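(* Let $R:(\mathcal C\times\mathcal C)^{op}\to\mathsf{Pos}$ be an extensional relational doctrine with quotients and let $\mathcal G$ be a full subcategory of $\mathcal C$, with inclusion functor $I_{\mathcal G}:\mathcal G\to\mathcal C$. Then $\mathcal G$ is an $R$-projective cover if and only if $R$ is equivalent to $(I_{\mathcal G}^\star R)^{eq}$ in $\mathbf{EQRD}$.
   Context: A relational doctrine consists of a category $\mathcal C$ (its base) and a functor $R:(\mathcal C\times\mathcal C)^{op}\to\mathsf{Pos}$ (posets and monotone maps; $R_{f,g}:R(X,Y)\to R(A,B)$ for $f:A\to X$, $g:B\to Y$), together with monotone maps $;:R(X,Y)\times R(Y,Z)\to R(X,Z)$, elements $\mathsf d_X\in R(X,X)$ and monotone maps $(-)^\bot:R(X,Y)\to R(Y,X)$ such that $\alpha;(\beta;\gamma)=(\alpha;\beta);\gamma$, $\mathsf d_X;\alpha=\alpha=\alpha;\mathsf d_Y$, $(\alpha;\beta)^\bot=\beta^\bot;\alpha^\bot$, $\mathsf d_X^\bot=\mathsf d_X$, $\alpha^{\bot\bot}=\alpha$, and $R_{f,g}(\alpha);R_{g,h}(\beta)\le R_{f,h}(\alpha;\beta)$, $\mathsf d_A\le R_{f,f}(\mathsf d_X)$ for $f:A\to X$, $(R_{f,g}(\alpha))^\bot\le R_{g,f}(\alpha^\bot)$. The graph of $f:X\to Y$ is $\Gamma_f=R_{f,\mathrm{id}_Y}(\mathsf d_Y)\in R(X,Y)$. $R$ is extensional if $\Gamma_f=\Gamma_g$ implies $f=g$ for all parallel $f,g$. Quotients.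 An $R$-equivalence relation on $X$ is $\rho\in R(X,X)$ with $\mathsf d_X\le\rho$, $\rho^\bot\le\rho$, $\rho;\rho\le\rho$. A quotient arrow of $\rho$ is $q:X\to W$ with $\rho\le\Gamma_q;\Gamma_q^\bot$ such that for every $f:X\to Z$ with $\rho\le\Gamma_f;\Gamma_f^\bot$ there is a unique $h:W\to Z$ with $f=h\circ q$; it is effective if $\rho=\Gamma_q;\Gamma_q^\bot$ and descent if $\Gamma_q^\bot;\Gamma_q=\mathsf d_W$. $R$ has quotients if every $R$-equivalence relation has an effective descent quotient arrow. "Quotient arrow" without further specification means quotient arrow of some $R$-equivalence relation. If $R$ has quotients, an object $P$ is $R$-projective if for every $f:P\to Y$ and every quotient arrow $q:X\to Y$ there is $h:P\to X$ with $f=q\circ h$. An $R$-projective cover is a full subcategory $\mathcal G$ of the base all of whose objects are $R$-projective and such that for every object $X$ of $\mathcal C$ there is a quotient arrow $P\to X$ with $P$ in $\mathcal G$. 2-categories. $\mathbf{RD}$ has relational doctrines as objects. A 1-arrow $F:R\to S$ (bases $\mathcal C,\mathcal D$) is a pair $\langle\widehat F,\overline F\rangle$ of a functor $\widehat F:\mathcal C\to\mathcal D$ and a natural family of monotone maps $\overline F_{X,Y}:R(X,Y)\to S(\widehat FX,\widehat FY)$ preserving $\mathsf d$, $;$ and $(-)^\bot$. A 2-arrow $\theta:F\Rightarrow G$ is a natural transformation $\theta:\widehat F\to\widehat G$ with $\overline F_{X,Y}(\alpha)\le S_{\theta_X,\theta_Y}(\overline G_{X,Y}(\alpha))$ for all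 $\alpha$. A 1-arrow $F:R\to S$ preserves quotients if whenever $q$ is a quotient arrow of an $R$-equivalence relation $\rho$ on $X$, $\widehat Fq$ is a quotient arrow of $\overline F_{X,X}(\rho)$. $\mathbf{EQRD}$ is the 2-category of extensional relational doctrines with quotients, quotient-preserving 1-arrows, and all 2-arrows of $\mathbf{RD}$ between them. Two objects $R,S$ of $\mathbf{EQRD}$ are equivalent in $\mathbf{EQRD}$ if there are 1-arrows $F:R\to S$ and $G:S\to R$ of $\mathbf{EQRD}$ and invertible 2-arrows $G\circ F\cong\mathrm{Id}_R$ and $F\circ G\cong\mathrm{Id}_S$. $I_{\mathcal G}^\star R$ is the restriction of $R$ to $\mathcal G$ (change of base along $I_{\mathcal G}$), i.e. the functor $R\circ(I_{\mathcal G}\times I_{\mathcal G})^{op}$ with relational operations inherited from $R$. Extensional quotient completion. For a relational doctrine $S$ on $\mathcal D$, the relational doctrine $S^{eq}$ has as base the category whose objects are pairs $\langle X,\rho\rangle$ with $X$ in $\mathcal D$ and $\rho$ an $S$-equivalence relation on $X$, and whose arrows $[f]:\langle X,\rho\rangle\to\langle Y,\sigma\rangle$ are classes of arrows $f:X\to Y$ with $\rho\le\Gamma_f;\sigma;\Gamma_f^\bot$, where $f\sim g$ iff $\rho\le\Gamma_f;\sigma;\Gamma_g^\bot$. Its fibres are $S^{eq}(\langle X,\rho\rangle,\langle Y,\sigma\rangle)=\{\alpha\in S(X,Y)\mid\rho;\alpha;\sigma\le\alpha\}$, with $S^{eq}_{[f],[g]}=S_{f,g}$, composition and converse as in $S$,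 and $\mathsf d_{\langle X,\rho\rangle}=\rho$. It is extensional and has quotients.
   Formalization: The equivalence is also required to be compatible with the inclusion: its 1-arrow from the completion to R, restricted along X ↦ ⟨X, d_X⟩, is isomorphic to the inclusion of I_G^*R in R. For a bare equivalence the "if" direction fails (discrete category on ℕ, G the positive numbers). *)

theory Defs
  imports Main
begin

section \<open>Categories\<close>

record ('o, 'a) cat =
  Obj :: "'o set"
  Arr :: "'a set"
  Dom :: "'a \<Rightarrow> 'o"
  Cod :: "'a \<Rightarrow> 'o"
  Ide :: "'o \<Rightarrow> 'a"
  Comp :: "'a \<Rightarrow> 'a \<Rightarrow> 'a"

text \<open>Composition is written in applicative order: \<open>Comp C g f\<close> is ``first \<open>f\<close>, then \<open>g\<close>''.\<close>

definition hom :: "('o, 'a, 'z) cat_scheme \<Rightarrow> 'o \<Rightarrow> 'o \<Rightarrow> 'a set"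
  where "hom C X Y = {f \<in> Arr C. Dom C f = X \<and> Cod C f = Y}"

locale category =
  fixes C :: "('o, 'a, 'z) cat_scheme"
  assumes Dom_closed: "f \<in> Arr C \<Longrightarrow> Dom C f \<in> Obj C"
    and Cod_closed: "f \<in> Arr C \<Longrightarrow> Cod C f \<in> Obj C"
    and Ide_hom: "X \<in> Obj C \<Longrightarrow> Ide C X \<in> hom C X X"
    and Comp_hom: "f \<in> hom C X Y \<Longrightarrow> g \<in> hom C Y Z \<Longrightarrow> Comp C g f \<in> hom C X Z"
    and Comp_Ide_left: "f \<in> hom C X Y \<Longrightarrow> Comp C (Ide C Y) f = f"
    and Comp_Ide_right: "f \<in> hom C X Y \<Longrightarrow> Comp C f (Ide C X) = f"
    and Comp_assoc: "f \<in> hom C X Y \<Longrightarrow> g \<in> hom C Y Z \<Longrightarrow> h \<in> hom C Z W \<Longrightarrow>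
      Comp C h (Comp C g f) = Comp C (Comp C h g) f"


section \<open>Relational doctrines\<close>

text \<open>
  The record extends that of the base category. The fibre over \<open>(X, Y)\<close> is the set
  \<open>Fib R X Y\<close> ordered by \<open>Le R X Y\<close>. Fibres need not be disjoint, so the operations carry the
  objects involved: \<open>Seq R X Y Z \<alpha> \<beta>\<close> is \<open>\<alpha> ; \<beta>\<close> for \<open>\<alpha>\<close> over \<open>(X, Y)\<close> and \<open>\<beta>\<close> over \<open>(Y, Z)\<close>,
  \<open>Dia R X\<close> is \<open>d\<^sub>X\<close>, \<open>Conv R X Y \<alpha>\<close> is the converse of \<open>\<alpha>\<close> over \<open>(X, Y)\<close>, and
  \<open>Reindex R f g\<close> maps the fibre over \<open>(Cod f, Cod g)\<close> to the one over \<open>(Dom f, Dom g)\<close>.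
\<close>

record ('o, 'a, 'r) reldoc = "('o, 'a) cat" +
  Fib :: "'o \<Rightarrow> 'o \<Rightarrow> 'r set"
  Le :: "'o \<Rightarrow> 'o \<Rightarrow> 'r \<Rightarrow> 'r \<Rightarrow> bool"
  Reindex :: "'a \<Rightarrow> 'a \<Rightarrow> 'r \<Rightarrow> 'r"
  Seq :: "'o \<Rightarrow> 'o \<Rightarrow> 'o \<Rightarrow> 'r \<Rightarrow> 'r \<Rightarrow> 'r"
  Dia :: "'o \<Rightarrow> 'r"
  Conv :: "'o \<Rightarrow> 'o \<Rightarrow> 'r \<Rightarrow> 'r"

locale relational_doctrine = category R
  for R :: "('o, 'a, 'r) reldoc" +
  assumes Le_refl: "X \<in> Obj R \<Longrightarrow> Y \<in> Obj R \<Longrightarrow> \<alpha> \<in> Fib R X Y \<Longrightarrow> Le R X Y \<alpha> \<alpha>"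
    and Le_trans: "X \<in> Obj R \<Longrightarrow> Y \<in> Obj R \<Longrightarrow>
      \<alpha> \<in> Fib R X Y \<Longrightarrow> \<beta> \<in> Fib R X Y \<Longrightarrow> \<gamma> \<in> Fib R X Y \<Longrightarrow>
      Le R X Y \<alpha> \<beta> \<Longrightarrow> Le R X Y \<beta> \<gamma> \<Longrightarrow> Le R X Y \<alpha> \<gamma>"
    and Le_antisym: "X \<in> Obj R \<Longrightarrow> Y \<in> Obj R \<Longrightarrow> \<alpha> \<in> Fib R X Y \<Longrightarrow> \<beta> \<in> Fib R X Y \<Longrightarrow>
      Le R X Y \<alpha> \<beta> \<Longrightarrow> Le R X Y \<beta> \<alpha> \<Longrightarrow> \<alpha> = \<beta>"
    and Reindex_closed: "f \<in> hom R A X \<Longrightarrow> g \<in> hom R B Y \<Longrightarrow> \<alpha> \<in> Fib R X Y \<Longrightarrow>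
      Reindex R f g \<alpha> \<in> Fib R A B"
    and Reindex_mono: "f \<in> hom R A X \<Longrightarrow> g \<in> hom R B Y \<Longrightarrow>
      \<alpha> \<in> Fib R X Y \<Longrightarrow> \<beta> \<in> Fib R X Y \<Longrightarrow> Le R X Y \<alpha> \<beta> \<Longrightarrow>
      Le R A B (Reindex R f g \<alpha>) (Reindex R f g \<beta>)"
    and Reindex_Ide: "X \<in> Obj R \<Longrightarrow> Y \<in> Obj R \<Longrightarrow> \<alpha> \<in> Fib R X Y \<Longrightarrow>
      Reindex R (Ide R X) (Ide R Y) \<alpha> = \<alpha>"
    and Reindex_Comp: "f' \<in> hom R A' A \<Longrightarrow> f \<in> hom R A X \<Longrightarrow>
      g' \<in> hom R B' B \<Longrightarrow> g \<in> hom R B Y \<Longrightarrow> \<alpha> \<in> Fib R X Y \<Longrightarrow>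
      Reindex R (Comp R f f') (Comp R g g') \<alpha> = Reindex R f' g' (Reindex R f g \<alpha>)"
    and Seq_closed: "X \<in> Obj R \<Longrightarrow> Y \<in> Obj R \<Longrightarrow> Z \<in> Obj R \<Longrightarrow>
      \<alpha> \<in> Fib R X Y \<Longrightarrow> \<beta> \<in> Fib R Y Z \<Longrightarrow> Seq R X Y Z \<alpha> \<beta> \<in> Fib R X Z"
    and Seq_mono: "X \<in> Obj R \<Longrightarrow> Y \<in> Obj R \<Longrightarrow> Z \<in> Obj R \<Longrightarrow>
      \<alpha> \<in> Fib R X Y \<Longrightarrow> \<alpha>' \<in> Fib R X Y \<Longrightarrow> \<beta> \<in> Fib R Y Z \<Longrightarrow> \<beta>' \<in> Fib R Y Z \<Longrightarrow>
      Le R X Y \<alpha> \<alpha>' \<Longrightarrow> Le R Y Z \<beta> \<beta>' \<Longrightarrow> Le R X Z (Seq R X Y Z \<alpha> \<beta>) (Seq R X Y Z \<alpha>' \<beta>')"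
    and Dia_closed: "X \<in> Obj R \<Longrightarrow> Dia R X \<in> Fib R X X"
    and Conv_closed: "X \<in> Obj R \<Longrightarrow> Y \<in> Obj R \<Longrightarrow> \<alpha> \<in> Fib R X Y \<Longrightarrow>
      Conv R X Y \<alpha> \<in> Fib R Y X"
    and Conv_mono: "X \<in> Obj R \<Longrightarrow> Y \<in> Obj R \<Longrightarrow> \<alpha> \<in> Fib R X Y \<Longrightarrow> \<beta> \<in> Fib R X Y \<Longrightarrow>
      Le R X Y \<alpha> \<beta> \<Longrightarrow> Le R Y X (Conv R X Y \<alpha>) (Conv R X Y \<beta>)"
    and Seq_assoc: "X \<in> Obj R \<Longrightarrow> Y \<in> Obj R \<Longrightarrow> Z \<in> Obj R \<Longrightarrow> W \<in> Obj R \<Longrightarrow>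
      \<alpha> \<in> Fib R X Y \<Longrightarrow> \<beta> \<in> Fib R Y Z \<Longrightarrow> \<gamma> \<in> Fib R Z W \<Longrightarrow>
      Seq R X Y W \<alpha> (Seq R Y Z W \<beta> \<gamma>) = Seq R X Z W (Seq R X Y Z \<alpha> \<beta>) \<gamma>"
    and Seq_Dia_left: "X \<in> Obj R \<Longrightarrow> Y \<in> Obj R \<Longrightarrow> \<alpha> \<in> Fib R X Y \<Longrightarrow>
      Seq R X X Y (Dia R X) \<alpha> = \<alpha>"
    and Seq_Dia_right: "X \<in> Obj R \<Longrightarrow> Y \<in> Obj R \<Longrightarrow> \<alpha> \<in> Fib R X Y \<Longrightarrow>
      Seq R X Y Y \<alpha> (Dia R Y) = \<alpha>"
    and Conv_Seq: "X \<in> Obj R \<Longrightarrow> Y \<in> Obj R \<Longrightarrow> Z \<in> Obj R \<Longrightarrow>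
      \<alpha> \<in> Fib R X Y \<Longrightarrow> \<beta> \<in> Fib R Y Z \<Longrightarrow>
      Conv R X Z (Seq R X Y Z \<alpha> \<beta>) = Seq R Z Y X (Conv R Y Z \<beta>) (Conv R X Y \<alpha>)"
    and Conv_Dia: "X \<in> Obj R \<Longrightarrow> Conv R X X (Dia R X) = Dia R X"
    and Conv_Conv: "X \<in> Obj R \<Longrightarrow> Y \<in> Obj R \<Longrightarrow> \<alpha> \<in> Fib R X Y \<Longrightarrow>
      Conv R Y X (Conv R X Y \<alpha>) = \<alpha>"
    and Seq_Reindex: "f \<in> hom R A X \<Longrightarrow> g \<in> hom R B Y \<Longrightarrow> h \<in> hom R D Z \<Longrightarrow>
      \<alpha> \<in> Fib R X Y \<Longrightarrow> \<beta> \<in> Fib R Y Z \<Longrightarrow>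
      Le R A D (Seq R A B D (Reindex R f g \<alpha>) (Reindex R g h \<beta>))
        (Reindex R f h (Seq R X Y Z \<alpha> \<beta>))"
    and Dia_Reindex: "f \<in> hom R A X \<Longrightarrow> Le R A A (Dia R A) (Reindex R f f (Dia R X))"
    and Conv_Reindex: "f \<in> hom R A X \<Longrightarrow> g \<in> hom R B Y \<Longrightarrow> \<alpha> \<in> Fib R X Y \<Longrightarrow>
      Le R B A (Conv R A B (Reindex R f g \<alpha>)) (Reindex R g f (Conv R X Y \<alpha>))"

definition graph :: "('o, 'a, 'r) reldoc \<Rightarrow> 'a \<Rightarrow> 'r"
  where "graph R f = Reindex R f (Ide R (Cod R f)) (Dia R (Cod R f))"

definition cograph :: "('o, 'a, 'r) reldoc \<Rightarrow> 'a \<Rightarrow> 'r"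
  where "cograph R f = Conv R (Dom R f) (Cod R f) (graph R f)"

definition extensional :: "('o, 'a, 'r) reldoc \<Rightarrow> bool"
  where "extensional R \<longleftrightarrow>
    (\<forall>f\<in>Arr R. \<forall>g\<in>Arr R. Dom R f = Dom R g \<longrightarrow> Cod R f = Cod R g \<longrightarrow>
      graph R f = graph R g \<longrightarrow> f = g)"


section \<open>Quotients and projective covers\<close>

definition equivalence_rel :: "('o, 'a, 'r) reldoc \<Rightarrow> 'o \<Rightarrow> 'r \<Rightarrow> bool"
  where "equivalence_rel R X \<rho> \<longleftrightarrow>
    \<rho> \<in> Fib R X X \<and> Le R X X (Dia R X) \<rho> \<and> Le R X X (Conv R X X \<rho>) \<rho> \<and>
    Le R X X (Seq R X X X \<rho> \<rho>) \<rho>"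

definition kernel :: "('o, 'a, 'r) reldoc \<Rightarrow> 'a \<Rightarrow> 'r"
  where "kernel R f = Seq R (Dom R f) (Cod R f) (Dom R f) (graph R f) (cograph R f)"

definition quotient_arrow :: "('o, 'a, 'r) reldoc \<Rightarrow> 'o \<Rightarrow> 'r \<Rightarrow> 'a \<Rightarrow> bool"
  where "quotient_arrow R X \<rho> q \<longleftrightarrow>
    X \<in> Obj R \<and> equivalence_rel R X \<rho> \<and>
    q \<in> Arr R \<and> Dom R q = X \<and> Le R X X \<rho> (kernel R q) \<and>
    (\<forall>f\<in>Arr R. Dom R f = X \<and> Le R X X \<rho> (kernel R f) \<longrightarrow>
      (\<exists>!h. h \<in> hom R (Cod R q) (Cod R f) \<and> f = Comp R h q))"

definition effective :: "('o, 'a, 'r) reldoc \<Rightarrow> 'r \<Rightarrow> 'a \<Rightarrow> bool"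
  where "effective R \<rho> q \<longleftrightarrow> \<rho> = kernel R q"

definition descent :: "('o, 'a, 'r) reldoc \<Rightarrow> 'a \<Rightarrow> bool"
  where "descent R q \<longleftrightarrow>
    Seq R (Cod R q) (Dom R q) (Cod R q) (cograph R q) (graph R q) = Dia R (Cod R q)"

definition has_quotients :: "('o, 'a, 'r) reldoc \<Rightarrow> bool"
  where "has_quotients R \<longleftrightarrow>
    (\<forall>X\<in>Obj R. \<forall>\<rho>. equivalence_rel R X \<rho> \<longrightarrow>
      (\<exists>q. quotient_arrow R X \<rho> q \<and> effective R \<rho> q \<and> descent R q))"

definition is_quotient_arrow :: "('o, 'a, 'r) reldoc \<Rightarrow> 'a \<Rightarrow> bool"
  where "is_quotient_arrow R q \<longleftrightarrow> (\<exists>\<rho>. quotient_arrow R (Dom R q) \<rho> q)"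

definition projective :: "('o, 'a, 'r) reldoc \<Rightarrow> 'o \<Rightarrow> bool"
  where "projective R P \<longleftrightarrow> P \<in> Obj R \<and>
    (\<forall>f q. f \<in> Arr R \<and> Dom R f = P \<and> is_quotient_arrow R q \<and> Cod R q = Cod R f \<longrightarrow>
      (\<exists>h. h \<in> hom R P (Dom R q) \<and> f = Comp R q h))"

text \<open>A full subcategory is given by its set of objects.\<close>

definition projective_cover :: "('o, 'a, 'r) reldoc \<Rightarrow> 'o set \<Rightarrow> bool"
  where "projective_cover R \<G> \<longleftrightarrow> \<G> \<subseteq> Obj R \<and> (\<forall>P\<in>\<G>. projective R P) \<and>
    (\<forall>X\<in>Obj R. \<exists>P\<in>\<G>. \<exists>q. q \<in> hom R P X \<and> is_quotient_arrow R q)"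

definition restriction :: "('o, 'a, 'r) reldoc \<Rightarrow> 'o set \<Rightarrow> ('o, 'a, 'r) reldoc"
  where "restriction R \<G> = R\<lparr>Obj := \<G>, Arr := {f \<in> Arr R. Dom R f \<in> \<G> \<and> Cod R f \<in> \<G>}\<rparr>"


section \<open>The 2-categories RD and EQRD\<close>

record ('o, 'a, 'r, 'p, 'b, 's) onearrow =
  ObMap :: "'o \<Rightarrow> 'p"
  ArMap :: "'a \<Rightarrow> 'b"
  RelMap :: "'o \<Rightarrow> 'o \<Rightarrow> 'r \<Rightarrow> 's"

locale rd_arrow = src: relational_doctrine R + tgt: relational_doctrine S
  for R :: "('o, 'a, 'r) reldoc" and S :: "('p, 'b, 's) reldoc"
    and F :: "('o, 'a, 'r, 'p, 'b, 's) onearrow" +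
  assumes ObMap_closed: "X \<in> Obj R \<Longrightarrow> ObMap F X \<in> Obj S"
    and ArMap_hom: "f \<in> hom R X Y \<Longrightarrow> ArMap F f \<in> hom S (ObMap F X) (ObMap F Y)"
    and ArMap_Ide: "X \<in> Obj R \<Longrightarrow> ArMap F (Ide R X) = Ide S (ObMap F X)"
    and ArMap_Comp: "f \<in> hom R X Y \<Longrightarrow> g \<in> hom R Y Z \<Longrightarrow>
      ArMap F (Comp R g f) = Comp S (ArMap F g) (ArMap F f)"
    and RelMap_closed: "X \<in> Obj R \<Longrightarrow> Y \<in> Obj R \<Longrightarrow> \<alpha> \<in> Fib R X Y \<Longrightarrow>
      RelMap F X Y \<alpha> \<in> Fib S (ObMap F X) (ObMap F Y)"
    and RelMap_mono: "X \<in> Obj R \<Longrightarrow> Y \<in> Obj R \<Longrightarrow> \<alpha> \<in> Fib R X Y \<Longrightarrow> \<beta> \<in> Fib R X Y \<Longrightarrow>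
      Le R X Y \<alpha> \<beta> \<Longrightarrow> Le S (ObMap F X) (ObMap F Y) (RelMap F X Y \<alpha>) (RelMap F X Y \<beta>)"
    and RelMap_natural: "f \<in> hom R A X \<Longrightarrow> g \<in> hom R B Y \<Longrightarrow> \<alpha> \<in> Fib R X Y \<Longrightarrow>
      RelMap F A B (Reindex R f g \<alpha>) = Reindex S (ArMap F f) (ArMap F g) (RelMap F X Y \<alpha>)"
    and RelMap_Dia: "X \<in> Obj R \<Longrightarrow> RelMap F X X (Dia R X) = Dia S (ObMap F X)"
    and RelMap_Seq: "X \<in> Obj R \<Longrightarrow> Y \<in> Obj R \<Longrightarrow> Z \<in> Obj R \<Longrightarrow>
      \<alpha> \<in> Fib R X Y \<Longrightarrow> \<beta> \<in> Fib R Y Z \<Longrightarrow>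
      RelMap F X Z (Seq R X Y Z \<alpha> \<beta>) =
        Seq S (ObMap F X) (ObMap F Y) (ObMap F Z) (RelMap F X Y \<alpha>) (RelMap F Y Z \<beta>)"
    and RelMap_Conv: "X \<in> Obj R \<Longrightarrow> Y \<in> Obj R \<Longrightarrow> \<alpha> \<in> Fib R X Y \<Longrightarrow>
      RelMap F Y X (Conv R X Y \<alpha>) = Conv S (ObMap F X) (ObMap F Y) (RelMap F X Y \<alpha>)"

definition id_arrow :: "('o, 'a, 'r, 'o, 'a, 'r) onearrow"
  where "id_arrow = \<lparr>ObMap = (\<lambda>X. X), ArMap = (\<lambda>f. f), RelMap = (\<lambda>X Y \<alpha>. \<alpha>)\<rparr>"

definition comp_arrow ::
  "('p, 'b, 's, 'q, 'c, 't) onearrow \<Rightarrow> ('o, 'a, 'r, 'p, 'b, 's) onearrow \<Rightarrow>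
    ('o, 'a, 'r, 'q, 'c, 't) onearrow"
  where "comp_arrow G F =
    \<lparr>ObMap = (\<lambda>X. ObMap G (ObMap F X)),
     ArMap = (\<lambda>f. ArMap G (ArMap F f)),
     RelMap = (\<lambda>X Y \<alpha>. RelMap G (ObMap F X) (ObMap F Y) (RelMap F X Y \<alpha>))\<rparr>"

definition two_arrow ::
  "('o, 'a, 'r) reldoc \<Rightarrow> ('p, 'b, 's) reldoc \<Rightarrow> ('o, 'a, 'r, 'p, 'b, 's) onearrow \<Rightarrow>
    ('o, 'a, 'r, 'p, 'b, 's) onearrow \<Rightarrow> ('o \<Rightarrow> 'b) \<Rightarrow> bool"
  where "two_arrow R S F G \<theta> \<longleftrightarrow>
    (\<forall>X\<in>Obj R. \<theta> X \<in> hom S (ObMap F X) (ObMap G X)) \<and>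
    (\<forall>f\<in>Arr R. Comp S (\<theta> (Cod R f)) (ArMap F f) = Comp S (ArMap G f) (\<theta> (Dom R f))) \<and>
    (\<forall>X\<in>Obj R. \<forall>Y\<in>Obj R. \<forall>\<alpha>\<in>Fib R X Y.
      Le S (ObMap F X) (ObMap F Y) (RelMap F X Y \<alpha>) (Reindex S (\<theta> X) (\<theta> Y) (RelMap G X Y \<alpha>)))"

text \<open>Existence of an invertible 2-arrow between two 1-arrows.\<close>

definition iso_arrows ::
  "('o, 'a, 'r) reldoc \<Rightarrow> ('p, 'b, 's) reldoc \<Rightarrow> ('o, 'a, 'r, 'p, 'b, 's) onearrow \<Rightarrow>
    ('o, 'a, 'r, 'p, 'b, 's) onearrow \<Rightarrow> bool"
  where "iso_arrows R S F G \<longleftrightarrow> (\<exists>\<theta> \<theta>'. two_arrow R S F G \<theta> \<and> two_arrow R S G F \<theta>' \<and>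
    (\<forall>X\<in>Obj R. Comp S (\<theta>' X) (\<theta> X) = Ide S (ObMap F X) \<and>
      Comp S (\<theta> X) (\<theta>' X) = Ide S (ObMap G X)))"

definition preserves_quotients ::
  "('o, 'a, 'r) reldoc \<Rightarrow> ('p, 'b, 's) reldoc \<Rightarrow> ('o, 'a, 'r, 'p, 'b, 's) onearrow \<Rightarrow> bool"
  where "preserves_quotients R S F \<longleftrightarrow>
    (\<forall>X \<rho> q. quotient_arrow R X \<rho> q \<longrightarrow>
      quotient_arrow S (ObMap F X) (RelMap F X X \<rho>) (ArMap F q))"

definition EQRD_object :: "('o, 'a, 'r) reldoc \<Rightarrow> bool"
  where "EQRD_object R \<longleftrightarrow> relational_doctrine R \<and> extensional R \<and> has_quotients R"

definition EQRD_arrow ::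
  "('o, 'a, 'r) reldoc \<Rightarrow> ('p, 'b, 's) reldoc \<Rightarrow> ('o, 'a, 'r, 'p, 'b, 's) onearrow \<Rightarrow> bool"
  where "EQRD_arrow R S F \<longleftrightarrow>
    EQRD_object R \<and> EQRD_object S \<and> rd_arrow R S F \<and> preserves_quotients R S F"

definition EQRD_equivalence ::
  "('o, 'a, 'r) reldoc \<Rightarrow> ('p, 'b, 's) reldoc \<Rightarrow> ('o, 'a, 'r, 'p, 'b, 's) onearrow \<Rightarrow>
    ('p, 'b, 's, 'o, 'a, 'r) onearrow \<Rightarrow> bool"
  where "EQRD_equivalence R S F G \<longleftrightarrow>
    EQRD_arrow R S F \<and> EQRD_arrow S R G \<and>
    iso_arrows R R (comp_arrow G F) id_arrow \<and> iso_arrows S S (comp_arrow F G) id_arrow"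


section \<open>Extensional quotient completion\<close>

text \<open>\<open>between S (X, \<rho>) (Y, \<sigma>) f g\<close> says \<open>\<rho> \<le> \<Gamma>\<^sub>f ; \<sigma> ; (\<Gamma>\<^sub>g)\<^sup>\<bottom>\<close>, for parallel \<open>f, g : X \<rightarrow> Y\<close>.\<close>

definition between :: "('o, 'a, 'r) reldoc \<Rightarrow> 'o \<times> 'r \<Rightarrow> 'o \<times> 'r \<Rightarrow> 'a \<Rightarrow> 'a \<Rightarrow> bool"
  where "between S = (\<lambda>(X, \<rho>) (Y, \<sigma>) f g.
    Le S X X \<rho> (Seq S X Y X (Seq S X Y Y (graph S f) \<sigma>) (cograph S g)))"

definition eq_rel :: "('o, 'a, 'r) reldoc \<Rightarrow> 'o \<times> 'r \<Rightarrow> 'o \<times> 'r \<Rightarrow> ('a \<times> 'a) set"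
  where "eq_rel S A B = {(f, g). f \<in> hom S (fst A) (fst B) \<and> g \<in> hom S (fst A) (fst B) \<and>
    between S A B f f \<and> between S A B g g \<and> between S A B f g}"

text \<open>
  An arrow of the completion is a triple of its domain, an equivalence class of arrows of \<open>S\<close>, and
  its codomain; \<open>eq_arr S A B f\<close> is \<open>[f] : A \<rightarrow> B\<close>. Composition and reindexing, which do not depend
  on representatives, are computed on chosen ones.
\<close>

type_synonym ('o, 'a, 'r) eq_arrow = "('o \<times> 'r) \<times> 'a set \<times> ('o \<times> 'r)"

definition eq_arr :: "('o, 'a, 'r) reldoc \<Rightarrow> 'o \<times> 'r \<Rightarrow> 'o \<times> 'r \<Rightarrow> 'a \<Rightarrow> ('o, 'a, 'r) eq_arrow"
  where "eq_arr S A B f = (A, eq_rel S A B `` {f}, B)"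

definition eq_dom :: "('o, 'a, 'r) eq_arrow \<Rightarrow> 'o \<times> 'r"
  where "eq_dom = fst"

definition eq_cod :: "('o, 'a, 'r) eq_arrow \<Rightarrow> 'o \<times> 'r"
  where "eq_cod = (\<lambda>\<phi>. snd (snd \<phi>))"

definition eq_rep :: "('o, 'a, 'r) eq_arrow \<Rightarrow> 'a"
  where "eq_rep \<phi> = (SOME f. f \<in> fst (snd \<phi>))"

definition eq_obj :: "('o, 'a, 'r) reldoc \<Rightarrow> ('o \<times> 'r) set"
  where "eq_obj S = {(X, \<rho>). X \<in> Obj S \<and> equivalence_rel S X \<rho>}"

definition eq_completion ::
  "('o, 'a, 'r) reldoc \<Rightarrow> ('o \<times> 'r, ('o, 'a, 'r) eq_arrow, 'r) reldoc"
  where "eq_completion S =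
    \<lparr>Obj = eq_obj S,
     Arr = {eq_arr S A B f | A B f.
       A \<in> eq_obj S \<and> B \<in> eq_obj S \<and> f \<in> hom S (fst A) (fst B) \<and> between S A B f f},
     Dom = eq_dom,
     Cod = eq_cod,
     Ide = (\<lambda>A. eq_arr S A A (Ide S (fst A))),
     Comp = (\<lambda>\<psi> \<phi>. eq_arr S (eq_dom \<phi>) (eq_cod \<psi>) (Comp S (eq_rep \<psi>) (eq_rep \<phi>))),
     Fib = (\<lambda>(X, \<rho>) (Y, \<sigma>). {\<alpha> \<in> Fib S X Y. Le S X Y (Seq S X Y Y (Seq S X X Y \<rho> \<alpha>) \<sigma>) \<alpha>}),
     Le = (\<lambda>A B. Le S (fst A) (fst B)),
     Reindex = (\<lambda>\<phi> \<psi>. Reindex S (eq_rep \<phi>) (eq_rep \<psi>)),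
     Seq = (\<lambda>A B C. Seq S (fst A) (fst B) (fst C)),
     Dia = snd,
     Conv = (\<lambda>A B. Conv S (fst A) (fst B))\<rparr>"

text \<open>The canonical 1-arrow of RD from \<open>S\<close> to its completion, sending \<open>X\<close> to \<open>(X, d\<^sub>X)\<close>.\<close>

definition eq_unit :: "('o, 'a, 'r) reldoc \<Rightarrow>
    ('o, 'a, 'r, 'o \<times> 'r, ('o, 'a, 'r) eq_arrow, 'r) onearrow"
  where "eq_unit S =
    \<lparr>ObMap = (\<lambda>X. (X, Dia S X)),
     ArMap = (\<lambda>f. eq_arr S (Dom S f, Dia S (Dom S f)) (Cod S f, Dia S (Cod S f)) f),
     RelMap = (\<lambda>X Y \<alpha>. \<alpha>)\<rparr>"

text \<open>The inclusion 1-arrow \<open>restriction R \<G> \<rightarrow> R\<close> has the identity functions as components.\<close>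

abbreviation inclusion :: "('o, 'a, 'r, 'o, 'a, 'r) onearrow"
  where "inclusion \<equiv> id_arrow"

text \<open>
  A pitfall when comparing \<open>R\<close> with \<open>eq_completion (restriction R \<G>)\<close>: the mere existence of an
  \<open>EQRD_equivalence\<close> between them does not make \<open>\<G>\<close> a projective cover. For instance, let the
  base be the discrete category on the natural numbers, with a singleton fibre over each \<open>(n, n)\<close>
  and the other fibres empty, and let \<open>\<G>\<close> be the positive numbers: the shift gives an equivalence,
  but there is no arrow from an object of \<open>\<G>\<close> to \<open>0\<close>. The equivalence has to be taken over the
  inclusion of \<open>\<G>\<close>: its 1-arrow from the completion to \<open>R\<close> extends \<open>inclusion\<close> along \<open>eq_unit\<close>
  up to an invertible 2-arrow, that is, by the universal property of the completion, it is the
  comparison 1-arrow induced by the inclusion.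
\<close>

end

theory Submission
  imports Defs
begin

text \<open>
  In a relational doctrine reindexing is composition with graphs,
  \<open>R\<^sub>f\<^sub>,\<^sub>g(\<alpha>) = \<Gamma>\<^sub>f ; \<alpha> ; \<Gamma>\<^sub>g\<^sup>\<bottom>\<close>, and in an extensional one an arrow is its graph. So functors and
  natural transformations are determined by what they do to relations, and functoriality and
  naturality reduce to identities between relations.

  Let \<open>\<G>\<close> be a projective cover, and let \<open>p : P \<rightarrow> X\<close>, \<open>p' : P' \<rightarrow> X'\<close> be quotient arrows with \<open>P\<close> and
  \<open>P'\<close> in \<open>\<G>\<close>. Since they are effective descent, \<open>\<alpha> \<mapsto> \<Gamma>\<^sub>p ; \<alpha> ; \<Gamma>\<^sub>p\<^sub>'\<^sup>\<bottom>\<close> is an isomorphism from \<open>R(X, X')\<close> to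
  the fibre of the completion over \<open>(P, ker p)\<close> and \<open>(P', ker p')\<close>; projectivity of \<open>P\<close> and the
  universal property of \<open>p\<close> show that it preserves and reflects graphs of arrows. Choosing a
  quotient arrow from an object of \<open>\<G>\<close> onto every \<open>X\<close>, and a quotient of every \<open>(P, \<rho>)\<close>, gives
  the two 1-arrows of the equivalence.

  Conversely, in the completion the objects \<open>(X, d\<^sub>X)\<close> are projective and the identity of \<open>X\<close>
  represents a quotient arrow \<open>(X, d\<^sub>X) \<rightarrow> (X, \<rho>)\<close>; both facts transport along the equivalence.
\<close>

section \<open>Relations and graphs\<close>

text \<open>Arrows of the completion are classes handled through chosen representatives, so checking
  its axioms directly would mean tracking representatives everywhere. The laws of the fibres mention
  no arrows and can be established first; \<open>fibres\<close> isolates them. A faithful assignment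
  of total, functional relations to arrows, compatible with identities, composition and reindexing,
  then yields the remaining axioms. In the comparison, the choice of covers and the choice of
  quotients are independent of each other. They fit together because two quotient arrows out of
  \<open>\<G>\<close> are compared canonically as soon as they share their kernel or their codomain.
  Identities of objects of \<open>\<G>\<close> count among these quotient arrows, and this places
  the equivalence over the inclusion. In the converse direction, the equivalence by itself speaks of
  the images of the objects \<open>(P, d\<^sub>P)\<close>; the isomorphism with the inclusion
  identifies these images with the objects P of \<open>\<G>\<close>.\<close>

locale fibres =
  fixes R :: "('o, 'a, 'r) reldoc"
  assumes le_refl: "X \<in> Obj R \<Longrightarrow> Y \<in> Obj R \<Longrightarrow> \<alpha> \<in> Fib R X Y \<Longrightarrow> Le R X Y \<alpha> \<alpha>"
    and le_trans: "X \<in> Obj R \<Longrightarrow> Y \<in> Obj R \<Longrightarrow>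
      \<alpha> \<in> Fib R X Y \<Longrightarrow> \<beta> \<in> Fib R X Y \<Longrightarrow> \<gamma> \<in> Fib R X Y \<Longrightarrow>
      Le R X Y \<alpha> \<beta> \<Longrightarrow> Le R X Y \<beta> \<gamma> \<Longrightarrow> Le R X Y \<alpha> \<gamma>"
    and le_antisym: "X \<in> Obj R \<Longrightarrow> Y \<in> Obj R \<Longrightarrow> \<alpha> \<in> Fib R X Y \<Longrightarrow> \<beta> \<in> Fib R X Y \<Longrightarrow>
      Le R X Y \<alpha> \<beta> \<Longrightarrow> Le R X Y \<beta> \<alpha> \<Longrightarrow> \<alpha> = \<beta>"
    and seq_closed [simp]: "X \<in> Obj R \<Longrightarrow> Y \<in> Obj R \<Longrightarrow> Z \<in> Obj R \<Longrightarrow>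
      \<alpha> \<in> Fib R X Y \<Longrightarrow> \<beta> \<in> Fib R Y Z \<Longrightarrow> Seq R X Y Z \<alpha> \<beta> \<in> Fib R X Z"
    and seq_mono: "X \<in> Obj R \<Longrightarrow> Y \<in> Obj R \<Longrightarrow> Z \<in> Obj R \<Longrightarrow>
      \<alpha> \<in> Fib R X Y \<Longrightarrow> \<alpha>' \<in> Fib R X Y \<Longrightarrow> \<beta> \<in> Fib R Y Z \<Longrightarrow> \<beta>' \<in> Fib R Y Z \<Longrightarrow>
      Le R X Y \<alpha> \<alpha>' \<Longrightarrow> Le R Y Z \<beta> \<beta>' \<Longrightarrow> Le R X Z (Seq R X Y Z \<alpha> \<beta>) (Seq R X Y Z \<alpha>' \<beta>')"
    and dia_closed [simp]: "X \<in> Obj R \<Longrightarrow> Dia R X \<in> Fib R X X"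
    and conv_closed [simp]: "X \<in> Obj R \<Longrightarrow> Y \<in> Obj R \<Longrightarrow> \<alpha> \<in> Fib R X Y \<Longrightarrow>
      Conv R X Y \<alpha> \<in> Fib R Y X"
    and conv_mono: "X \<in> Obj R \<Longrightarrow> Y \<in> Obj R \<Longrightarrow> \<alpha> \<in> Fib R X Y \<Longrightarrow> \<beta> \<in> Fib R X Y \<Longrightarrow>
      Le R X Y \<alpha> \<beta> \<Longrightarrow> Le R Y X (Conv R X Y \<alpha>) (Conv R X Y \<beta>)"
    and seq_assoc [simp]: "X \<in> Obj R \<Longrightarrow> Y \<in> Obj R \<Longrightarrow> Z \<in> Obj R \<Longrightarrow> W \<in> Obj R \<Longrightarrow>
      \<alpha> \<in> Fib R X Y \<Longrightarrow> \<beta> \<in> Fib R Y Z \<Longrightarrow> \<gamma> \<in> Fib R Z W \<Longrightarrow>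
      Seq R X Z W (Seq R X Y Z \<alpha> \<beta>) \<gamma> = Seq R X Y W \<alpha> (Seq R Y Z W \<beta> \<gamma>)"
    and seq_dia_left [simp]: "X \<in> Obj R \<Longrightarrow> Y \<in> Obj R \<Longrightarrow> \<alpha> \<in> Fib R X Y \<Longrightarrow>
      Seq R X X Y (Dia R X) \<alpha> = \<alpha>"
    and seq_dia_right [simp]: "X \<in> Obj R \<Longrightarrow> Y \<in> Obj R \<Longrightarrow> \<alpha> \<in> Fib R X Y \<Longrightarrow>
      Seq R X Y Y \<alpha> (Dia R Y) = \<alpha>"
    and conv_seq [simp]: "X \<in> Obj R \<Longrightarrow> Y \<in> Obj R \<Longrightarrow> Z \<in> Obj R \<Longrightarrow>
      \<alpha> \<in> Fib R X Y \<Longrightarrow> \<beta> \<in> Fib R Y Z \<Longrightarrow>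
      Conv R X Z (Seq R X Y Z \<alpha> \<beta>) = Seq R Z Y X (Conv R Y Z \<beta>) (Conv R X Y \<alpha>)"
    and conv_dia [simp]: "X \<in> Obj R \<Longrightarrow> Conv R X X (Dia R X) = Dia R X"
    and conv_conv [simp]: "X \<in> Obj R \<Longrightarrow> Y \<in> Obj R \<Longrightarrow> \<alpha> \<in> Fib R X Y \<Longrightarrow>
      Conv R Y X (Conv R X Y \<alpha>) = \<alpha>"
begin

text \<open>Bundles the order with the typing of both sides, so that chains of inequalities compose
  without side conditions.\<close>

definition leq :: "'o \<Rightarrow> 'o \<Rightarrow> 'r \<Rightarrow> 'r \<Rightarrow> bool"
  where "leq X Y \<alpha> \<beta> \<longleftrightarrow>
    X \<in> Obj R \<and> Y \<in> Obj R \<and> \<alpha> \<in> Fib R X Y \<and> \<beta> \<in> Fib R X Y \<and> Le R X Y \<alpha> \<beta>"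

lemma leqI: "X \<in> Obj R \<Longrightarrow> Y \<in> Obj R \<Longrightarrow> \<alpha> \<in> Fib R X Y \<Longrightarrow> \<beta> \<in> Fib R X Y \<Longrightarrow>
    Le R X Y \<alpha> \<beta> \<Longrightarrow> leq X Y \<alpha> \<beta>"
  by (simp add: leq_def)

lemma leqD: "leq X Y \<alpha> \<beta> \<Longrightarrow> Le R X Y \<alpha> \<beta>"
  by (simp add: leq_def)

lemma leq_refl: "X \<in> Obj R \<Longrightarrow> Y \<in> Obj R \<Longrightarrow> \<alpha> \<in> Fib R X Y \<Longrightarrow> leq X Y \<alpha> \<alpha>"
  by (simp add: leq_def le_refl)

lemma leq_trans [trans]: "leq X Y \<alpha> \<beta> \<Longrightarrow> leq X Y \<beta> \<gamma> \<Longrightarrow> leq X Y \<alpha> \<gamma>"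
  unfolding leq_def by (blast intro: le_trans)

lemma leq_antisym: "leq X Y \<alpha> \<beta> \<Longrightarrow> leq X Y \<beta> \<alpha> \<Longrightarrow> \<alpha> = \<beta>"
  unfolding leq_def by (blast intro: le_antisym)

lemma leq_seq: "leq X Y \<alpha> \<alpha>' \<Longrightarrow> leq Y Z \<beta> \<beta>' \<Longrightarrow>
    leq X Z (Seq R X Y Z \<alpha> \<beta>) (Seq R X Y Z \<alpha>' \<beta>')"
  unfolding leq_def by (blast intro: seq_mono seq_closed)

lemma leq_seq_left: "leq X Y \<alpha> \<alpha>' \<Longrightarrow> Z \<in> Obj R \<Longrightarrow> \<beta> \<in> Fib R Y Z \<Longrightarrow>
    leq X Z (Seq R X Y Z \<alpha> \<beta>) (Seq R X Y Z \<alpha>' \<beta>)"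
  by (rule leq_seq) (auto simp: leq_def intro: le_refl)

lemma leq_seq_right: "leq Y Z \<beta> \<beta>' \<Longrightarrow> X \<in> Obj R \<Longrightarrow> \<alpha> \<in> Fib R X Y \<Longrightarrow>
    leq X Z (Seq R X Y Z \<alpha> \<beta>) (Seq R X Y Z \<alpha> \<beta>')"
  by (rule leq_seq) (auto simp: leq_def intro: le_refl)

lemma leq_conv: "leq X Y \<alpha> \<beta> \<Longrightarrow> leq Y X (Conv R X Y \<alpha>) (Conv R X Y \<beta>)"
  unfolding leq_def by (simp add: conv_mono)

lemma leq_seq_dia_left: "leq X X (Dia R X) \<epsilon> \<Longrightarrow> Y \<in> Obj R \<Longrightarrow> \<alpha> \<in> Fib R X Y \<Longrightarrow>
    leq X Y \<alpha> (Seq R X X Y \<epsilon> \<alpha>)"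
  using leq_seq_left[of X X "Dia R X" \<epsilon> Y \<alpha>] by (simp add: leq_def)

lemma leq_seq_dia_right: "leq Y Y (Dia R Y) \<epsilon> \<Longrightarrow> X \<in> Obj R \<Longrightarrow> \<alpha> \<in> Fib R X Y \<Longrightarrow>
    leq X Y \<alpha> (Seq R X Y Y \<alpha> \<epsilon>)"
  using leq_seq_right[of Y Y "Dia R Y" \<epsilon> X \<alpha>] by (simp add: leq_def)

lemma seq_dia_leq_left: "leq X X \<epsilon> (Dia R X) \<Longrightarrow> Y \<in> Obj R \<Longrightarrow> \<alpha> \<in> Fib R X Y \<Longrightarrow>
    leq X Y (Seq R X X Y \<epsilon> \<alpha>) \<alpha>"
  using leq_seq_left[of X X \<epsilon> "Dia R X" Y \<alpha>] by (simp add: leq_def)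

lemma seq_dia_leq_right: "leq Y Y \<epsilon> (Dia R Y) \<Longrightarrow> X \<in> Obj R \<Longrightarrow> \<alpha> \<in> Fib R X Y \<Longrightarrow>
    leq X Y (Seq R X Y Y \<alpha> \<epsilon>) \<alpha>"
  using leq_seq_right[of Y Y \<epsilon> "Dia R Y" X \<alpha>] by (simp add: leq_def)

text \<open>The inequalities are equations, usable by rewriting: converse is monotone and
  involutive, which reverses symmetry, and reflexivity gives
  \<open>\<rho> \<le> \<rho> ; \<rho>\<close>.\<close>

lemma equivalence_rel_iff:
  assumes X: "X \<in> Obj R"
  shows "equivalence_rel R X \<rho> \<longleftrightarrow>
    leq X X (Dia R X) \<rho> \<and> Conv R X X \<rho> = \<rho> \<and> Seq R X X X \<rho> \<rho> = \<rho>" (is "?L \<longleftrightarrow> ?R")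
proof
  assume L: ?L
  then have mem: "\<rho> \<in> Fib R X X" and d: "leq X X (Dia R X) \<rho>"
    and c: "leq X X (Conv R X X \<rho>) \<rho>" and t: "leq X X (Seq R X X X \<rho> \<rho>) \<rho>"
    using X by (auto simp: equivalence_rel_def leq_def)
  have "leq X X \<rho> (Conv R X X \<rho>)"
    using leq_conv[OF c] X mem by simp
  moreover have "leq X X \<rho> (Seq R X X X \<rho> \<rho>)"
    by (rule leq_seq_dia_left[OF d X mem])
  ultimately show ?R
    using c t d leq_antisym by blast
next
  assume ?R
  then show ?L
    using X by (auto simp: equivalence_rel_def leq_def intro: le_refl)
qed

text \<open>
  Faithfulness of \<open>\<Gamma>\<close> makes the category laws a consequence of the laws of the fibres.
\<close>

lemma
  assumes dom: "\<And>f. f \<in> Arr R \<Longrightarrow> Dom R f \<in> Obj R"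
    and cod: "\<And>f. f \<in> Arr R \<Longrightarrow> Cod R f \<in> Obj R"
    and ide: "\<And>X. X \<in> Obj R \<Longrightarrow> Ide R X \<in> hom R X X"
    and comp: "\<And>f g X Y Z. f \<in> hom R X Y \<Longrightarrow> g \<in> hom R Y Z \<Longrightarrow> Comp R g f \<in> hom R X Z"
    and closed: "\<And>f X Y. f \<in> hom R X Y \<Longrightarrow> \<Gamma> f \<in> Fib R X Y"
    and \<Gamma>_ide: "\<And>X. X \<in> Obj R \<Longrightarrow> \<Gamma> (Ide R X) = Dia R X"
    and \<Gamma>_comp: "\<And>f g X Y Z. f \<in> hom R X Y \<Longrightarrow> g \<in> hom R Y Z \<Longrightarrow>
      \<Gamma> (Comp R g f) = Seq R X Y Z (\<Gamma> f) (\<Gamma> g)"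
    and total: "\<And>f X Y. f \<in> hom R X Y \<Longrightarrow>
      leq X X (Dia R X) (Seq R X Y X (\<Gamma> f) (Conv R X Y (\<Gamma> f)))"
    and functional: "\<And>f X Y. f \<in> hom R X Y \<Longrightarrow>
      leq Y Y (Seq R Y X Y (Conv R X Y (\<Gamma> f)) (\<Gamma> f)) (Dia R Y)"
    and faithful: "\<And>f g X Y. f \<in> hom R X Y \<Longrightarrow> g \<in> hom R X Y \<Longrightarrow> \<Gamma> f = \<Gamma> g \<Longrightarrow> f = g"
    and reindex: "\<And>f g A B X Y \<alpha>. f \<in> hom R A X \<Longrightarrow> g \<in> hom R B Y \<Longrightarrow> \<alpha> \<in> Fib R X Y \<Longrightarrow>
      Reindex R f g \<alpha> = Seq R A X B (\<Gamma> f) (Seq R X Y B \<alpha> (Conv R B Y (\<Gamma> g)))"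
  shows relational_doctrine_of_graphs: "relational_doctrine R"
    and graph_of_graphs: "f \<in> hom R X Y \<Longrightarrow> graph R f = \<Gamma> f"
    and extensional_of_graphs: "extensional R"
proof -
  have o: "X \<in> Obj R" "Y \<in> Obj R" if "f \<in> hom R X Y" for f X Y
    using that dom cod by (auto simp: hom_def)
  have gr: "graph R f = \<Gamma> f" if f: "f \<in> hom R X Y" for f X Y
  proof -
    have "Cod R f = Y" using f by (simp add: hom_def)
    then show ?thesis
      unfolding graph_def using reindex[OF f ide[OF o(2)[OF f]]] o[OF f]
      by (simp add: \<Gamma>_ide closed[OF f])
  qed
  show "graph R f = \<Gamma> f" if "f \<in> hom R X Y" using gr[OF that] .
  show "extensional R"
    unfolding extensional_def
  proof (intro ballI impI)
    fix f g
    assume "f \<in> Arr R" "g \<in> Arr R" "Dom R f = Dom R g" "Cod R f = Cod R g"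
      and eq: "graph R f = graph R g"
    then have f: "f \<in> hom R (Dom R f) (Cod R f)" and g: "g \<in> hom R (Dom R f) (Cod R f)"
      by (auto simp: hom_def)
    show "f = g"
      by (rule faithful[OF f g]) (use eq gr[OF f] gr[OF g] in simp)
  qed
  show "relational_doctrine R"
  proof unfold_locales
    show "Comp R (Ide R Y) f = f" "Comp R f (Ide R X) = f" if f: "f \<in> hom R X Y" for f X Y
      by (auto intro!: faithful[OF comp f] ide o[OF f] f
        simp: \<Gamma>_comp[OF f ide] \<Gamma>_comp[OF ide f] \<Gamma>_ide o[OF f] closed[OF f])
    show "Comp R h (Comp R g f) = Comp R (Comp R h g) f"
      if f: "f \<in> hom R X Y" and g: "g \<in> hom R Y Z" and h: "h \<in> hom R Z W" for f g h X Y Z W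
      using f g h
      by (auto intro!: faithful comp
        simp: \<Gamma>_comp[OF comp] \<Gamma>_comp[OF _ comp] \<Gamma>_comp o closed)
  next
    fix f g A B X Y \<alpha> \<beta>
    assume f: "f \<in> hom R A X" and g: "g \<in> hom R B Y"
      and a: "\<alpha> \<in> Fib R X Y"
    note ob = o[OF f] o[OF g] and cl = closed[OF f] closed[OF g]
    show "Reindex R f g \<alpha> \<in> Fib R A B"
      using f g a ob cl by (simp add: reindex)
    show "Le R B A (Conv R A B (Reindex R f g \<alpha>)) (Reindex R g f (Conv R X Y \<alpha>))"
      using f g a ob cl by (simp add: reindex le_refl)
    assume b: "\<beta> \<in> Fib R X Y" and le: "Le R X Y \<alpha> \<beta>"
    then show "Le R A B (Reindex R f g \<alpha>) (Reindex R f g \<beta>)"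
      using f g a ob cl by (simp add: reindex seq_mono le_refl)
  next
    fix f f' g g' A A' B B' X Y \<alpha>
    assume "f' \<in> hom R A' A" "f \<in> hom R A X" "g' \<in> hom R B' B" "g \<in> hom R B Y" "\<alpha> \<in> Fib R X Y"
    then show "Reindex R (Comp R f f') (Comp R g g') \<alpha> = Reindex R f' g' (Reindex R f g \<alpha>)"
      using o closed by (simp add: reindex[OF comp comp] reindex \<Gamma>_comp)
  next
    fix f g h A B D X Y Z \<alpha> \<beta>
    assume f: "f \<in> hom R A X" and g: "g \<in> hom R B Y" and h: "h \<in> hom R D Z"
      and a: "\<alpha> \<in> Fib R X Y" and b: "\<beta> \<in> Fib R Y Z"
    note ob = o[OF f] o[OF g] o[OF h] and cl = closed[OF f] closed[OF g] closed[OF h]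
    \<comment> \<open>The composite of the two reindexed relations contains
      \<open>\<Gamma>\<^sub>g\<^sup>\<bottom> ; \<Gamma>\<^sub>g\<close> in the middle, which lies
      below the diagonal of Y.\<close>
    have "leq A D (Seq R A X D (\<Gamma> f) (Seq R X Y D \<alpha> (Seq R Y Y D
        (Seq R Y B Y (Conv R B Y (\<Gamma> g)) (\<Gamma> g)) (Seq R Y Z D \<beta> (Conv R D Z (\<Gamma> h))))))
      (Seq R A X D (\<Gamma> f) (Seq R X Y D \<alpha> (Seq R Y Z D \<beta> (Conv R D Z (\<Gamma> h)))))"
      using a b ob cl by (intro leq_seq_right seq_dia_leq_left functional[OF g]) auto
    then show "Le R A D (Seq R A B D (Reindex R f g \<alpha>) (Reindex R g h \<beta>))
        (Reindex R f h (Seq R X Y Z \<alpha> \<beta>))"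
      using a b ob cl by (simp add: reindex[OF f g] reindex[OF g h] reindex[OF f h] leq_def)
  next
    fix f A X assume f: "f \<in> hom R A X"
    show "Le R A A (Dia R A) (Reindex R f f (Dia R X))"
      using leqD[OF total[OF f]] o[OF f] closed[OF f] by (simp add: reindex[OF f f])
  qed (use dom cod ide comp in \<open>auto simp: reindex[OF ide ide] \<Gamma>_ide
      intro: le_refl le_antisym le_trans seq_mono conv_mono\<close>)
qed

end

sublocale relational_doctrine \<subseteq> fibres R
  by unfold_locales
    (auto simp: Seq_closed Dia_closed Conv_closed Seq_assoc Seq_Dia_left Seq_Dia_right
      Conv_Seq Conv_Dia Conv_Conv intro: Le_refl Le_trans Le_antisym Seq_mono Conv_mono)

section \<open>Graphs and reindexing in a relational doctrine\<close>

context relational_doctrine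
begin

lemma hom_Obj: "f \<in> hom R X Y \<Longrightarrow> X \<in> Obj R" "f \<in> hom R X Y \<Longrightarrow> Y \<in> Obj R"
  using Dom_closed Cod_closed by (auto simp: hom_def)

lemma graph_closed [simp]: "f \<in> hom R X Y \<Longrightarrow> graph R f \<in> Fib R X Y"
  unfolding graph_def by (auto simp: hom_def intro!: Reindex_closed Ide_hom Cod_closed dia_closed)

lemma cograph_eq: "f \<in> hom R X Y \<Longrightarrow> cograph R f = Conv R X Y (graph R f)"
  by (auto simp: cograph_def hom_def)

lemma cograph_closed [simp]: "f \<in> hom R X Y \<Longrightarrow> cograph R f \<in> Fib R Y X"
  by (simp add: cograph_eq hom_Obj)

lemma conv_graph [simp]: "f \<in> hom R X Y \<Longrightarrow> Conv R X Y (graph R f) = cograph R f"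
  by (simp add: cograph_eq)

lemma conv_cograph [simp]: "f \<in> hom R X Y \<Longrightarrow> Conv R Y X (cograph R f) = graph R f"
  using conv_conv[of X Y "graph R f"] hom_Obj[of f X Y] by simp

lemma kernel_eq: "f \<in> hom R X Y \<Longrightarrow> kernel R f = Seq R X Y X (graph R f) (cograph R f)"
  by (auto simp: kernel_def hom_def)

lemma descent_iff: "f \<in> hom R X Y \<Longrightarrow>
    descent R f \<longleftrightarrow> Seq R Y X Y (cograph R f) (graph R f) = Dia R Y"
  by (auto simp: descent_def hom_def)

text \<open>The axiom is only an inequality. Applying it to the converse of \<alpha> and taking
  converses once more gives the opposite one.\<close>

lemma conv_Reindex:
  assumes f: "f \<in> hom R A X" and g: "g \<in> hom R B Y" and a: "\<alpha> \<in> Fib R X Y"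
  shows "Conv R A B (Reindex R f g \<alpha>) = Reindex R g f (Conv R X Y \<alpha>)"
proof (rule leq_antisym[of B A])
  note o = hom_Obj[OF f] hom_Obj[OF g]
  show "leq B A (Conv R A B (Reindex R f g \<alpha>)) (Reindex R g f (Conv R X Y \<alpha>))"
    using f g a o by (intro leqI Conv_Reindex conv_closed Reindex_closed) auto
  have "leq A B (Conv R B A (Reindex R g f (Conv R X Y \<alpha>))) (Reindex R f g \<alpha>)"
    using Conv_Reindex[OF g f conv_closed[OF o(2) o(4) a]] f g a o
    by (intro leqI conv_closed Reindex_closed) auto
  from leq_conv[OF this] show "leq B A (Reindex R g f (Conv R X Y \<alpha>)) (Conv R A B (Reindex R f g \<alpha>))"
    using Reindex_closed[OF g f conv_closed[OF o(2) o(4) a]] o by simp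
qed

text \<open>Two lax laws are played against each other: composing \<open>\<Gamma>\<^sub>f =
  R\<^sub>f\<^sub>,\<^sub>i\<^sub>d(d\<^sub>X)\<close> with \<alpha> gives one inequality; for the
  other, \<open>d\<^sub>A \<le> R\<^sub>f\<^sub>,\<^sub>f(d\<^sub>X)\<close> is inserted in front of
  the reindexed relation.\<close>

lemma Reindex_left:
  assumes f: "f \<in> hom R A X" and Y: "Y \<in> Obj R" and a: "\<alpha> \<in> Fib R X Y"
  shows "Reindex R f (Ide R Y) \<alpha> = Seq R A X Y (graph R f) \<alpha>"
proof (rule leq_antisym[of A Y])
  note o = hom_Obj[OF f] and iX = Ide_hom[OF hom_Obj(2)[OF f]] and iY = Ide_hom[OF Y]
    and iA = Ide_hom[OF hom_Obj(1)[OF f]]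
  have graph: "graph R f = Reindex R f (Ide R X) (Dia R X)"
    using f by (auto simp: graph_def hom_def)
  let ?r = "Reindex R f (Ide R Y) \<alpha>"
  have r: "?r \<in> Fib R A Y" using Reindex_closed[OF f iY a] .
  show "leq A Y (Seq R A X Y (graph R f) \<alpha>) ?r"
    using Seq_Reindex[OF f iX iY _ a, of "Dia R X"] o Y a r graph_closed[OF f]
    by (intro leqI) (auto simp: graph Reindex_Ide)
  \<comment> \<open>Splitting off the first variable leaves f only in the second, where it meets the
    f of \<open>?r\<close> and \<open>Seq_Reindex\<close> applies.\<close>
  have rr: "Reindex R f f (Dia R X) = Reindex R (Ide R A) f (graph R f)"
    using Reindex_Comp[OF iA f f iX, of "Dia R X"] Comp_Ide_right[OF f] Comp_Ide_left[OF f] o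
    by (simp add: graph)
  have "leq A A (Dia R A) (Reindex R (Ide R A) f (graph R f))"
    using Dia_Reindex[OF f] Reindex_closed[OF f f, of "Dia R X"] o by (intro leqI) (auto simp: rr)
  then have "leq A Y ?r (Seq R A A Y (Reindex R (Ide R A) f (graph R f)) ?r)"
    by (rule leq_seq_dia_left[OF _ Y r])
  also have "leq A Y \<dots> (Seq R A X Y (graph R f) \<alpha>)"
    using Seq_Reindex[OF iA f iY graph_closed[OF f] a] o Y a r graph_closed[OF f]
      Reindex_closed[OF iA f graph_closed[OF f]]
    by (intro leqI) (auto simp: Reindex_Ide)
  finally show "leq A Y ?r (Seq R A X Y (graph R f) \<alpha>)" .
qed

text \<open>Converse exchanges the two variables, so \<open>Reindex_left\<close> also treats the
  second one, and functoriality lets the variables be reindexed one at a time.\<close>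

lemma Reindex_eq:
  assumes f: "f \<in> hom R A X" and g: "g \<in> hom R B Y" and a: "\<alpha> \<in> Fib R X Y"
  shows "Reindex R f g \<alpha> = Seq R A X B (graph R f) (Seq R X Y B \<alpha> (cograph R g))"
proof -
  note o = hom_Obj[OF f] hom_Obj[OF g]
  have r: "Reindex R (Ide R X) g \<alpha> \<in> Fib R X B"
    using Reindex_closed[OF Ide_hom g a] o by simp
  have "Conv R X B (Reindex R (Ide R X) g \<alpha>) = Seq R B Y X (graph R g) (Conv R X Y \<alpha>)"
    using conv_Reindex[OF Ide_hom g a] Reindex_left[OF g] o a by simp
  then have "Conv R B X (Conv R X B (Reindex R (Ide R X) g \<alpha>)) = Seq R X Y B \<alpha> (cograph R g)"
    using o a g by simp
  then have *: "Reindex R (Ide R X) g \<alpha> = Seq R X Y B \<alpha> (cograph R g)"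
    using r o by simp
  have "Reindex R f g \<alpha> = Reindex R f (Ide R B) (Reindex R (Ide R X) g \<alpha>)"
    using Reindex_Comp[OF f Ide_hom Ide_hom g a] Comp_Ide_right[OF g] Comp_Ide_left[OF f] o by simp
  then show ?thesis
    using Reindex_left[OF f o(3) r] * by simp
qed

lemma graph_Ide [simp]: "X \<in> Obj R \<Longrightarrow> graph R (Ide R X) = Dia R X"
  using Ide_hom[of X] by (auto simp: graph_def hom_def Reindex_Ide)

lemma cograph_Ide [simp]: "X \<in> Obj R \<Longrightarrow> cograph R (Ide R X) = Dia R X"
  using cograph_eq[OF Ide_hom[of X]] by simp

lemma graph_Comp:
  assumes f: "f \<in> hom R X Y" and g: "g \<in> hom R Y Z"
  shows "graph R (Comp R g f) = Seq R X Y Z (graph R f) (graph R g)"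
proof -
  note o = hom_Obj[OF f] hom_Obj[OF g]
  have "graph R (Comp R g f) = Reindex R (Comp R g f) (Comp R (Ide R Z) (Ide R Z)) (Dia R Z)"
    using Comp_hom[OF f g] Comp_Ide_left[OF Ide_hom[OF o(4)]] by (auto simp: graph_def hom_def)
  also have "\<dots> = Reindex R f (Ide R Z) (Reindex R g (Ide R Z) (Dia R Z))"
    using Reindex_Comp[OF f g Ide_hom Ide_hom] o by simp
  also have "Reindex R g (Ide R Z) (Dia R Z) = graph R g"
    using g by (auto simp: graph_def hom_def)
  finally show ?thesis
    using Reindex_left[OF f o(4)] g by simp
qed

lemma cograph_Comp:
  assumes f: "f \<in> hom R X Y" and g: "g \<in> hom R Y Z"
  shows "cograph R (Comp R g f) = Seq R Z Y X (cograph R g) (cograph R f)"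
  unfolding cograph_eq[OF Comp_hom[OF f g]]
  using assms hom_Obj[OF f] hom_Obj[OF g] by (simp add: graph_Comp)

lemma graph_total: "f \<in> hom R X Y \<Longrightarrow> leq X X (Dia R X) (Seq R X Y X (graph R f) (cograph R f))"
  using Dia_Reindex[of f X Y] Reindex_eq[of f X Y f X Y "Dia R Y"] hom_Obj[of f X Y]
  by (intro leqI) auto

lemma graph_functional:
  assumes f: "f \<in> hom R X Y"
  shows "leq Y Y (Seq R Y X Y (cograph R f) (graph R f)) (Dia R Y)"
proof -
  note o = hom_Obj[OF f]
  have *: "Reindex R (Ide R Y) f (Dia R Y) = cograph R f" "Reindex R f (Ide R Y) (Dia R Y) = graph R f"
    using Reindex_eq[OF Ide_hom[OF o(2)] f, of "Dia R Y"]
      Reindex_eq[OF f Ide_hom[OF o(2)], of "Dia R Y"] f o by auto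
  show ?thesis
    using Seq_Reindex[OF Ide_hom[OF o(2)] f Ide_hom[OF o(2)], of "Dia R Y" "Dia R Y"] f o
    by (intro leqI) (auto simp: Reindex_Ide *)
qed

lemma kernel_total: "f \<in> hom R X Y \<Longrightarrow> leq X X (Dia R X) (kernel R f)"
  by (simp add: kernel_eq graph_total)

lemma kernel_closed [simp]: "f \<in> hom R X Y \<Longrightarrow> kernel R f \<in> Fib R X X"
  using kernel_total leq_def by blast

text \<open>Totality of the graph gives one inequality and its functionality the other.\<close>

lemma graph_cograph_graph:
  assumes f: "f \<in> hom R X Y"
  shows "Seq R X X Y (kernel R f) (graph R f) = graph R f"
proof (rule leq_antisym)
  show "leq X Y (graph R f) (Seq R X X Y (kernel R f) (graph R f))"
    using leq_seq_dia_left[OF kernel_total[OF f]] f hom_Obj[OF f] by simp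
  show "leq X Y (Seq R X X Y (kernel R f) (graph R f)) (graph R f)"
    using seq_dia_leq_right[OF graph_functional[OF f], of X "graph R f"] f hom_Obj[OF f]
    by (simp add: kernel_eq)
qed

lemma conv_kernel: "f \<in> hom R X Y \<Longrightarrow> Conv R X X (kernel R f) = kernel R f"
  using hom_Obj[of f X Y] by (simp add: kernel_eq)

lemma equivalence_rel_kernel:
  assumes f: "f \<in> hom R X Y"
  shows "equivalence_rel R X (kernel R f)"
proof -
  have "Seq R X X X (kernel R f) (kernel R f) = kernel R f"
    using graph_cograph_graph[OF f] f hom_Obj[OF f]
      seq_assoc[of X X Y X "kernel R f" "graph R f" "cograph R f"]
    by (simp add: kernel_eq)
  then show ?thesis
    using f hom_Obj[OF f] by (simp add: equivalence_rel_iff kernel_total conv_kernel)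
qed

lemma extensionalD:
  "extensional R \<Longrightarrow> f \<in> hom R X Y \<Longrightarrow> g \<in> hom R X Y \<Longrightarrow> graph R f = graph R g \<Longrightarrow> f = g"
  unfolding extensional_def hom_def by auto

end

section \<open>Quotient arrows\<close>

definition iso_pair :: "('o, 'a, 'z) cat_scheme \<Rightarrow> 'o \<Rightarrow> 'o \<Rightarrow> 'a \<Rightarrow> 'a \<Rightarrow> bool"
  where "iso_pair C X Y i j \<longleftrightarrow> i \<in> hom C X Y \<and> j \<in> hom C Y X \<and>
    Comp C j i = Ide C X \<and> Comp C i j = Ide C Y"

lemma iso_pair_sym: "iso_pair C X Y i j \<Longrightarrow> iso_pair C Y X j i"
  by (auto simp: iso_pair_def)

lemma quotient_arrow_hom: "quotient_arrow R X \<rho> q \<Longrightarrow> q \<in> hom R X (Cod R q)"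
  by (simp add: quotient_arrow_def hom_def)

lemma quotient_arrow_ex1:
  assumes q: "quotient_arrow R X \<rho> q" and f: "f \<in> hom R X Z" and le: "Le R X X \<rho> (kernel R f)"
  shows "\<exists>!h. h \<in> hom R (Cod R q) Z \<and> f = Comp R h q"
proof -
  have "\<forall>f\<in>Arr R. Dom R f = X \<and> Le R X X \<rho> (kernel R f) \<longrightarrow>
      (\<exists>!h. h \<in> hom R (Cod R q) (Cod R f) \<and> f = Comp R h q)"
    using q by (simp add: quotient_arrow_def)
  moreover have "f \<in> Arr R" "Dom R f = X" "Cod R f = Z"
    using f by (simp_all add: hom_def)
  ultimately show ?thesis using le by blast
qed

lemma quotient_arrow_factor:
  assumes "quotient_arrow R X \<rho> q" and "f \<in> hom R X Z" and "Le R X X \<rho> (kernel R f)"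
  obtains h where "h \<in> hom R (Cod R q) Z" and "f = Comp R h q"
  using quotient_arrow_ex1[OF assms] by blast

text \<open>The universal property gives uniqueness only for composites compatible with \<rho>,
  whence the condition on the kernel.\<close>

lemma quotient_arrow_cancel:
  assumes "quotient_arrow R X \<rho> q" and "Le R X X \<rho> (kernel R (Comp R h q))"
    and "Comp R h q \<in> hom R X Z"
    and "h \<in> hom R (Cod R q) Z" "h' \<in> hom R (Cod R q) Z" "Comp R h q = Comp R h' q"
  shows "h = h'"
  using quotient_arrow_ex1[OF assms(1,3,2)] assms(4-6) by blast

context relational_doctrine
begin

text \<open>The kernel of g contains the diagonal, so it can be inserted between
  \<open>\<Gamma>\<^sub>f\<close> and \<open>\<Gamma>\<^sub>f\<^sup>\<bottom>\<close>.\<close>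

lemma kernel_Comp_leq:
  assumes f: "f \<in> hom R X Y" and g: "g \<in> hom R Y Z"
  shows "leq X X (kernel R f) (kernel R (Comp R g f))"
proof -
  note o = hom_Obj[OF f] hom_Obj[OF g]
  have "leq X X (Seq R X Y X (graph R f) (cograph R f))
    (Seq R X Y X (graph R f) (Seq R Y Y X (kernel R g) (cograph R f)))"
    using f o by (intro leq_seq_right leq_seq_dia_left[OF kernel_total[OF g]]) auto
  then show ?thesis
    using f g o by (simp add: kernel_eq[OF Comp_hom[OF f g]] kernel_eq[OF f] kernel_eq[OF g]
        graph_Comp[OF f g] cograph_Comp[OF f g])
qed

text \<open>A two-sided inverse of a total functional relation is its converse:
  \<open>\<Gamma>\<^sub>j \<le> \<Gamma>\<^sub>j ; \<Gamma>\<^sub>i ;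
  \<Gamma>\<^sub>i\<^sup>\<bottom> = \<Gamma>\<^sub>i\<^sup>\<bottom>\<close> by totality, and
  \<open>\<Gamma>\<^sub>i\<^sup>\<bottom> = \<Gamma>\<^sub>i\<^sup>\<bottom> ; \<Gamma>\<^sub>i ;
  \<Gamma>\<^sub>j \<le> \<Gamma>\<^sub>j\<close> by functionality.\<close>

lemma iso_pair_graph:
  assumes i: "iso_pair R X Y i j"
  shows "graph R j = cograph R i" "cograph R j = graph R i" "kernel R i = Dia R X" "descent R i"
proof -
  have f: "i \<in> hom R X Y" and g: "j \<in> hom R Y X"
    and gf: "Seq R X Y X (graph R i) (graph R j) = Dia R X"
    and fg: "Seq R Y X Y (graph R j) (graph R i) = Dia R Y"
    using i hom_Obj[of i X Y] graph_Comp[of i X Y j X] graph_Comp[of j Y X i Y]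
    by (auto simp: iso_pair_def)
  note o = hom_Obj[OF f]
  show *: "graph R j = cograph R i"
  proof (rule leq_antisym[of Y X])
    have "leq Y X (graph R j) (Seq R Y X X (graph R j) (kernel R i))"
      using f g o by (intro leq_seq_dia_right kernel_total) auto
    also have "Seq R Y X X (graph R j) (kernel R i) =
        Seq R Y Y X (Seq R Y X Y (graph R j) (graph R i)) (cograph R i)"
      using f g o by (simp add: kernel_eq)
    also have "\<dots> = cograph R i" using f o by (simp add: fg)
    finally show "leq Y X (graph R j) (cograph R i)" .
    have "cograph R i = Seq R Y X X (cograph R i) (Seq R X Y X (graph R i) (graph R j))"
      using f o by (simp add: gf)
    also have "\<dots> = Seq R Y Y X (Seq R Y X Y (cograph R i) (graph R i)) (graph R j)"
      using f g o by simp
    also have "leq Y X \<dots> (graph R j)"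
      using g o by (intro seq_dia_leq_left graph_functional[OF f]) auto
    finally show "leq Y X (cograph R i) (graph R j)" .
  qed
  show "cograph R j = graph R i"
    using cograph_eq[OF g] f by (simp add: *)
  show "kernel R i = Dia R X" "descent R i"
    using gf fg by (simp_all add: kernel_eq[OF f] descent_iff[OF f] flip: *)
qed

lemma quotient_arrow_iso:
  assumes q: "quotient_arrow R X \<rho> q" and p: "quotient_arrow R X \<rho> p"
  obtains i j where "iso_pair R (Cod R q) (Cod R p) i j" "p = Comp R i q" "q = Comp R j p"
proof -
  note hq = quotient_arrow_hom[OF q] and hp = quotient_arrow_hom[OF p]
  have lq: "Le R X X \<rho> (kernel R q)" and lp: "Le R X X \<rho> (kernel R p)"
    using q p by (auto simp: quotient_arrow_def)
  obtain i where i: "i \<in> hom R (Cod R q) (Cod R p)" "p = Comp R i q"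
    using quotient_arrow_factor[OF q hp lp] .
  obtain j where j: "j \<in> hom R (Cod R p) (Cod R q)" "q = Comp R j p"
    using quotient_arrow_factor[OF p hq lq] .
  have Iq: "Ide R (Cod R q) \<in> hom R (Cod R q) (Cod R q)"
    and Ip: "Ide R (Cod R p) \<in> hom R (Cod R p) (Cod R p)"
    using hom_Obj[OF hq] hom_Obj[OF hp] by (auto intro: Ide_hom)
  have "Comp R (Comp R j i) q = q" "Comp R (Comp R i j) p = p"
    using Comp_assoc[OF hq i(1) j(1)] Comp_assoc[OF hp j(1) i(1)] i(2) j(2) by metis+
  then have "Comp R j i = Ide R (Cod R q)" "Comp R i j = Ide R (Cod R p)"
    using quotient_arrow_cancel[OF q _ _ Comp_hom[OF i(1) j(1)] Iq] lq hq
      quotient_arrow_cancel[OF p _ _ Comp_hom[OF j(1) i(1)] Ip] lp hp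
    by (simp_all add: Comp_Ide_left)
  then show ?thesis using that[OF _ i(2) j(2)] i(1) j(1) by (simp add: iso_pair_def)
qed

lemma quotient_arrow_Comp_iso:
  assumes q: "quotient_arrow R X \<rho> q" and i: "iso_pair R (Cod R q) W i j"
  shows "quotient_arrow R X \<rho> (Comp R i q)"
proof -
  note hq = quotient_arrow_hom[OF q]
  have hi: "i \<in> hom R (Cod R q) W" and hj: "j \<in> hom R W (Cod R q)"
    and ji: "Comp R j i = Ide R (Cod R q)" and ij: "Comp R i j = Ide R W"
    using i by (auto simp: iso_pair_def)
  note hc = Comp_hom[OF hq hi] and o = hom_Obj[OF hq]
  have jiq: "Comp R j (Comp R i q) = q"
    using Comp_assoc[OF hq hi hj] ji Comp_Ide_left[OF hq] by simp
  have r: "\<rho> \<in> Fib R X X" "Le R X X \<rho> (kernel R q)" "X \<in> Obj R" "equivalence_rel R X \<rho>"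
    using q by (auto simp: quotient_arrow_def equivalence_rel_def)
  then have "leq X X \<rho> (kernel R q)" using hq by (intro leqI) auto
  from leq_trans[OF this kernel_Comp_leq[OF hq hi]]
  have le: "Le R X X \<rho> (kernel R (Comp R i q))" by (rule leqD)
  have "\<exists>!h. h \<in> hom R W (Cod R f) \<and> f = Comp R h (Comp R i q)"
    if f: "f \<in> Arr R" "Dom R f = X" and lf: "Le R X X \<rho> (kernel R f)" for f
  proof -
    have hf: "f \<in> hom R X (Cod R f)" using f by (simp add: hom_def)
    obtain h where h: "h \<in> hom R (Cod R q) (Cod R f)" "f = Comp R h q"
      using quotient_arrow_factor[OF q hf lf] .
    show ?thesis
    proof (rule ex1I[of _ "Comp R h j"])
      show "Comp R h j \<in> hom R W (Cod R f) \<and> f = Comp R (Comp R h j) (Comp R i q)"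
        using Comp_hom[OF hj h(1)] Comp_assoc[OF hc hj h(1)] jiq h by simp
      fix k assume k: "k \<in> hom R W (Cod R f) \<and> f = Comp R k (Comp R i q)"
      then have hk: "k \<in> hom R W (Cod R f)" by (rule conjunct1)
      have "Comp R (Comp R k i) q = Comp R h q" using k h Comp_assoc[OF hq hi hk] by simp
      then have "Comp R k i = h"
        using quotient_arrow_cancel[OF q _ _ Comp_hom[OF hi hk] h(1)] h lf hf by simp
      then have "Comp R h j = Comp R k (Comp R i j)" using Comp_assoc[OF hj hi hk] by simp
      then show "k = Comp R h j" using ij Comp_Ide_right[OF hk] by simp
    qed
  qed
  moreover have "Cod R (Comp R i q) = W" "Comp R i q \<in> Arr R" "Dom R (Comp R i q) = X"
    using hc by (auto simp: hom_def)
  ultimately show ?thesis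
    using r le unfolding quotient_arrow_def by simp
qed

text \<open>Precomposition changes the relation being divided out: the composite is a quotient arrow
  of \<open>\<Gamma>\<^sub>i ; \<rho> ; \<Gamma>\<^sub>i\<^sup>\<bottom>\<close> on V.\<close>

lemma quotient_arrow_iso_Comp:
  assumes q: "quotient_arrow R X \<rho> q" and i: "iso_pair R V X i j"
  shows "is_quotient_arrow R (Comp R q i)"
proof -
  note hq = quotient_arrow_hom[OF q]
  have hi: "i \<in> hom R V X" and hj: "j \<in> hom R X V"
    and ji: "Comp R j i = Ide R V" and ij: "Comp R i j = Ide R X"
    using i by (auto simp: iso_pair_def)
  note hc = Comp_hom[OF hi hq] and oq = hom_Obj[OF hq] and oi = hom_Obj[OF hi]
  have r: "\<rho> \<in> Fib R X X" "leq X X \<rho> (kernel R q)" "leq X X (Dia R X) \<rho>"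
    "Conv R X X \<rho> = \<rho>" "Seq R X X X \<rho> \<rho> = \<rho>"
  proof -
    have e: "equivalence_rel R X \<rho>" and le: "Le R X X \<rho> (kernel R q)"
      using q by (simp_all add: quotient_arrow_def)
    then show "\<rho> \<in> Fib R X X" by (simp add: equivalence_rel_def)
    then show "leq X X \<rho> (kernel R q)" using le oq hq by (simp add: leqI)
    show "leq X X (Dia R X) \<rho>" "Conv R X X \<rho> = \<rho>" "Seq R X X X \<rho> \<rho> = \<rho>"
      using e equivalence_rel_iff[OF oq(1)] by auto
  qed
  have inv: "Seq R X V X (cograph R i) (graph R i) = Dia R X"
    using iso_pair_graph(4)[OF i] descent_iff[OF hi] by simp
  \<comment> \<open>Conjugation by the graph of i carries relations on X to relations on V;
    \<open>?d\<close> carries them back.\<close>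
  let ?c = "\<lambda>\<alpha>. Seq R V X V (graph R i) (Seq R X X V \<alpha> (cograph R i))"
  let ?d = "\<lambda>\<alpha>. Seq R X V X (cograph R i) (Seq R V V X \<alpha> (graph R i))"
  have dc: "?d (?c \<alpha>) = \<alpha>" if a: "\<alpha> \<in> Fib R X X" for \<alpha>
  proof -
    have "?d (?c \<alpha>) = Seq R X X X (Seq R X V X (cograph R i) (graph R i))
        (Seq R X X X \<alpha> (Seq R X V X (cograph R i) (graph R i)))"
      using hi oi a by simp
    then show ?thesis using a oi inv by simp
  qed
  have c_mono: "leq V V (?c \<alpha>) (?c \<beta>)" if "leq X X \<alpha> \<beta>" for \<alpha> \<beta>
    using that hi oi by (intro leq_seq_right leq_seq_left) auto
  have d_mono: "leq X X (?d \<alpha>) (?d \<beta>)" if "leq V V \<alpha> \<beta>" for \<alpha> \<beta>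
    using that hi oi by (intro leq_seq_right leq_seq_left) auto
  have "equivalence_rel R V (?c \<rho>)"
  proof -
    have "leq V V (Dia R V) (?c (Dia R X))"
      using graph_total[OF hi] hi oi by simp
    also have "leq V V (?c (Dia R X)) (?c \<rho>)" by (rule c_mono) (rule r)
    finally have "leq V V (Dia R V) (?c \<rho>)" .
    moreover have "Seq R V V V (?c \<rho>) (?c \<rho>) = Seq R V X V (graph R i) (Seq R X X V \<rho>
        (Seq R X X V (Seq R X V X (cograph R i) (graph R i)) (Seq R X X V \<rho> (cograph R i))))"
      using r(1) hi oi by simp
    then have "Seq R V V V (?c \<rho>) (?c \<rho>) = Seq R V X V (graph R i) (Seq R X X V
        (Seq R X X X \<rho> \<rho>) (cograph R i))"
      unfolding inv using r(1) hi oi by simp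
    then have "Seq R V V V (?c \<rho>) (?c \<rho>) = ?c \<rho>" using r(5) by simp
    moreover have "Conv R V V (?c \<rho>) = ?c \<rho>" using r(1,4) hi oi by simp
    ultimately show ?thesis using equivalence_rel_iff[OF oi(1)] by simp
  qed
  moreover have "Le R V V (?c \<rho>) (kernel R (Comp R q i))"
    using leqD[OF c_mono[OF r(2)]] hi hq oi oq
    by (simp add: kernel_eq[OF hc] kernel_eq[OF hq] graph_Comp[OF hi hq] cograph_Comp[OF hi hq])
  moreover have "\<exists>!h. h \<in> hom R (Cod R q) (Cod R f) \<and> f = Comp R h (Comp R q i)"
    if f: "f \<in> Arr R" "Dom R f = V" and lf: "Le R V V (?c \<rho>) (kernel R f)" for f
  proof -
    have hf: "f \<in> hom R V (Cod R f)" using f by (simp add: hom_def)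
    note hfj = Comp_hom[OF hj hf]
    \<comment> \<open>Compatibility of f with the transported relation is turned into compatibility
      of \<open>f \<circ> j\<close> with \<rho>, so that the universal property of q
      applies.\<close>
    have "leq X X \<rho> (?d (kernel R f))"
      using d_mono[of "?c \<rho>" "kernel R f"] dc[OF r(1)] lf r(1) hi hf oi by (simp add: leq_def)
    then have lfj: "Le R X X \<rho> (kernel R (Comp R f j))"
      using hi hj hf oi hom_Obj[OF hf] iso_pair_graph(1,2)[OF i]
      by (simp add: kernel_eq[OF hfj] kernel_eq[OF hf] graph_Comp[OF hj hf] cograph_Comp[OF hj hf] leq_def)
    have fji: "Comp R (Comp R f j) i = f"
      using Comp_assoc[OF hi hj hf] ji Comp_Ide_right[OF hf] by simp
    have eq: "f = Comp R h (Comp R q i) \<longleftrightarrow> Comp R f j = Comp R h q"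
      if h: "h \<in> hom R (Cod R q) (Cod R f)" for h
    proof
      assume "f = Comp R h (Comp R q i)"
      then show "Comp R f j = Comp R h q"
        using Comp_assoc[OF hi hq h] Comp_assoc[OF hj hi Comp_hom[OF hq h]] ij
          Comp_Ide_right[OF Comp_hom[OF hq h]] by simp
    next
      assume "Comp R f j = Comp R h q"
      then show "f = Comp R h (Comp R q i)"
        using Comp_assoc[OF hi hq h] fji by simp
    qed
    obtain h where h: "h \<in> hom R (Cod R q) (Cod R f)" "Comp R f j = Comp R h q"
      using quotient_arrow_factor[OF q hfj lfj] .
    show ?thesis
    proof (rule ex1I[of _ h])
      show "h \<in> hom R (Cod R q) (Cod R f) \<and> f = Comp R h (Comp R q i)"
        using h eq by simp
      fix k assume k: "k \<in> hom R (Cod R q) (Cod R f) \<and> f = Comp R k (Comp R q i)"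
      then have hk: "k \<in> hom R (Cod R q) (Cod R f)" and "f = Comp R k (Comp R q i)" by blast+
      then have "Comp R h q = Comp R k q" using iffD1[OF eq[OF hk]] h(2) by simp
      then show "k = h"
        using quotient_arrow_cancel[OF q, of h "Cod R f" k] hk lfj hfj h by simp
    qed
  qed
  moreover have "Cod R (Comp R q i) = Cod R q" "Comp R q i \<in> Arr R" "Dom R (Comp R q i) = V"
    using hc by (auto simp: hom_def)
  ultimately have "quotient_arrow R V (?c \<rho>) (Comp R q i)"
    using oi unfolding quotient_arrow_def by simp
  then show ?thesis
    using \<open>Dom R (Comp R q i) = V\<close> unfolding is_quotient_arrow_def by auto
qed

lemma is_quotient_arrow_conjugate:
  assumes q: "is_quotient_arrow R q" and h: "q \<in> hom R X Y"
    and i: "iso_pair R V X i i'" and j: "iso_pair R Y W j j'"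
  shows "is_quotient_arrow R (Comp R j (Comp R q i))"
proof -
  obtain \<rho> where "quotient_arrow R X \<rho> q"
    using q h by (auto simp: is_quotient_arrow_def hom_def)
  then have "is_quotient_arrow R (Comp R q i)" by (rule quotient_arrow_iso_Comp[OF _ i])
  moreover have hc: "Comp R q i \<in> hom R V Y" using h i Comp_hom by (auto simp: iso_pair_def)
  ultimately obtain \<sigma> where "quotient_arrow R V \<sigma> (Comp R q i)"
    by (auto simp: is_quotient_arrow_def hom_def)
  then have "quotient_arrow R V \<sigma> (Comp R j (Comp R q i))"
    using quotient_arrow_Comp_iso[of V \<sigma> "Comp R q i" W j j'] j hc by (simp add: hom_def)
  then show ?thesis by (auto simp: is_quotient_arrow_def quotient_arrow_def)
qed

text \<open>\<open>has_quotients\<close> promises only one effective descent quotient of \<rho>, but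
  q differs from it by an isomorphism, whose graph and converse cancel in both the kernel and the
  descent composite.\<close>

lemma quotient_arrow_effective_descent:
  assumes hq: "has_quotients R" and q: "quotient_arrow R X \<rho> q"
  shows "kernel R q = \<rho>" "descent R q"
proof -
  have "X \<in> Obj R" "equivalence_rel R X \<rho>" using q by (auto simp: quotient_arrow_def)
  then obtain p where p: "quotient_arrow R X \<rho> p" "kernel R p = \<rho>" "descent R p"
    using hq unfolding has_quotients_def effective_def by metis
  obtain i j where i: "iso_pair R (Cod R p) (Cod R q) i j" and qi: "q = Comp R i p"
    using quotient_arrow_iso[OF p(1) q] .
  note hp = quotient_arrow_hom[OF p(1)] and hi = i[unfolded iso_pair_def, THEN conjunct1]
  note hc = Comp_hom[OF hp hi] and o = hom_Obj[OF hp] hom_Obj[OF hi]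
  have ki: "Seq R (Cod R p) (Cod R q) (Cod R p) (graph R i) (cograph R i) = Dia R (Cod R p)"
    using iso_pair_graph(3)[OF i] kernel_eq[OF hi] by simp
  have di: "Seq R (Cod R q) (Cod R p) (Cod R q) (cograph R i) (graph R i) = Dia R (Cod R q)"
    using iso_pair_graph(4)[OF i] descent_iff[OF hi] by simp
  have dp: "Seq R (Cod R p) X (Cod R p) (cograph R p) (graph R p) = Dia R (Cod R p)"
    using p(3) descent_iff[OF hp] by simp
  have "kernel R (Comp R i p) = Seq R X (Cod R p) X (graph R p) (Seq R (Cod R p) (Cod R p) X
      (Seq R (Cod R p) (Cod R q) (Cod R p) (graph R i) (cograph R i)) (cograph R p))"
    using hp hi o by (simp add: kernel_eq[OF hc] graph_Comp[OF hp hi] cograph_Comp[OF hp hi])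
  also have "\<dots> = \<rho>" using p(2) hp o kernel_eq[OF hp] unfolding ki by simp
  finally show "kernel R q = \<rho>" using qi by simp
  have "Seq R (Cod R q) X (Cod R q) (cograph R (Comp R i p)) (graph R (Comp R i p)) =
     Seq R (Cod R q) (Cod R p) (Cod R q) (cograph R i) (Seq R (Cod R p) (Cod R p) (Cod R q)
      (Seq R (Cod R p) X (Cod R p) (cograph R p) (graph R p)) (graph R i))"
    using hp hi o by (simp add: graph_Comp[OF hp hi] cograph_Comp[OF hp hi])
  also have "\<dots> = Dia R (Cod R q)" unfolding dp using hi o by (simp add: di)
  finally show "descent R q" using qi descent_iff[OF hc] by simp
qed

text \<open>Descent recovers a factor from the composite, \<open>\<Gamma>\<^sub>k =
  \<Gamma>\<^sub>q\<^sup>\<bottom> ; \<Gamma>\<^sub>k\<^sub>q\<close>, so uniqueness is automatic by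
  extensionality and only existence remains, stated as an equation between relations.\<close>

lemma quotient_arrowI:
  assumes ext: "extensional R" and rho: "equivalence_rel R X \<rho>"
    and q: "q \<in> hom R X W" and le: "Le R X X \<rho> (kernel R q)" and d: "descent R q"
    and univ: "\<And>f Z. f \<in> hom R X Z \<Longrightarrow> Le R X X \<rho> (kernel R f) \<Longrightarrow>
      \<exists>h\<in>hom R W Z. graph R f = Seq R X W Z (graph R q) (graph R h)"
  shows "quotient_arrow R X \<rho> q"
proof -
  note o = hom_Obj[OF q]
  have "\<exists>!h. h \<in> hom R W (Cod R f) \<and> f = Comp R h q"
    if f: "f \<in> Arr R" "Dom R f = X" and lf: "Le R X X \<rho> (kernel R f)" for f
  proof -
    have hf: "f \<in> hom R X (Cod R f)" using f by (simp add: hom_def)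
    obtain h where h: "h \<in> hom R W (Cod R f)"
      "graph R f = Seq R X W (Cod R f) (graph R q) (graph R h)"
      using univ[OF hf lf] by blast
    have det: "graph R k = Seq R W X (Cod R f) (cograph R q) (graph R (Comp R k q))"
      if k: "k \<in> hom R W (Cod R f)" for k
    proof -
      have "Seq R W X (Cod R f) (cograph R q) (graph R (Comp R k q)) =
          Seq R W W (Cod R f) (Seq R W X W (cograph R q) (graph R q)) (graph R k)"
        using q k o hom_Obj[OF k] by (simp add: graph_Comp[OF q k])
      then show ?thesis using d descent_iff[OF q] k hom_Obj[OF k] by simp
    qed
    show ?thesis
    proof (rule ex1I[of _ h])
      show *: "h \<in> hom R W (Cod R f) \<and> f = Comp R h q"
        using extensionalD[OF ext hf Comp_hom[OF q h(1)]] graph_Comp[OF q h(1)] h by simp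
      fix k assume "k \<in> hom R W (Cod R f) \<and> f = Comp R k q"
      then have hk: "k \<in> hom R W (Cod R f)" and "f = Comp R k q" by blast+
      then have "graph R k = graph R h" using det[OF hk] det[OF h(1)] * by metis
      then show "k = h" by (rule extensionalD[OF ext hk h(1)])
    qed
  qed
  then show ?thesis using assms o unfolding quotient_arrow_def by (auto simp: hom_def)
qed

end

section \<open>The extensional quotient completion\<close>

context relational_doctrine
begin

lemma eq_completion_simps [simp]:
  "Obj (eq_completion R) = eq_obj R" "Dom (eq_completion R) = eq_dom"
  "Cod (eq_completion R) = eq_cod" "Le (eq_completion R) A B = Le R (fst A) (fst B)"
  "Seq (eq_completion R) A B D = Seq R (fst A) (fst B) (fst D)"
  "Dia (eq_completion R) = snd" "Conv (eq_completion R) A B = Conv R (fst A) (fst B)"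
  "Ide (eq_completion R) A = eq_arr R A A (Ide R (fst A))"
  by (simp_all add: eq_completion_def)

lemma eq_objD:
  assumes "A \<in> eq_obj R"
  shows "fst A \<in> Obj R" "snd A \<in> Fib R (fst A) (fst A)" "leq (fst A) (fst A) (Dia R (fst A)) (snd A)"
    "Conv R (fst A) (fst A) (snd A) = snd A" "Seq R (fst A) (fst A) (fst A) (snd A) (snd A) = snd A"
  using assms equivalence_rel_iff[of "fst A" "snd A"]
  by (auto simp: eq_obj_def equivalence_rel_def)

lemma eq_objI: "X \<in> Obj R \<Longrightarrow> equivalence_rel R X \<rho> \<Longrightarrow> (X, \<rho>) \<in> eq_obj R"
  by (simp add: eq_obj_def)

lemma dia_eq_obj: "X \<in> Obj R \<Longrightarrow> (X, Dia R X) \<in> eq_obj R"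
  by (intro eq_objI) (simp_all add: equivalence_rel_iff leq_refl)

lemma seq_idem:
  assumes "A \<in> eq_obj R" "Y \<in> Obj R" "\<alpha> \<in> Fib R (fst A) Y"
  shows "Seq R (fst A) (fst A) Y (snd A) (Seq R (fst A) (fst A) Y (snd A) \<alpha>) =
    Seq R (fst A) (fst A) Y (snd A) \<alpha>"
  using assms eq_objD[OF assms(1)] seq_assoc[of "fst A" "fst A" "fst A" Y "snd A" "snd A" \<alpha>] by simp

text \<open>Reflexivity of \<rho> and \<sigma> squeezes \<open>\<alpha> \<le> \<alpha> ; \<sigma>
  \<le> \<rho> ; \<alpha> ; \<sigma> \<le> \<alpha>\<close>, which splits the defining inequality
  into two one-sided absorption equations.\<close>

lemma Fib_eq_completion:
  assumes A: "A \<in> eq_obj R" and B: "B \<in> eq_obj R"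
  shows "\<alpha> \<in> Fib (eq_completion R) A B \<longleftrightarrow> \<alpha> \<in> Fib R (fst A) (fst B) \<and>
    Seq R (fst A) (fst A) (fst B) (snd A) \<alpha> = \<alpha> \<and> Seq R (fst A) (fst B) (fst B) \<alpha> (snd B) = \<alpha>"
    (is "_ \<longleftrightarrow> ?R")
proof -
  note a = eq_objD[OF A] and b = eq_objD[OF B]
  let ?X = "fst A" and ?Y = "fst B" and ?\<rho> = "snd A" and ?\<sigma> = "snd B"
  have def: "\<alpha> \<in> Fib (eq_completion R) A B \<longleftrightarrow> \<alpha> \<in> Fib R ?X ?Y \<and>
      Le R ?X ?Y (Seq R ?X ?Y ?Y (Seq R ?X ?X ?Y ?\<rho> \<alpha>) ?\<sigma>) \<alpha>"
    by (cases A; cases B) (simp add: eq_completion_def)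
  show ?thesis
  proof
    assume "\<alpha> \<in> Fib (eq_completion R) A B"
    then have m: "\<alpha> \<in> Fib R ?X ?Y" and "Le R ?X ?Y (Seq R ?X ?Y ?Y (Seq R ?X ?X ?Y ?\<rho> \<alpha>) ?\<sigma>) \<alpha>"
      using def by blast+
    then have le: "leq ?X ?Y (Seq R ?X ?X ?Y ?\<rho> (Seq R ?X ?Y ?Y \<alpha> ?\<sigma>)) \<alpha>"
      using a b by (intro leqI) simp_all
    have "leq ?X ?Y (Seq R ?X ?Y ?Y \<alpha> ?\<sigma>) (Seq R ?X ?X ?Y ?\<rho> (Seq R ?X ?Y ?Y \<alpha> ?\<sigma>))"
      using a b m by (intro leq_seq_dia_left) auto
    moreover have "leq ?X ?Y \<alpha> (Seq R ?X ?Y ?Y \<alpha> ?\<sigma>)"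
      using a b m by (intro leq_seq_dia_right) auto
    ultimately have eq: "Seq R ?X ?X ?Y ?\<rho> (Seq R ?X ?Y ?Y \<alpha> ?\<sigma>) = \<alpha>" "Seq R ?X ?Y ?Y \<alpha> ?\<sigma> = \<alpha>"
      using le by (blast intro: leq_antisym leq_trans)+
    then show ?R using m by simp
  next
    assume ?R
    then have m: "\<alpha> \<in> Fib R ?X ?Y" and "Seq R ?X ?X ?Y ?\<rho> \<alpha> = \<alpha>" "Seq R ?X ?Y ?Y \<alpha> ?\<sigma> = \<alpha>"
      by blast+
    then show "\<alpha> \<in> Fib (eq_completion R) A B" unfolding def using a b by (simp add: le_refl)
  qed
qed

lemma between_iff:
  assumes "A \<in> eq_obj R" "B \<in> eq_obj R" "f \<in> hom R (fst A) (fst B)" "g \<in> hom R (fst A) (fst B)"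
  shows "between R A B f g \<longleftrightarrow> leq (fst A) (fst A) (snd A) (Seq R (fst A) (fst B) (fst A)
    (Seq R (fst A) (fst B) (fst B) (graph R f) (snd B)) (cograph R g))"
  using assms eq_objD[OF assms(1)] eq_objD[OF assms(2)]
  by (simp add: between_def leq_def case_prod_unfold del: seq_assoc)

text \<open>Composition on the right with \<open>\<Gamma>\<^sub>g\<close> is left adjoint to
  composition with \<open>\<Gamma>\<^sub>g\<^sup>\<bottom>\<close>; the unit is totality and the
  counit functionality.\<close>

lemma between_iff_leq:
  assumes A: "A \<in> eq_obj R" and B: "B \<in> eq_obj R"
    and f: "f \<in> hom R (fst A) (fst B)" and g: "g \<in> hom R (fst A) (fst B)"
  shows "between R A B f g \<longleftrightarrow> leq (fst A) (fst B)
    (Seq R (fst A) (fst A) (fst B) (snd A) (graph R g)) (Seq R (fst A) (fst B) (fst B) (graph R f) (snd B))"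
proof -
  let ?X = "fst A" and ?Y = "fst B" and ?\<rho> = "snd A" and ?\<sigma> = "snd B"
  note a = eq_objD[OF A] and b = eq_objD[OF B]
  let ?fs = "Seq R ?X ?Y ?Y (graph R f) ?\<sigma>"
  have "between R A B f g \<longleftrightarrow> leq ?X ?X ?\<rho> (Seq R ?X ?Y ?X ?fs (cograph R g))"
    by (rule between_iff[OF A B f g])
  also have "\<dots> \<longleftrightarrow> leq ?X ?Y (Seq R ?X ?X ?Y ?\<rho> (graph R g)) ?fs"
  proof
    assume "leq ?X ?X ?\<rho> (Seq R ?X ?Y ?X ?fs (cograph R g))"
    then have "leq ?X ?Y (Seq R ?X ?X ?Y ?\<rho> (graph R g))
        (Seq R ?X ?X ?Y (Seq R ?X ?Y ?X ?fs (cograph R g)) (graph R g))"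
      using b g by (intro leq_seq_left) auto
    also have "\<dots> = Seq R ?X ?Y ?Y ?fs (Seq R ?Y ?X ?Y (cograph R g) (graph R g))"
      using a b f g by simp
    also have "leq ?X ?Y \<dots> ?fs"
      using a b f g by (intro seq_dia_leq_right graph_functional) auto
    finally show "leq ?X ?Y (Seq R ?X ?X ?Y ?\<rho> (graph R g)) ?fs" .
  next
    assume le: "leq ?X ?Y (Seq R ?X ?X ?Y ?\<rho> (graph R g)) ?fs"
    have "leq ?X ?X ?\<rho> (Seq R ?X ?X ?X ?\<rho> (Seq R ?X ?Y ?X (graph R g) (cograph R g)))"
      using a by (intro leq_seq_dia_right graph_total[OF g]) auto
    also have "\<dots> = Seq R ?X ?Y ?X (Seq R ?X ?X ?Y ?\<rho> (graph R g)) (cograph R g)"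
      using a b g by simp
    also have "leq ?X ?X \<dots> (Seq R ?X ?Y ?X ?fs (cograph R g))"
      using le a g by (intro leq_seq_left) auto
    finally show "leq ?X ?X ?\<rho> (Seq R ?X ?Y ?X ?fs (cograph R g))" .
  qed
  finally show ?thesis .
qed

text \<open>The relation \<open>\<Gamma>\<^sub>f ; \<sigma>\<close> is to become the graph of the
  class of f. It absorbs \<sigma> on the right by idempotence, and absorbing \<rho> on the left
  amounts to \<open>\<rho> ; \<Gamma>\<^sub>f \<le> \<Gamma>\<^sub>f ; \<sigma>\<close>, which is
  compatibility.\<close>

lemma between_self_iff:
  assumes A: "A \<in> eq_obj R" and B: "B \<in> eq_obj R" and f: "f \<in> hom R (fst A) (fst B)"
  shows "between R A B f f \<longleftrightarrow>
    Seq R (fst A) (fst B) (fst B) (graph R f) (snd B) \<in> Fib (eq_completion R) A B"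
proof -
  let ?X = "fst A" and ?Y = "fst B" and ?\<rho> = "snd A" and ?\<sigma> = "snd B"
  note a = eq_objD[OF A] and b = eq_objD[OF B]
  let ?fs = "Seq R ?X ?Y ?Y (graph R f) ?\<sigma>" and ?rf = "Seq R ?X ?X ?Y ?\<rho> (graph R f)"
  have "?fs \<in> Fib (eq_completion R) A B \<longleftrightarrow> Seq R ?X ?X ?Y ?\<rho> ?fs = ?fs"
    using a b f by (simp add: Fib_eq_completion[OF A B])
  also have "\<dots> \<longleftrightarrow> leq ?X ?Y ?rf ?fs"
  proof
    assume eq: "Seq R ?X ?X ?Y ?\<rho> ?fs = ?fs"
    have "leq ?X ?Y ?rf (Seq R ?X ?Y ?Y ?rf ?\<sigma>)"
      using a b f by (intro leq_seq_dia_right) auto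
    also have "\<dots> = ?fs" using eq a b f by simp
    finally show "leq ?X ?Y ?rf ?fs" .
  next
    assume "leq ?X ?Y ?rf ?fs"
    then have "leq ?X ?Y (Seq R ?X ?Y ?Y ?rf ?\<sigma>) (Seq R ?X ?Y ?Y ?fs ?\<sigma>)"
      using b by (intro leq_seq_left) auto
    then have "leq ?X ?Y (Seq R ?X ?X ?Y ?\<rho> ?fs) ?fs" using a b f by simp
    moreover have "leq ?X ?Y ?fs (Seq R ?X ?X ?Y ?\<rho> ?fs)"
      using a b f by (intro leq_seq_dia_left) auto
    ultimately show "Seq R ?X ?X ?Y ?\<rho> ?fs = ?fs" by (rule leq_antisym)
  qed
  finally show ?thesis using between_iff_leq[OF A B f f] by simp
qed

text \<open>Composing \<open>\<rho> ; \<Gamma>\<^sub>g \<le> \<Gamma>\<^sub>f ; \<sigma>\<close>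
  with \<sigma> gives \<open>\<Gamma>\<^sub>g ; \<sigma> \<le> \<Gamma>\<^sub>f ; \<sigma>\<close>,
  because the left side absorbs \<rho>. Taking converses shows that \<open>between\<close> is
  symmetric, which yields the other inequality.\<close>

lemma between_iff_graph:
  assumes A: "A \<in> eq_obj R" and B: "B \<in> eq_obj R"
    and f: "f \<in> hom R (fst A) (fst B)" "between R A B f f"
    and g: "g \<in> hom R (fst A) (fst B)" "between R A B g g"
  shows "between R A B f g \<longleftrightarrow> Seq R (fst A) (fst B) (fst B) (graph R f) (snd B) =
    Seq R (fst A) (fst B) (fst B) (graph R g) (snd B)"
proof -
  let ?X = "fst A" and ?Y = "fst B" and ?\<rho> = "snd A" and ?\<sigma> = "snd B"
  note a = eq_objD[OF A] and b = eq_objD[OF B]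
  let ?s = "\<lambda>h. Seq R ?X ?Y ?Y (graph R h) ?\<sigma>" and ?r = "\<lambda>h. Seq R ?X ?X ?Y ?\<rho> (graph R h)"
  have le: "leq ?X ?Y (?s h) (?s k)"
    if "leq ?X ?Y (?r h) (?s k)" "h \<in> hom R ?X ?Y" "between R A B h h" "k \<in> hom R ?X ?Y" for h k
  proof -
    have "Seq R ?X ?Y ?Y (?r h) ?\<sigma> = ?s h"
      using that between_self_iff[OF A B] a b by (simp add: Fib_eq_completion[OF A B])
    moreover have "leq ?X ?Y (Seq R ?X ?Y ?Y (?r h) ?\<sigma>) (Seq R ?X ?Y ?Y (?s k) ?\<sigma>)"
      using that b by (intro leq_seq_left) auto
    ultimately show ?thesis using a b that by simp
  qed
  have sym: "between R A B g f" if "between R A B f g"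
  proof -
    have "leq ?X ?X ?\<rho> (Seq R ?X ?Y ?X (?s f) (cograph R g))"
      using that between_iff[OF A B f(1) g(1)] by simp
    from leq_conv[OF this] have "leq ?X ?X ?\<rho> (Seq R ?X ?Y ?X (?s g) (cograph R f))"
      using a b f(1) g(1) by simp
    then show ?thesis
      using a b f(1) g(1) between_iff[OF A B g(1) f(1)] by simp
  qed
  show ?thesis
  proof
    assume fg: "between R A B f g"
    show "?s f = ?s g"
      using le[of f g] le[of g f] fg sym f g between_iff_leq[OF A B]
      by (blast intro: leq_antisym)
  next
    assume "?s f = ?s g"
    then show "between R A B f g"
      using between_iff_leq[OF A B] f(1) g by simp
  qed
qed

text \<open>On compatible arrows the classes are the fibres of the map
  \<open>f \<mapsto> \<Gamma>\<^sub>f ; \<sigma>\<close>.\<close>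

lemma eq_arr_eq_iff:
  assumes A: "A \<in> eq_obj R" and B: "B \<in> eq_obj R"
    and f: "f \<in> hom R (fst A) (fst B)" "between R A B f f"
    and g: "g \<in> hom R (fst A) (fst B)" "between R A B g g"
  shows "eq_arr R A B f = eq_arr R A B g \<longleftrightarrow> Seq R (fst A) (fst B) (fst B) (graph R f) (snd B) =
    Seq R (fst A) (fst B) (fst B) (graph R g) (snd B)"
proof -
  have cls: "eq_rel R A B `` {h} = {k. k \<in> hom R (fst A) (fst B) \<and> between R A B k k \<and>
      Seq R (fst A) (fst B) (fst B) (graph R h) (snd B) =
      Seq R (fst A) (fst B) (fst B) (graph R k) (snd B)}"
    if "h \<in> hom R (fst A) (fst B)" "between R A B h h" for h
    using that by (auto simp: eq_rel_def between_iff_graph[OF A B])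
  then show ?thesis
    unfolding eq_arr_def cls[OF f] cls[OF g] using f g by auto
qed

text \<open>Intended graph in the completion. The general \<open>graph\<close> would also involve a
  chosen representative of an identity class, and its properties presuppose that the completion is a
  doctrine.\<close>

definition eq_graph :: "('o, 'a, 'r) eq_arrow \<Rightarrow> 'r"
  where "eq_graph \<phi> = Seq R (fst (eq_dom \<phi>)) (fst (eq_cod \<phi>)) (fst (eq_cod \<phi>))
    (graph R (eq_rep \<phi>)) (snd (eq_cod \<phi>))"

lemma eq_arr_hom:
  assumes "A \<in> eq_obj R" "B \<in> eq_obj R" "f \<in> hom R (fst A) (fst B)" "between R A B f f"
  shows "eq_arr R A B f \<in> hom (eq_completion R) A B"
proof -
  have "Arr (eq_completion R) = {eq_arr R A B f | A B f.
      A \<in> eq_obj R \<and> B \<in> eq_obj R \<and> f \<in> hom R (fst A) (fst B) \<and> between R A B f f}"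
    by (simp add: eq_completion_def)
  then have "eq_arr R A B f \<in> Arr (eq_completion R)" using assms by blast
  then show ?thesis by (simp add: hom_def eq_arr_def eq_dom_def eq_cod_def)
qed

lemma eq_rep:
  assumes "\<phi> \<in> hom (eq_completion R) A B"
  shows "A \<in> eq_obj R" "B \<in> eq_obj R" "eq_rep \<phi> \<in> hom R (fst A) (fst B)"
    "between R A B (eq_rep \<phi>) (eq_rep \<phi>)" "\<phi> = eq_arr R A B (eq_rep \<phi>)"
proof -
  obtain f where A: "A \<in> eq_obj R" and B: "B \<in> eq_obj R" and f: "f \<in> hom R (fst A) (fst B)"
    "between R A B f f" and \<phi>: "\<phi> = eq_arr R A B f"
    using assms by (auto simp: hom_def eq_arr_def eq_dom_def eq_cod_def eq_completion_def)
  have "f \<in> fst (snd \<phi>)" using f by (simp add: \<phi> eq_arr_def eq_rel_def)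
  then have "eq_rep \<phi> \<in> fst (snd \<phi>)" unfolding eq_rep_def by (rule someI)
  then have *: "eq_rep \<phi> \<in> hom R (fst A) (fst B)" "between R A B (eq_rep \<phi>) (eq_rep \<phi>)"
    and "between R A B f (eq_rep \<phi>)"
    by (auto simp: \<phi> eq_arr_def eq_rel_def)
  then have "eq_arr R A B f = eq_arr R A B (eq_rep \<phi>)"
    using iffD2[OF eq_arr_eq_iff[OF A B f *]] iffD1[OF between_iff_graph[OF A B f *]] by blast
  with \<phi> show "\<phi> = eq_arr R A B (eq_rep \<phi>)" by (rule trans)
  show "A \<in> eq_obj R" "B \<in> eq_obj R" "eq_rep \<phi> \<in> hom R (fst A) (fst B)"
    "between R A B (eq_rep \<phi>) (eq_rep \<phi>)"
    by fact+
qed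

lemma eq_dom_cod: "\<phi> \<in> hom (eq_completion R) A B \<Longrightarrow> eq_dom \<phi> = A \<and> eq_cod \<phi> = B"
  by (simp add: hom_def)

lemma eq_graph_rep:
  "\<phi> \<in> hom (eq_completion R) A B \<Longrightarrow>
    eq_graph \<phi> = Seq R (fst A) (fst B) (fst B) (graph R (eq_rep \<phi>)) (snd B)"
  by (simp add: eq_graph_def eq_dom_cod)

lemma eq_graph_eq_arr:
  assumes "A \<in> eq_obj R" "B \<in> eq_obj R" "f \<in> hom R (fst A) (fst B)" "between R A B f f"
  shows "eq_graph (eq_arr R A B f) = Seq R (fst A) (fst B) (fst B) (graph R f) (snd B)"
proof -
  note h = eq_arr_hom[OF assms]
  show ?thesis
    using eq_graph_rep[OF h] iffD1[OF eq_arr_eq_iff[OF assms eq_rep(3,4)[OF h]] eq_rep(5)[OF h]] by simp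
qed

lemma eq_graph_closed: "\<phi> \<in> hom (eq_completion R) A B \<Longrightarrow> eq_graph \<phi> \<in> Fib (eq_completion R) A B"
  using between_self_iff eq_rep eq_graph_rep by metis

lemma fibres_eq_completion: "fibres (eq_completion R)"
proof
  fix A B assume A: "A \<in> Obj (eq_completion R)" and B: "B \<in> Obj (eq_completion R)"
  then have A': "A \<in> eq_obj R" and B': "B \<in> eq_obj R" by simp_all
  note a = eq_objD[OF A'] and b = eq_objD[OF B'] and fAB = Fib_eq_completion[OF A' B']
    and fBA = Fib_eq_completion[OF B' A']
  show "Dia (eq_completion R) A \<in> Fib (eq_completion R) A A"
    using a by (simp add: Fib_eq_completion[OF A' A'])
  show "Conv (eq_completion R) A A (Dia (eq_completion R) A) = Dia (eq_completion R) A"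
    using a by simp
  fix \<alpha> assume \<alpha>: "\<alpha> \<in> Fib (eq_completion R) A B"
  then have al: "\<alpha> \<in> Fib R (fst A) (fst B)" "Seq R (fst A) (fst A) (fst B) (snd A) \<alpha> = \<alpha>"
    "Seq R (fst A) (fst B) (fst B) \<alpha> (snd B) = \<alpha>" by (simp_all add: fAB)
  show "Le (eq_completion R) A B \<alpha> \<alpha>" using a b al by (simp add: le_refl)
  have "Seq R (fst B) (fst B) (fst A) (snd B) (Conv R (fst A) (fst B) \<alpha>) = Conv R (fst A) (fst B) \<alpha>"
    "Seq R (fst B) (fst A) (fst A) (Conv R (fst A) (fst B) \<alpha>) (snd A) = Conv R (fst A) (fst B) \<alpha>"
    using arg_cong[OF al(3), of "Conv R (fst A) (fst B)"] arg_cong[OF al(2), of "Conv R (fst A) (fst B)"]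
      a b al(1) by simp_all
  then show "Conv (eq_completion R) A B \<alpha> \<in> Fib (eq_completion R) B A"
    using a b al(1) by (simp add: fBA)
  show "Seq (eq_completion R) A A B (Dia (eq_completion R) A) \<alpha> = \<alpha>"
    "Seq (eq_completion R) A B B \<alpha> (Dia (eq_completion R) B) = \<alpha>" using al by simp_all
  show "Conv (eq_completion R) B A (Conv (eq_completion R) A B \<alpha>) = \<alpha>" using a b al by simp
  {
    fix \<beta> assume \<beta>: "\<beta> \<in> Fib (eq_completion R) A B"
      and le: "Le (eq_completion R) A B \<alpha> \<beta>"
    then have be: "\<beta> \<in> Fib R (fst A) (fst B)" "Le R (fst A) (fst B) \<alpha> \<beta>" by (simp_all add: fAB)
    show "Le (eq_completion R) B A (Conv (eq_completion R) A B \<alpha>) (Conv (eq_completion R) A B \<beta>)"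
      using a b al be by (simp add: conv_mono)
    show "\<alpha> = \<beta>" if "Le (eq_completion R) A B \<beta> \<alpha>"
      using that a b al be le_antisym[of "fst A" "fst B" \<alpha> \<beta>] by simp
    show "Le (eq_completion R) A B \<alpha> \<gamma>"
      if "\<gamma> \<in> Fib (eq_completion R) A B" "Le (eq_completion R) A B \<beta> \<gamma>" for \<gamma>
      using that a b al be le_trans[of "fst A" "fst B" \<alpha> \<beta> \<gamma>] by (simp add: fAB)
  }
  fix D assume "D \<in> Obj (eq_completion R)"
  then have D: "D \<in> eq_obj R" by simp
  note d = eq_objD[OF D] and fBD = Fib_eq_completion[OF B' D]
  fix \<beta> assume "\<beta> \<in> Fib (eq_completion R) B D"
  then have be: "\<beta> \<in> Fib R (fst B) (fst D)" "Seq R (fst B) (fst B) (fst D) (snd B) \<beta> = \<beta>"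
    "Seq R (fst B) (fst D) (fst D) \<beta> (snd D) = \<beta>" by (simp_all add: fBD)
  show "Seq (eq_completion R) A B D \<alpha> \<beta> \<in> Fib (eq_completion R) A D"
    using a b d al be seq_assoc[of "fst A" "fst A" "fst B" "fst D" "snd A" \<alpha> \<beta>]
    by (simp add: Fib_eq_completion[OF A' D])
  show "Conv (eq_completion R) A D (Seq (eq_completion R) A B D \<alpha> \<beta>) =
      Seq (eq_completion R) D B A (Conv (eq_completion R) B D \<beta>) (Conv (eq_completion R) A B \<alpha>)"
    using a b d al be by simp
  show "Le (eq_completion R) A D (Seq (eq_completion R) A B D \<alpha> \<beta>) (Seq (eq_completion R) A B D \<alpha>' \<beta>')"
    if "\<alpha>' \<in> Fib (eq_completion R) A B" "\<beta>' \<in> Fib (eq_completion R) B D"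
      "Le (eq_completion R) A B \<alpha> \<alpha>'" "Le (eq_completion R) B D \<beta> \<beta>'" for \<alpha>' \<beta>'
    using that a b d al be by (simp add: fAB fBD seq_mono)
  show "Seq (eq_completion R) A D W (Seq (eq_completion R) A B D \<alpha> \<beta>) \<gamma> =
      Seq (eq_completion R) A B W \<alpha> (Seq (eq_completion R) B D W \<beta> \<gamma>)"
    if "W \<in> Obj (eq_completion R)" "\<gamma> \<in> Fib (eq_completion R) D W" for W \<gamma>
    using that a b d al be eq_objD[of W] by (simp add: Fib_eq_completion[OF D])
qed

text \<open>The graph of \<psi> absorbs the middle equivalence relation on the left, which may
  therefore be inserted after \<open>\<Gamma>\<^sub>f\<close>: the composite of the representatives
  yields the composite of the graphs. This relation lies in the fibre, so the composite is
  compatible.\<close>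

lemma Comp_eq_completion:
  assumes \<phi>: "\<phi> \<in> hom (eq_completion R) A B" and \<psi>: "\<psi> \<in> hom (eq_completion R) B D"
  shows "Comp (eq_completion R) \<psi> \<phi> \<in> hom (eq_completion R) A D"
    and "eq_graph (Comp (eq_completion R) \<psi> \<phi>) =
      Seq R (fst A) (fst B) (fst D) (eq_graph \<phi>) (eq_graph \<psi>)"
proof -
  interpret Q: fibres "eq_completion R" by (rule fibres_eq_completion)
  note f = eq_rep[OF \<phi>] and g = eq_rep[OF \<psi>]
  note a = eq_objD[OF f(1)] and b = eq_objD[OF f(2)] and d = eq_objD[OF g(2)]
  let ?h = "Comp R (eq_rep \<psi>) (eq_rep \<phi>)"
  have h: "?h \<in> hom R (fst A) (fst D)" using Comp_hom[OF f(3) g(3)] .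
  have g\<psi>: "Seq R (fst B) (fst B) (fst D) (snd B) (eq_graph \<psi>) = eq_graph \<psi>"
    "eq_graph \<psi> \<in> Fib R (fst B) (fst D)"
    using eq_graph_closed[OF \<psi>] by (simp_all add: Fib_eq_completion[OF f(2) g(2)])
  have "Seq R (fst A) (fst D) (fst D) (graph R ?h) (snd D) =
      Seq R (fst A) (fst B) (fst D) (graph R (eq_rep \<phi>)) (eq_graph \<psi>)"
    using a b d f g by (simp add: graph_Comp[OF f(3) g(3)] eq_graph_rep[OF \<psi>])
  also have "\<dots> = Seq R (fst A) (fst B) (fst D) (graph R (eq_rep \<phi>))
      (Seq R (fst B) (fst B) (fst D) (snd B) (eq_graph \<psi>))"
    by (simp only: g\<psi>)
  also have "\<dots> = Seq R (fst A) (fst B) (fst D) (eq_graph \<phi>) (eq_graph \<psi>)"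
    using a b d f(3) g\<psi>(2) by (simp add: eq_graph_rep[OF \<phi>])
  finally have gr: "Seq R (fst A) (fst D) (fst D) (graph R ?h) (snd D) =
      Seq R (fst A) (fst B) (fst D) (eq_graph \<phi>) (eq_graph \<psi>)" .
  then have bt: "between R A D ?h ?h"
    using between_self_iff[OF f(1) g(2) h] f(1) g(1,2)
      Q.seq_closed[OF _ _ _ eq_graph_closed[OF \<phi>] eq_graph_closed[OF \<psi>]] by simp
  have "Comp (eq_completion R) \<psi> \<phi> = eq_arr R A D ?h"
    using eq_dom_cod[OF \<phi>] eq_dom_cod[OF \<psi>] by (simp add: eq_completion_def)
  then show "Comp (eq_completion R) \<psi> \<phi> \<in> hom (eq_completion R) A D"
    "eq_graph (Comp (eq_completion R) \<psi> \<phi>) =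
      Seq R (fst A) (fst B) (fst D) (eq_graph \<phi>) (eq_graph \<psi>)"
    using eq_arr_hom[OF f(1) g(2) h bt] eq_graph_eq_arr[OF f(1) g(2) h bt] gr by simp_all
qed

text \<open>Totality and functionality with \<open>snd A\<close> and \<open>snd B\<close> in the
  role of diagonals. The first is compatibility of the representative, with \<sigma> doubled; the
  second is functionality of the representative between two copies of \<sigma>.\<close>

lemma eq_graph_laws:
  assumes \<phi>: "\<phi> \<in> hom (eq_completion R) A B"
  shows "leq (fst A) (fst A) (snd A)
      (Seq R (fst A) (fst B) (fst A) (eq_graph \<phi>) (Conv R (fst A) (fst B) (eq_graph \<phi>)))"
    and "leq (fst B) (fst B)
      (Seq R (fst B) (fst A) (fst B) (Conv R (fst A) (fst B) (eq_graph \<phi>)) (eq_graph \<phi>)) (snd B)"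
proof -
  note f = eq_rep[OF \<phi>]
  note a = eq_objD[OF f(1)] and b = eq_objD[OF f(2)]
  let ?X = "fst A" and ?Y = "fst B" and ?\<rho> = "snd A" and ?\<sigma> = "snd B"
  let ?f = "graph R (eq_rep \<phi>)" and ?c = "cograph R (eq_rep \<phi>)"
  have "leq ?X ?X ?\<rho> (Seq R ?X ?Y ?X ?f (Seq R ?Y ?Y ?X ?\<sigma> ?c))"
    using f(4) a b f(3) unfolding between_iff[OF f(1,2,3,3)] by simp
  also have "\<dots> = Seq R ?X ?Y ?X (eq_graph \<phi>) (Conv R ?X ?Y (eq_graph \<phi>))"
    using a b f(3) seq_idem[OF f(2) a(1)] by (simp add: eq_graph_rep[OF \<phi>])
  finally show "leq ?X ?X ?\<rho> (Seq R ?X ?Y ?X (eq_graph \<phi>) (Conv R ?X ?Y (eq_graph \<phi>)))" .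
  have "Seq R ?Y ?X ?Y (Conv R ?X ?Y (eq_graph \<phi>)) (eq_graph \<phi>) =
      Seq R ?Y ?Y ?Y ?\<sigma> (Seq R ?Y ?Y ?Y (Seq R ?Y ?X ?Y ?c ?f) ?\<sigma>)"
    using a b f(3) by (simp add: eq_graph_rep[OF \<phi>])
  also have "leq ?Y ?Y \<dots> (Seq R ?Y ?Y ?Y ?\<sigma> ?\<sigma>)"
    by (intro leq_seq_right seq_dia_leq_left graph_functional[OF f(3)]) (use b in auto)
  finally show "leq ?Y ?Y (Seq R ?Y ?X ?Y (Conv R ?X ?Y (eq_graph \<phi>)) (eq_graph \<phi>)) ?\<sigma>"
    using b by simp
qed

lemma
  shows relational_doctrine_eq_completion: "relational_doctrine (eq_completion R)"
    and extensional_eq_completion: "extensional (eq_completion R)"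
    and graph_eq_completion: "\<phi> \<in> hom (eq_completion R) A B \<Longrightarrow>
      graph (eq_completion R) \<phi> = eq_graph \<phi>"
proof -
  interpret Q: fibres "eq_completion R" by (rule fibres_eq_completion)
  have arr: "\<phi> \<in> hom (eq_completion R) (eq_dom \<phi>) (eq_cod \<phi>)"
    if "\<phi> \<in> Arr (eq_completion R)" for \<phi>
    using that by (simp add: hom_def)
  have 1: "Dom (eq_completion R) \<phi> \<in> Obj (eq_completion R)"
    and 2: "Cod (eq_completion R) \<phi> \<in> Obj (eq_completion R)" if "\<phi> \<in> Arr (eq_completion R)" for \<phi>
    using eq_rep(1,2)[OF arr[OF that]] by simp_all
  have bt: "between R A A (Ide R (fst A)) (Ide R (fst A))" if A: "A \<in> eq_obj R" for A
    using between_self_iff[OF A A Ide_hom] eq_objD[OF A] Q.dia_closed[of A] A by simp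
  have 3: "Ide (eq_completion R) A \<in> hom (eq_completion R) A A"
    and 6: "eq_graph (Ide (eq_completion R) A) = Dia (eq_completion R) A"
    if "A \<in> Obj (eq_completion R)" for A
    using that eq_arr_hom[OF _ _ Ide_hom bt] eq_graph_eq_arr[OF _ _ Ide_hom bt] eq_objD[of A]
    by simp_all
  have 7: "eq_graph (Comp (eq_completion R) \<psi> \<phi>) =
      Seq (eq_completion R) A B D (eq_graph \<phi>) (eq_graph \<psi>)"
    if "\<phi> \<in> hom (eq_completion R) A B" "\<psi> \<in> hom (eq_completion R) B D" for \<phi> \<psi> A B D
    using Comp_eq_completion(2)[OF that] by simp
  have cl: "eq_graph \<phi> \<in> Fib (eq_completion R) A B" "A \<in> Obj (eq_completion R)"
    "B \<in> Obj (eq_completion R)" if "\<phi> \<in> hom (eq_completion R) A B" for \<phi> A B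
    using that eq_graph_closed eq_rep by simp_all
  have 8: "Q.leq A A (Dia (eq_completion R) A) (Seq (eq_completion R) A B A (eq_graph \<phi>)
      (Conv (eq_completion R) A B (eq_graph \<phi>)))"
    and 9: "Q.leq B B (Seq (eq_completion R) B A B (Conv (eq_completion R) A B (eq_graph \<phi>))
      (eq_graph \<phi>)) (Dia (eq_completion R) B)"
    if \<phi>: "\<phi> \<in> hom (eq_completion R) A B" for \<phi> A B
    using leqD[OF eq_graph_laws(1)[OF \<phi>]] leqD[OF eq_graph_laws(2)[OF \<phi>]] cl[OF \<phi>]
    by (auto intro!: Q.leqI Q.dia_closed Q.seq_closed Q.conv_closed simp del: eq_completion_simps)
      (auto simp: eq_completion_simps)
  have 10: "\<phi> = \<psi>"
    if \<phi>: "\<phi> \<in> hom (eq_completion R) A B" and \<psi>: "\<psi> \<in> hom (eq_completion R) A B"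
      and eq: "eq_graph \<phi> = eq_graph \<psi>" for \<phi> \<psi> A B
    using iffD2[OF eq_arr_eq_iff[OF eq_rep(1-4)[OF \<phi>] eq_rep(3,4)[OF \<psi>]]] eq
      eq_graph_rep[OF \<phi>] eq_graph_rep[OF \<psi>] eq_rep(5)[OF \<phi>] eq_rep(5)[OF \<psi>] by metis
  \<comment> \<open>Reindexing is computed on bare representatives. The equivalence relations that
    \<open>eq_graph\<close> adds are absorbed by \<alpha>.\<close>
  have 11: "Reindex (eq_completion R) \<phi> \<psi> \<alpha> = Seq (eq_completion R) A X B (eq_graph \<phi>)
      (Seq (eq_completion R) X Y B \<alpha> (Conv (eq_completion R) B Y (eq_graph \<psi>)))"
    if \<phi>: "\<phi> \<in> hom (eq_completion R) A X" and \<psi>: "\<psi> \<in> hom (eq_completion R) B Y"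
      and \<alpha>: "\<alpha> \<in> Fib (eq_completion R) X Y" for \<phi> \<psi> A B X Y \<alpha>
  proof -
    note f = eq_rep[OF \<phi>] and g = eq_rep[OF \<psi>]
    note o = eq_objD[OF f(1)] eq_objD[OF f(2)] eq_objD[OF g(1)] eq_objD[OF g(2)]
    have al: "\<alpha> \<in> Fib R (fst X) (fst Y)" "Seq R (fst X) (fst X) (fst Y) (snd X) \<alpha> = \<alpha>"
      "Seq R (fst X) (fst Y) (fst Y) \<alpha> (snd Y) = \<alpha>"
      using \<alpha> by (simp_all add: Fib_eq_completion[OF f(2) g(2)])
    have "Seq R (fst A) (fst X) (fst B) (eq_graph \<phi>)
      (Seq R (fst X) (fst Y) (fst B) \<alpha> (Conv R (fst B) (fst Y) (eq_graph \<psi>))) =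
      Seq R (fst A) (fst X) (fst B) (graph R (eq_rep \<phi>)) (Seq R (fst X) (fst Y) (fst B)
        (Seq R (fst X) (fst X) (fst Y) (snd X) (Seq R (fst X) (fst Y) (fst Y) \<alpha> (snd Y)))
        (cograph R (eq_rep \<psi>)))"
      using o f(3) g(3) al(1) by (simp add: eq_graph_rep[OF \<phi>] eq_graph_rep[OF \<psi>])
    also have "\<dots> = Seq R (fst A) (fst X) (fst B) (graph R (eq_rep \<phi>))
        (Seq R (fst X) (fst Y) (fst B) \<alpha> (cograph R (eq_rep \<psi>)))"
      by (simp only: al)
    also have "\<dots> = Reindex R (eq_rep \<phi>) (eq_rep \<psi>) \<alpha>"
      using Reindex_eq[OF f(3) g(3) al(1)] by simp
    finally show ?thesis by (simp add: eq_completion_def)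
  qed
  note laws = 1 2 3 Comp_eq_completion(1) cl(1) 6 7 8 9 10 11
  show "relational_doctrine (eq_completion R)"
    by (rule Q.relational_doctrine_of_graphs[where \<Gamma> = eq_graph]) (fact laws)+
  show "extensional (eq_completion R)"
    by (rule Q.extensional_of_graphs[where \<Gamma> = eq_graph]) (fact laws)+
  show "graph (eq_completion R) \<phi> = eq_graph \<phi>" if "\<phi> \<in> hom (eq_completion R) A B"
    by (rule Q.graph_of_graphs[where \<Gamma> = eq_graph, OF _ _ _ _ _ _ _ _ _ _ _ that]) (fact laws)+
qed

lemma graph_eq_completion_ex:
  assumes "\<phi> \<in> hom (eq_completion R) A B"
  obtains f where "f \<in> hom R (fst A) (fst B)"
    "graph (eq_completion R) \<phi> = Seq R (fst A) (fst B) (fst B) (graph R f) (snd B)"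
  using that eq_rep(3)[OF assms] eq_graph_rep[OF assms] graph_eq_completion[OF assms] by metis

text \<open>Used to construct arrows: it suffices to check that the intended graph lies in the
  fibre, which is compatibility of the representative.\<close>

lemma eq_arr_graph:
  assumes A: "A \<in> eq_obj R" and B: "B \<in> eq_obj R" and f: "f \<in> hom R (fst A) (fst B)"
    and gr: "Seq R (fst A) (fst B) (fst B) (graph R f) (snd B) \<in> Fib (eq_completion R) A B"
  shows "eq_arr R A B f \<in> hom (eq_completion R) A B"
    and "graph (eq_completion R) (eq_arr R A B f) = Seq R (fst A) (fst B) (fst B) (graph R f) (snd B)"
  using between_self_iff[OF A B f] eq_arr_hom[OF A B f] eq_graph_eq_arr[OF A B f] gr
    graph_eq_completion[of "eq_arr R A B f" A B] by simp_all

text \<open>Dividing \<open>(X, \<rho>)\<close> by \<tau> keeps X and enlarges the relation. The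
  graph of the quotient arrow is \<tau> itself, so symmetry and idempotence of \<tau> make it both
  effective and descent.\<close>

lemma quotient_arrow_eq_completion:
  assumes A: "A \<in> eq_obj R" and \<tau>: "equivalence_rel (eq_completion R) A \<tau>"
  shows "(fst A, \<tau>) \<in> eq_obj R"
    and "quotient_arrow (eq_completion R) A \<tau> (eq_arr R A (fst A, \<tau>) (Ide R (fst A)))"
    and "eq_arr R A (fst A, \<tau>) (Ide R (fst A)) \<in> hom (eq_completion R) A (fst A, \<tau>)"
    and "graph (eq_completion R) (eq_arr R A (fst A, \<tau>) (Ide R (fst A))) = \<tau>"
    and "kernel (eq_completion R) (eq_arr R A (fst A, \<tau>) (Ide R (fst A))) = \<tau>"
    and "descent (eq_completion R) (eq_arr R A (fst A, \<tau>) (Ide R (fst A)))"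
proof -
  interpret Q: relational_doctrine "eq_completion R" by (rule relational_doctrine_eq_completion)
  let ?X = "fst A" and ?\<rho> = "snd A" and ?T = "(fst A, \<tau>)"
  let ?q = "eq_arr R A ?T (Ide R ?X)"
  note a = eq_objD[OF A]
  have t: "\<tau> \<in> Fib (eq_completion R) A A" "Le R ?X ?X ?\<rho> \<tau>" "Conv R ?X ?X \<tau> = \<tau>"
    "Seq R ?X ?X ?X \<tau> \<tau> = \<tau>"
    using \<tau> Q.equivalence_rel_iff[of A \<tau>] A by (simp_all add: Q.leq_def)
  then have tR: "\<tau> \<in> Fib R ?X ?X" "Seq R ?X ?X ?X ?\<rho> \<tau> = \<tau>"
    by (simp_all add: Fib_eq_completion[OF A A])
  have "leq ?X ?X (Dia R ?X) \<tau>"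
    using leq_trans[OF a(3) leqI[OF a(1,1,2) tR(1) t(2)]] .
  then show T: "?T \<in> eq_obj R"
    using t a by (intro eq_objI) (simp_all add: equivalence_rel_iff)
  have gr: "Seq R ?X ?X ?X (graph R (Ide R ?X)) \<tau> = \<tau>" using a tR by simp
  have "\<tau> \<in> Fib (eq_completion R) A ?T"
    using tR t a by (simp add: Fib_eq_completion[OF A T])
  then show q: "?q \<in> hom (eq_completion R) A ?T" and gq: "graph (eq_completion R) ?q = \<tau>"
    using eq_arr_graph[OF A T, of "Ide R ?X"] Ide_hom[OF a(1)] gr by simp_all
  have cq: "cograph (eq_completion R) ?q = \<tau>"
    using Q.cograph_eq[OF q] gq t by simp
  show kq: "kernel (eq_completion R) ?q = \<tau>" and dq: "descent (eq_completion R) ?q"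
    using Q.kernel_eq[OF q] Q.descent_iff[OF q] gq cq t by simp_all
  show "quotient_arrow (eq_completion R) A \<tau> ?q"
  proof (rule Q.quotient_arrowI[OF extensional_eq_completion \<tau> q _ dq])
    show "Le (eq_completion R) A A \<tau> (kernel (eq_completion R) ?q)"
      using kq Q.le_refl[of A A \<tau>] A t by simp
    fix \<phi> Z assume \<phi>: "\<phi> \<in> hom (eq_completion R) A Z"
      and le: "Le (eq_completion R) A A \<tau> (kernel (eq_completion R) \<phi>)"
    have Z: "Z \<in> eq_obj R" using Q.hom_Obj[OF \<phi>] by simp
    let ?g = "graph (eq_completion R) \<phi>"
    have "Q.leq A A \<tau> (kernel (eq_completion R) \<phi>)"
      using le t A Q.kernel_closed[OF \<phi>] by (intro Q.leqI) simp_all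
    then have "Q.leq A Z (Seq (eq_completion R) A A Z \<tau> ?g)
        (Seq (eq_completion R) A A Z (kernel (eq_completion R) \<phi>) ?g)"
      using \<phi> Z by (intro Q.leq_seq_left) simp_all
    also have "\<dots> = ?g" by (rule Q.graph_cograph_graph[OF \<phi>])
    finally have "Q.leq A Z (Seq (eq_completion R) A A Z \<tau> ?g) ?g" .
    moreover have "Q.leq A Z ?g (Seq (eq_completion R) A A Z \<tau> ?g)"
      using \<tau> A Z \<phi> Q.equivalence_rel_iff[of A \<tau>] by (intro Q.leq_seq_dia_left) simp_all
    ultimately have eq: "Seq R ?X ?X (fst Z) \<tau> ?g = ?g"
      using Q.leq_antisym by fastforce
    \<comment> \<open>Compatibility of \<phi> with \<tau> has made its graph absorb \<tau>, so a
      representative of \<phi> also represents an arrow out of \<open>(X, \<tau>)\<close>.\<close>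
    obtain f where f: "f \<in> hom R ?X (fst Z)"
      "?g = Seq R ?X (fst Z) (fst Z) (graph R f) (snd Z)"
      using graph_eq_completion_ex[OF \<phi>] .
    have gZ: "?g \<in> Fib (eq_completion R) ?T Z"
      using Q.graph_closed[OF \<phi>] eq by (simp add: Fib_eq_completion[OF A Z] Fib_eq_completion[OF T Z])
    show "\<exists>h\<in>hom (eq_completion R) ?T Z.
        ?g = Seq (eq_completion R) A ?T Z (graph (eq_completion R) ?q) (graph (eq_completion R) h)"
      using eq_arr_graph[OF T Z, of f] f gZ eq gq
      by (intro bexI[of _ "eq_arr R ?T Z f"]) simp_all
  qed
qed

lemma has_quotients_eq_completion: "has_quotients (eq_completion R)"
  unfolding has_quotients_def effective_def
  using quotient_arrow_eq_completion by (metis eq_completion_simps(1))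

lemma EQRD_object_eq_completion: "EQRD_object (eq_completion R)"
  by (simp add: EQRD_object_def relational_doctrine_eq_completion extensional_eq_completion
      has_quotients_eq_completion)

end

section \<open>Arrows determined by their action on relations\<close>

lemma arrow_simps [simp]:
  "ObMap (comp_arrow G F) X = ObMap G (ObMap F X)" "ArMap (comp_arrow G F) f = ArMap G (ArMap F f)"
  "RelMap (comp_arrow G F) X Y \<alpha> = RelMap G (ObMap F X) (ObMap F Y) (RelMap F X Y \<alpha>)"
  "ObMap id_arrow X = X" "ArMap id_arrow f = f" "RelMap id_arrow X Y \<alpha> = \<alpha>"
  "ObMap (eq_unit R) X = (X, Dia R X)" "RelMap (eq_unit R) X Y \<alpha> = \<alpha>"
  by (simp_all add: comp_arrow_def id_arrow_def eq_unit_def)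

definition is_graph :: "('o, 'a, 'r) reldoc \<Rightarrow> 'o \<Rightarrow> 'o \<Rightarrow> 'r \<Rightarrow> bool"
  where "is_graph R X Y \<alpha> \<longleftrightarrow> (\<exists>f\<in>hom R X Y. graph R f = \<alpha>)"

text \<open>An isomorphism of the base named by its graph; the converse being a graph too supplies
  the inverse arrow.\<close>

definition graph_iso :: "('o, 'a, 'r) reldoc \<Rightarrow> 'o \<Rightarrow> 'o \<Rightarrow> 'r \<Rightarrow> bool"
  where "graph_iso R X Y \<tau> \<longleftrightarrow> is_graph R X Y \<tau> \<and> is_graph R Y X (Conv R X Y \<tau>) \<and>
    Seq R X Y X \<tau> (Conv R X Y \<tau>) = Dia R X \<and> Seq R Y X Y (Conv R X Y \<tau>) \<tau> = Dia R Y"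

lemma (in relational_doctrine) graph_iso_sym:
  assumes "graph_iso R X Y \<tau>"
  shows "graph_iso R Y X (Conv R X Y \<tau>)"
proof -
  obtain f where "f \<in> hom R X Y" "graph R f = \<tau>"
    using assms by (auto simp: graph_iso_def is_graph_def)
  then have "Conv R Y X (Conv R X Y \<tau>) = \<tau>" using hom_Obj[of f X Y] by auto
  then show ?thesis using assms by (simp add: graph_iso_def)
qed

lemma (in relational_doctrine) graph_isoD:
  assumes "graph_iso R X Y \<tau>"
  shows "X \<in> Obj R" "Y \<in> Obj R" "\<tau> \<in> Fib R X Y"
    "Seq R X Y X \<tau> (Conv R X Y \<tau>) = Dia R X" "Seq R Y X Y (Conv R X Y \<tau>) \<tau> = Dia R Y"
  using assms hom_Obj by (auto simp: graph_iso_def is_graph_def)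

lemma (in relational_doctrine) is_graphD:
  assumes "is_graph R X Y \<alpha>"
  shows "X \<in> Obj R" "Y \<in> Obj R" "\<alpha> \<in> Fib R X Y"
  using assms hom_Obj by (auto simp: is_graph_def)

lemma (in relational_doctrine) is_graph_Dia: "X \<in> Obj R \<Longrightarrow> is_graph R X X (Dia R X)"
  using Ide_hom graph_Ide unfolding is_graph_def by blast

section \<open>Effect of a 1-arrow on graphs, kernels and equivalence relations\<close>

context rd_arrow
begin

lemma graph_ArMap:
  assumes f: "f \<in> hom R X Y"
  shows "graph S (ArMap F f) = RelMap F X Y (graph R f)"
proof -
  have "Cod R f = Y" "Cod S (ArMap F f) = ObMap F Y"
    using f ArMap_hom[OF f] by (simp_all add: hom_def)
  then show ?thesis
    using f src.hom_Obj[OF f]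
      RelMap_natural[OF f src.Ide_hom[of Y], of "Dia R Y"] RelMap_Dia[of Y] ArMap_Ide[of Y]
    by (simp add: graph_def)
qed

lemma cograph_ArMap:
  assumes f: "f \<in> hom R X Y"
  shows "cograph S (ArMap F f) = RelMap F Y X (cograph R f)"
  using f src.hom_Obj[OF f]
  by (simp only: src.cograph_eq[OF f] tgt.cograph_eq[OF ArMap_hom[OF f]] graph_ArMap[OF f]
      RelMap_Conv src.graph_closed)

lemma kernel_ArMap:
  assumes f: "f \<in> hom R X Y"
  shows "kernel S (ArMap F f) = RelMap F X X (kernel R f)"
  using f src.hom_Obj[OF f]
  by (simp add: src.kernel_eq[OF f] tgt.kernel_eq[OF ArMap_hom[OF f]] graph_ArMap[OF f]
      cograph_ArMap[OF f] RelMap_Seq)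

lemma descent_ArMap:
  assumes f: "f \<in> hom R X Y" and d: "descent R f"
  shows "descent S (ArMap F f)"
  using f d src.hom_Obj[OF f]
    RelMap_Seq[of Y X Y "cograph R f" "graph R f"] RelMap_Dia[of Y]
  by (simp add: src.descent_iff[OF f] tgt.descent_iff[OF ArMap_hom[OF f]] graph_ArMap[OF f]
      cograph_ArMap[OF f])

lemma RelMap_leq: "src.leq X Y \<alpha> \<beta> \<Longrightarrow>
    tgt.leq (ObMap F X) (ObMap F Y) (RelMap F X Y \<alpha>) (RelMap F X Y \<beta>)"
  by (simp add: src.leq_def tgt.leq_def ObMap_closed RelMap_closed RelMap_mono)

lemma equivalence_rel_RelMap:
  assumes X: "X \<in> Obj R" and \<rho>: "equivalence_rel R X \<rho>"
  shows "equivalence_rel S (ObMap F X) (RelMap F X X \<rho>)"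
proof -
  have "\<rho> \<in> Fib R X X" using \<rho> by (simp add: equivalence_rel_def)
  then show ?thesis
    using src.equivalence_rel_iff[OF X, of \<rho>] \<rho> RelMap_leq[of X X "Dia R X" \<rho>]
      RelMap_Dia[OF X] RelMap_Conv[OF X X, of \<rho>] RelMap_Seq[OF X X X, of \<rho> \<rho>]
    by (simp add: tgt.equivalence_rel_iff[OF ObMap_closed[OF X]])
qed

end

lemma rd_arrowI:
  assumes R: "relational_doctrine R" and S: "relational_doctrine S" and ext: "extensional S"
    and ob: "\<And>X. X \<in> Obj R \<Longrightarrow> ObMap F X \<in> Obj S"
    and ar: "\<And>f X Y. f \<in> hom R X Y \<Longrightarrow> ArMap F f \<in> hom S (ObMap F X) (ObMap F Y)"
    and gr: "\<And>f X Y. f \<in> hom R X Y \<Longrightarrow> graph S (ArMap F f) = RelMap F X Y (graph R f)"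
    and rel: "\<And>X Y \<alpha>. X \<in> Obj R \<Longrightarrow> Y \<in> Obj R \<Longrightarrow> \<alpha> \<in> Fib R X Y \<Longrightarrow>
      RelMap F X Y \<alpha> \<in> Fib S (ObMap F X) (ObMap F Y)"
    and mono: "\<And>X Y \<alpha> \<beta>. X \<in> Obj R \<Longrightarrow> Y \<in> Obj R \<Longrightarrow> \<alpha> \<in> Fib R X Y \<Longrightarrow> \<beta> \<in> Fib R X Y \<Longrightarrow>
      Le R X Y \<alpha> \<beta> \<Longrightarrow> Le S (ObMap F X) (ObMap F Y) (RelMap F X Y \<alpha>) (RelMap F X Y \<beta>)"
    and dia: "\<And>X. X \<in> Obj R \<Longrightarrow> RelMap F X X (Dia R X) = Dia S (ObMap F X)"
    and seq: "\<And>X Y Z \<alpha> \<beta>. X \<in> Obj R \<Longrightarrow> Y \<in> Obj R \<Longrightarrow> Z \<in> Obj R \<Longrightarrow>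
      \<alpha> \<in> Fib R X Y \<Longrightarrow> \<beta> \<in> Fib R Y Z \<Longrightarrow> RelMap F X Z (Seq R X Y Z \<alpha> \<beta>) =
        Seq S (ObMap F X) (ObMap F Y) (ObMap F Z) (RelMap F X Y \<alpha>) (RelMap F Y Z \<beta>)"
    and conv: "\<And>X Y \<alpha>. X \<in> Obj R \<Longrightarrow> Y \<in> Obj R \<Longrightarrow> \<alpha> \<in> Fib R X Y \<Longrightarrow>
      RelMap F Y X (Conv R X Y \<alpha>) = Conv S (ObMap F X) (ObMap F Y) (RelMap F X Y \<alpha>)"
  shows "rd_arrow R S F"
proof -
  interpret src: relational_doctrine R by (rule R)
  interpret tgt: relational_doctrine S by (rule S)
  show ?thesis
  proof unfold_locales
    show "ArMap F (Ide R X) = Ide S (ObMap F X)" if X: "X \<in> Obj R" for X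
      by (rule tgt.extensionalD[OF ext ar[OF src.Ide_hom[OF X]] tgt.Ide_hom[OF ob[OF X]]])
        (simp add: gr[OF src.Ide_hom[OF X]] X dia ob)
    show "ArMap F (Comp R g f) = Comp S (ArMap F g) (ArMap F f)"
      if f: "f \<in> hom R X Y" and g: "g \<in> hom R Y Z" for f g X Y Z
      by (rule tgt.extensionalD[OF ext ar[OF src.Comp_hom[OF f g]] tgt.Comp_hom[OF ar[OF f] ar[OF g]]])
        (simp add: gr[OF src.Comp_hom[OF f g]] src.graph_Comp[OF f g] tgt.graph_Comp[OF ar[OF f] ar[OF g]]
          gr[OF f] gr[OF g] seq f g src.hom_Obj[OF f] src.hom_Obj[OF g])
    show "RelMap F A B (Reindex R f g \<alpha>) = Reindex S (ArMap F f) (ArMap F g) (RelMap F X Y \<alpha>)"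
      if f: "f \<in> hom R A X" and g: "g \<in> hom R B Y" and a: "\<alpha> \<in> Fib R X Y" for f g A B X Y \<alpha>
    proof -
      note o = src.hom_Obj[OF f] src.hom_Obj[OF g]
      have cg: "cograph S (ArMap F g) = RelMap F Y B (cograph R g)"
        using g o by (simp only: src.cograph_eq[OF g] tgt.cograph_eq[OF ar[OF g]] gr[OF g]
            conv src.graph_closed)
      show ?thesis
        using f g a o
        by (simp add: src.Reindex_eq[OF f g a] tgt.Reindex_eq[OF ar[OF f] ar[OF g] rel]
            gr[OF f] cg seq)
    qed
  qed (use ob ar rel mono dia seq conv in \<open>blast+\<close>)
qed

text \<open>The action on arrows need not be supplied: since the action on relations sends graphs to
  graphs, an arrow with the prescribed graph can be chosen, and extensionality of S makes it
  unique.\<close>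

lemma rd_arrow_ex:
  assumes R: "relational_doctrine R" and S: "relational_doctrine S" and ext: "extensional S"
    and ob: "\<And>X. X \<in> Obj R \<Longrightarrow> O' X \<in> Obj S"
    and gr: "\<And>X Y \<alpha>. is_graph R X Y \<alpha> \<Longrightarrow> is_graph S (O' X) (O' Y) (M X Y \<alpha>)"
    and rel: "\<And>X Y \<alpha>. X \<in> Obj R \<Longrightarrow> Y \<in> Obj R \<Longrightarrow> \<alpha> \<in> Fib R X Y \<Longrightarrow>
      M X Y \<alpha> \<in> Fib S (O' X) (O' Y)"
    and mono: "\<And>X Y \<alpha> \<beta>. X \<in> Obj R \<Longrightarrow> Y \<in> Obj R \<Longrightarrow> \<alpha> \<in> Fib R X Y \<Longrightarrow> \<beta> \<in> Fib R X Y \<Longrightarrow>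
      Le R X Y \<alpha> \<beta> \<Longrightarrow> Le S (O' X) (O' Y) (M X Y \<alpha>) (M X Y \<beta>)"
    and dia: "\<And>X. X \<in> Obj R \<Longrightarrow> M X X (Dia R X) = Dia S (O' X)"
    and seq: "\<And>X Y Z \<alpha> \<beta>. X \<in> Obj R \<Longrightarrow> Y \<in> Obj R \<Longrightarrow> Z \<in> Obj R \<Longrightarrow>
      \<alpha> \<in> Fib R X Y \<Longrightarrow> \<beta> \<in> Fib R Y Z \<Longrightarrow>
      M X Z (Seq R X Y Z \<alpha> \<beta>) = Seq S (O' X) (O' Y) (O' Z) (M X Y \<alpha>) (M Y Z \<beta>)"
    and conv: "\<And>X Y \<alpha>. X \<in> Obj R \<Longrightarrow> Y \<in> Obj R \<Longrightarrow> \<alpha> \<in> Fib R X Y \<Longrightarrow>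
      M Y X (Conv R X Y \<alpha>) = Conv S (O' X) (O' Y) (M X Y \<alpha>)"
  obtains F where "rd_arrow R S F" "ObMap F = O'" "RelMap F = M"
proof -
  let ?A = "\<lambda>f. SOME g. g \<in> hom S (O' (Dom R f)) (O' (Cod R f)) \<and>
    graph S g = M (Dom R f) (Cod R f) (graph R f)"
  have A: "?A f \<in> hom S (O' X) (O' Y) \<and> graph S (?A f) = M X Y (graph R f)"
    if f: "f \<in> hom R X Y" for f X Y
  proof -
    have "Dom R f = X" "Cod R f = Y" using f by (simp_all add: hom_def)
    moreover have "is_graph R X Y (graph R f)" using f by (auto simp: is_graph_def)
    from gr[OF this] have "\<exists>g. g \<in> hom S (O' X) (O' Y) \<and> graph S g = M X Y (graph R f)"
      by (auto simp: is_graph_def)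
    from someI_ex[OF this] calculation show ?thesis by simp
  qed
  let ?F = "\<lparr>ObMap = O', ArMap = ?A, RelMap = M\<rparr>"
  have "rd_arrow R S ?F"
    by (rule rd_arrowI[OF R S ext]) (use ob A rel mono dia seq conv in \<open>simp_all\<close>)
  then show ?thesis using that[of ?F] by simp
qed

lemma rd_arrow_comp:
  assumes "rd_arrow R S F" "rd_arrow S T G"
  shows "rd_arrow R T (comp_arrow G F)"
proof -
  interpret F: rd_arrow R S F by fact
  interpret G: rd_arrow S T G by fact
  have nat: "RelMap G (ObMap F A) (ObMap F B) (Reindex S (ArMap F f) (ArMap F g) (RelMap F X Y \<alpha>)) =
      Reindex T (ArMap G (ArMap F f)) (ArMap G (ArMap F g))
        (RelMap G (ObMap F X) (ObMap F Y) (RelMap F X Y \<alpha>))"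
    if f: "f \<in> hom R A X" and g: "g \<in> hom R B Y" and a: "\<alpha> \<in> Fib R X Y" for f g A B X Y \<alpha>
    by (rule G.RelMap_natural[OF F.ArMap_hom[OF f] F.ArMap_hom[OF g]
          F.RelMap_closed[OF F.src.hom_Obj(2)[OF f] F.src.hom_Obj(2)[OF g] a]])
  show ?thesis
    by unfold_locales
      (auto simp: F.ArMap_Ide G.ArMap_Ide F.ArMap_Comp F.RelMap_natural
        F.RelMap_Dia G.RelMap_Dia F.RelMap_Seq G.RelMap_Seq F.RelMap_Conv G.RelMap_Conv
        F.ObMap_closed G.ObMap_closed F.RelMap_closed G.RelMap_closed
        intro: F.ArMap_hom G.ArMap_hom F.RelMap_mono G.RelMap_mono G.ArMap_Comp nat)
qed

lemma rd_arrow_id: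
  assumes "relational_doctrine R"
  shows "rd_arrow R R id_arrow"
proof -
  interpret relational_doctrine R by fact
  show ?thesis by unfold_locales simp_all
qed

text \<open>The square is required for all relations. On graphs it is naturality of \<theta>; on any
  \<alpha>, cancelling the invertible \<open>T Y\<close> gives the inequality of a 2-arrow, even as
  an equality.\<close>

lemma two_arrowI:
  assumes F: "rd_arrow R S F" and G: "rd_arrow R S G" and ext: "extensional S"
    and iso: "\<And>X. X \<in> Obj R \<Longrightarrow> graph_iso S (ObMap F X) (ObMap G X) (T X)"
    and nat: "\<And>X Y \<alpha>. X \<in> Obj R \<Longrightarrow> Y \<in> Obj R \<Longrightarrow> \<alpha> \<in> Fib R X Y \<Longrightarrow>
      Seq S (ObMap F X) (ObMap F Y) (ObMap G Y) (RelMap F X Y \<alpha>) (T Y) =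
      Seq S (ObMap F X) (ObMap G X) (ObMap G Y) (T X) (RelMap G X Y \<alpha>)"
    and \<theta>: "\<And>X. X \<in> Obj R \<Longrightarrow> \<theta> X \<in> hom S (ObMap F X) (ObMap G X)"
    and gr: "\<And>X. X \<in> Obj R \<Longrightarrow> graph S (\<theta> X) = T X"
  shows "two_arrow R S F G \<theta>"
proof -
  interpret F: rd_arrow R S F by (rule F)
  interpret G: rd_arrow R S G by (rule G)
  have "Comp S (\<theta> (Cod R f)) (ArMap F f) = Comp S (ArMap G f) (\<theta> (Dom R f))" if "f \<in> Arr R" for f
  proof -
    obtain X Y where XY: "Dom R f = X" "Cod R f = Y" by blast
    with that have f: "f \<in> hom R X Y" by (simp add: hom_def)
    note o = F.src.hom_Obj[OF f]
    show ?thesis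
      unfolding XY
      by (rule F.tgt.extensionalD[OF ext F.tgt.Comp_hom[OF F.ArMap_hom[OF f] \<theta>[OF o(2)]]
            F.tgt.Comp_hom[OF \<theta>[OF o(1)] G.ArMap_hom[OF f]]])
        (use nat[OF o] f in \<open>simp add: F.tgt.graph_Comp[OF F.ArMap_hom[OF f] \<theta>[OF o(2)]]
          F.tgt.graph_Comp[OF \<theta>[OF o(1)] G.ArMap_hom[OF f]] F.graph_ArMap[OF f] G.graph_ArMap[OF f]
          gr[OF o(1)] gr[OF o(2)]\<close>)
  qed
  moreover have "Le S (ObMap F X) (ObMap F Y) (RelMap F X Y \<alpha>)
      (Reindex S (\<theta> X) (\<theta> Y) (RelMap G X Y \<alpha>))"
    if X: "X \<in> Obj R" and Y: "Y \<in> Obj R" and a: "\<alpha> \<in> Fib R X Y" for X Y \<alpha>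
  proof -
    note t = F.tgt.graph_isoD[OF iso[OF X]] and t' = F.tgt.graph_isoD[OF iso[OF Y]]
    note r = F.RelMap_closed[OF X Y a] G.RelMap_closed[OF X Y a]
    have "Reindex S (\<theta> X) (\<theta> Y) (RelMap G X Y \<alpha>) =
      Seq S (ObMap F X) (ObMap G Y) (ObMap F Y)
        (Seq S (ObMap F X) (ObMap G X) (ObMap G Y) (T X) (RelMap G X Y \<alpha>))
        (Conv S (ObMap F Y) (ObMap G Y) (T Y))"
      using t t' r \<theta> X Y F.tgt.cograph_eq[OF \<theta>[OF Y]]
      by (simp add: F.tgt.Reindex_eq[OF \<theta>[OF X] \<theta>[OF Y] r(2)] gr)
    also have "\<dots> = Seq S (ObMap F X) (ObMap F Y) (ObMap F Y) (RelMap F X Y \<alpha>)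
        (Seq S (ObMap F Y) (ObMap G Y) (ObMap F Y) (T Y) (Conv S (ObMap F Y) (ObMap G Y) (T Y)))"
      unfolding nat[OF X Y a, symmetric] using t t' r by simp
    also have "\<dots> = RelMap F X Y \<alpha>" using t t' r by simp
    finally show ?thesis using t t' r by (simp add: F.tgt.le_refl)
  qed
  ultimately show ?thesis using \<theta> unfolding two_arrow_def by blast
qed

text \<open>Both families of arrows are read off from \<open>T\<close> and its converse, and
  extensionality turns inverse relations into inverse arrows.\<close>

lemma iso_arrowsI:
  assumes F: "rd_arrow R S F" and G: "rd_arrow R S G" and ext: "extensional S"
    and iso: "\<And>X. X \<in> Obj R \<Longrightarrow> graph_iso S (ObMap F X) (ObMap G X) (T X)"
    and nat: "\<And>X Y \<alpha>. X \<in> Obj R \<Longrightarrow> Y \<in> Obj R \<Longrightarrow> \<alpha> \<in> Fib R X Y \<Longrightarrow>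
      Seq S (ObMap F X) (ObMap F Y) (ObMap G Y) (RelMap F X Y \<alpha>) (T Y) =
      Seq S (ObMap F X) (ObMap G X) (ObMap G Y) (T X) (RelMap G X Y \<alpha>)"
  shows "iso_arrows R S F G"
proof -
  interpret F: rd_arrow R S F by (rule F)
  interpret G: rd_arrow R S G by (rule G)
  let ?T' = "\<lambda>X. Conv S (ObMap F X) (ObMap G X) (T X)"
  have "\<forall>X\<in>Obj R. \<exists>f. f \<in> hom S (ObMap F X) (ObMap G X) \<and> graph S f = T X"
    "\<forall>X\<in>Obj R. \<exists>f. f \<in> hom S (ObMap G X) (ObMap F X) \<and> graph S f = ?T' X"
    using iso by (auto simp: graph_iso_def is_graph_def)
  then obtain \<theta> \<theta>' where \<theta>: "\<And>X. X \<in> Obj R \<Longrightarrow> \<theta> X \<in> hom S (ObMap F X) (ObMap G X)"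
    "\<And>X. X \<in> Obj R \<Longrightarrow> graph S (\<theta> X) = T X"
    and \<theta>': "\<And>X. X \<in> Obj R \<Longrightarrow> \<theta>' X \<in> hom S (ObMap G X) (ObMap F X)"
    "\<And>X. X \<in> Obj R \<Longrightarrow> graph S (\<theta>' X) = ?T' X"
    by metis
  \<comment> \<open>The square for the converses is the square for \<open>T\<close> composed with
    the inverse of \<open>T X\<close> on the left and that of \<open>T Y\<close> on the
    right.\<close>
  have nat': "Seq S (ObMap G X) (ObMap G Y) (ObMap F Y) (RelMap G X Y \<alpha>) (?T' Y) =
      Seq S (ObMap G X) (ObMap F X) (ObMap F Y) (?T' X) (RelMap F X Y \<alpha>)"
    if X: "X \<in> Obj R" and Y: "Y \<in> Obj R" and a: "\<alpha> \<in> Fib R X Y" for X Y \<alpha>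
  proof -
    note t = F.tgt.graph_isoD[OF iso[OF X]] and t' = F.tgt.graph_isoD[OF iso[OF Y]]
    note r = F.RelMap_closed[OF X Y a] G.RelMap_closed[OF X Y a]
    have "Seq S (ObMap G X) (ObMap G Y) (ObMap F Y) (RelMap G X Y \<alpha>) (?T' Y) =
      Seq S (ObMap G X) (ObMap G X) (ObMap F Y)
        (Seq S (ObMap G X) (ObMap F X) (ObMap G X) (?T' X) (T X))
        (Seq S (ObMap G X) (ObMap G Y) (ObMap F Y) (RelMap G X Y \<alpha>) (?T' Y))"
      unfolding t(5) using t t' r by simp
    also have "\<dots> = Seq S (ObMap G X) (ObMap F X) (ObMap F Y) (?T' X)
        (Seq S (ObMap F X) (ObMap G Y) (ObMap F Y)
          (Seq S (ObMap F X) (ObMap G X) (ObMap G Y) (T X) (RelMap G X Y \<alpha>)) (?T' Y))"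
      using t(1-3) t'(1-3) r by simp
    also have "\<dots> = Seq S (ObMap G X) (ObMap F X) (ObMap F Y) (?T' X)
        (Seq S (ObMap F X) (ObMap F Y) (ObMap F Y) (RelMap F X Y \<alpha>)
          (Seq S (ObMap F Y) (ObMap G Y) (ObMap F Y) (T Y) (?T' Y)))"
      unfolding nat[OF X Y a, symmetric] using t(1-3) t'(1-3) r by simp
    also have "\<dots> = Seq S (ObMap G X) (ObMap F X) (ObMap F Y) (?T' X) (RelMap F X Y \<alpha>)"
      using t t' r by simp
    finally show ?thesis .
  qed
  have "two_arrow R S F G \<theta>"
    by (rule two_arrowI[OF F G ext iso nat \<theta>])
  moreover have "two_arrow R S G F \<theta>'"
    by (rule two_arrowI[OF G F ext F.tgt.graph_iso_sym[OF iso] nat' \<theta>'])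
  moreover have "Comp S (\<theta>' X) (\<theta> X) = Ide S (ObMap F X)" "Comp S (\<theta> X) (\<theta>' X) = Ide S (ObMap G X)"
    if X: "X \<in> Obj R" for X
  proof -
    note t = F.tgt.graph_isoD[OF iso[OF X]]
    show "Comp S (\<theta>' X) (\<theta> X) = Ide S (ObMap F X)"
      by (rule F.tgt.extensionalD[OF ext F.tgt.Comp_hom[OF \<theta>(1)[OF X] \<theta>'(1)[OF X]] F.tgt.Ide_hom])
        (use t in \<open>simp_all add: F.tgt.graph_Comp[OF \<theta>(1)[OF X] \<theta>'(1)[OF X]] \<theta>(2)[OF X] \<theta>'(2)[OF X]\<close>)
    show "Comp S (\<theta> X) (\<theta>' X) = Ide S (ObMap G X)"
      by (rule F.tgt.extensionalD[OF ext F.tgt.Comp_hom[OF \<theta>'(1)[OF X] \<theta>(1)[OF X]] F.tgt.Ide_hom])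
        (use t in \<open>simp_all add: F.tgt.graph_Comp[OF \<theta>'(1)[OF X] \<theta>(1)[OF X]] \<theta>(2)[OF X] \<theta>'(2)[OF X]\<close>)
  qed
  ultimately show ?thesis unfolding iso_arrows_def by blast
qed

text \<open>The hypotheses say that F behaves as an equivalence, without naming an inverse. Only the
  factorization of arrows has to be transported, the rest of \<open>quotient_arrowI\<close> being
  preserved by any 1-arrow.\<close>

lemma preserves_quotientsI:
  assumes F: "rd_arrow R S F" and quot: "has_quotients R" and ext: "extensional S"
    and surj: "\<And>X Y \<beta>. X \<in> Obj R \<Longrightarrow> Y \<in> Obj R \<Longrightarrow> \<beta> \<in> Fib S (ObMap F X) (ObMap F Y) \<Longrightarrow>
      \<exists>\<alpha>\<in>Fib R X Y. RelMap F X Y \<alpha> = \<beta>"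
    and reflect: "\<And>X Y \<alpha> \<beta>. X \<in> Obj R \<Longrightarrow> Y \<in> Obj R \<Longrightarrow> \<alpha> \<in> Fib R X Y \<Longrightarrow> \<beta> \<in> Fib R X Y \<Longrightarrow>
      Le S (ObMap F X) (ObMap F Y) (RelMap F X Y \<alpha>) (RelMap F X Y \<beta>) \<Longrightarrow> Le R X Y \<alpha> \<beta>"
    and full: "\<And>X Y \<alpha>. X \<in> Obj R \<Longrightarrow> Y \<in> Obj R \<Longrightarrow> \<alpha> \<in> Fib R X Y \<Longrightarrow>
      is_graph S (ObMap F X) (ObMap F Y) (RelMap F X Y \<alpha>) \<Longrightarrow> is_graph R X Y \<alpha>"
    and ess: "\<And>Z. Z \<in> Obj S \<Longrightarrow> \<exists>Y\<in>Obj R. \<exists>\<tau>. graph_iso S Z (ObMap F Y) \<tau>"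
  shows "preserves_quotients R S F"
  unfolding preserves_quotients_def
proof (intro allI impI)
  interpret F: rd_arrow R S F by (rule F)
  fix X \<rho> q assume q: "quotient_arrow R X \<rho> q"
  let ?W = "Cod R q"
  note hq = quotient_arrow_hom[OF q] and ed = F.src.quotient_arrow_effective_descent[OF quot q]
  note o = F.src.hom_Obj[OF hq]
  have \<rho>: "equivalence_rel R X \<rho>" "\<rho> \<in> Fib R X X"
    using q by (simp_all add: quotient_arrow_def equivalence_rel_def)
  show "quotient_arrow S (ObMap F X) (RelMap F X X \<rho>) (ArMap F q)"
  proof (rule F.tgt.quotient_arrowI[OF ext F.equivalence_rel_RelMap[OF o(1) \<rho>(1)]
        F.ArMap_hom[OF hq] _ F.descent_ArMap[OF hq ed(2)]])
    show "Le S (ObMap F X) (ObMap F X) (RelMap F X X \<rho>) (kernel S (ArMap F q))"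
      using F.RelMap_closed[OF o(1,1) \<rho>(2)] F.ObMap_closed[OF o(1)]
      by (simp add: F.kernel_ArMap[OF hq] ed F.tgt.le_refl)
    fix f Z assume f: "f \<in> hom S (ObMap F X) Z"
      and le: "Le S (ObMap F X) (ObMap F X) (RelMap F X X \<rho>) (kernel S f)"
    let ?FX = "ObMap F X"
    \<comment> \<open>The target Z is replaced by an isomorphic image object. The composite of f
      with that isomorphism comes from some \<open>g : X \<rightarrow> Y\<close>, is factored
      through q in R, and its factor is then brought back to Z.\<close>
    obtain Y \<tau> where Y: "Y \<in> Obj R" and \<tau>: "graph_iso S Z (ObMap F Y) \<tau>"
      using ess F.tgt.hom_Obj[OF f] by blast
    note t = F.tgt.graph_isoD[OF \<tau>]
    obtain i j where i: "i \<in> hom S Z (ObMap F Y)" "graph S i = \<tau>"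
      and j: "j \<in> hom S (ObMap F Y) Z" "graph S j = Conv S Z (ObMap F Y) \<tau>"
      using \<tau> by (auto simp: graph_iso_def is_graph_def)
    have fi: "Comp S i f \<in> hom S ?FX (ObMap F Y)" using F.tgt.Comp_hom[OF f i(1)] .
    obtain \<alpha> where \<alpha>: "\<alpha> \<in> Fib R X Y" "RelMap F X Y \<alpha> = graph S (Comp S i f)"
      using surj[OF o(1) Y F.tgt.graph_closed[OF fi]] by blast
    have "is_graph S ?FX (ObMap F Y) (graph S (Comp S i f))" using fi by (auto simp: is_graph_def)
    then have "is_graph R X Y \<alpha>" using full[OF o(1) Y \<alpha>(1)] \<alpha>(2) by simp
    then obtain g where g: "g \<in> hom R X Y" "graph R g = \<alpha>" by (auto simp: is_graph_def)
    have gfi: "ArMap F g = Comp S i f"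
      by (rule F.tgt.extensionalD[OF ext F.ArMap_hom[OF g(1)] fi]) (simp add: F.graph_ArMap[OF g(1)] g \<alpha>)
    have "F.tgt.leq ?FX ?FX (RelMap F X X \<rho>) (kernel S f)"
      using le F.RelMap_closed[OF o(1,1) \<rho>(2)] F.ObMap_closed[OF o(1)] f by (simp add: F.tgt.leq_def)
    from F.tgt.leq_trans[OF this F.tgt.kernel_Comp_leq[OF f i(1)]]
    have "Le S ?FX ?FX (RelMap F X X \<rho>) (RelMap F X X (kernel R g))"
      using F.kernel_ArMap[OF g(1)] gfi F.tgt.leqD by simp
    then have "Le R X X \<rho> (kernel R g)"
      using reflect[OF o(1,1) \<rho>(2) F.src.kernel_closed[OF g(1)]] by simp
    then obtain h where h: "h \<in> hom R ?W Y" "g = Comp R h q"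
      using quotient_arrow_factor[OF q g(1)] by metis
    note hF = F.ArMap_hom[OF h(1)] and qF = F.ArMap_hom[OF hq]
    have hj: "Comp S j (ArMap F h) \<in> hom S (ObMap F ?W) Z" using F.tgt.Comp_hom[OF hF j(1)] .
    have "graph S f = Seq S ?FX Z Z (graph S f) (Seq S Z (ObMap F Y) Z (graph S i) (graph S j))"
      unfolding i(2) j(2) t(4) using f t(1) F.tgt.hom_Obj[OF f] by simp
    also have "\<dots> = Seq S ?FX (ObMap F Y) Z (graph S (Comp S i f)) (graph S j)"
      using f i(1) j(1) t(1,2) F.tgt.hom_Obj[OF f] by (simp add: F.tgt.graph_Comp[OF f i(1)])
    also have "graph S (Comp S i f) = Seq S ?FX (ObMap F ?W) (ObMap F Y)
        (graph S (ArMap F q)) (graph S (ArMap F h))"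
      using gfi F.ArMap_Comp[OF hq h(1)] h(2) F.tgt.graph_Comp[OF qF hF] by metis
    also have "Seq S ?FX (ObMap F Y) Z \<dots> (graph S j) = Seq S ?FX (ObMap F ?W) Z
        (graph S (ArMap F q)) (graph S (Comp S j (ArMap F h)))"
      using qF hF j(1) F.tgt.hom_Obj[OF qF] F.tgt.hom_Obj[OF f] t(1,2)
      by (simp add: F.tgt.graph_Comp[OF hF j(1)])
    finally show "\<exists>h\<in>hom S (ObMap F ?W) Z.
        graph S f = Seq S ?FX (ObMap F ?W) Z (graph S (ArMap F q)) (graph S h)"
      using hj by blast
  qed
qed

text \<open>Over diagonals absorption is vacuous, so the fibres coincide with those of R and every
  arrow is compatible.\<close>

lemma (in relational_doctrine) rd_arrow_eq_unit: "rd_arrow R (eq_completion R) (eq_unit R)"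
proof -
  interpret Q: relational_doctrine "eq_completion R" by (rule relational_doctrine_eq_completion)
  have fib: "Fib (eq_completion R) (X, Dia R X) (Y, Dia R Y) = Fib R X Y"
    if "X \<in> Obj R" "Y \<in> Obj R" for X Y
    using that by (auto simp: Fib_eq_completion dia_eq_obj)
  have ar: "ArMap (eq_unit R) f \<in> hom (eq_completion R) (ObMap (eq_unit R) X) (ObMap (eq_unit R) Y)"
    "graph (eq_completion R) (ArMap (eq_unit R) f) = RelMap (eq_unit R) X Y (graph R f)"
    if f: "f \<in> hom R X Y" for f X Y
  proof -
    note o = hom_Obj[OF f]
    have "Dom R f = X" "Cod R f = Y" using f by (simp_all add: hom_def)
    then show "ArMap (eq_unit R) f \<in> hom (eq_completion R) (ObMap (eq_unit R) X) (ObMap (eq_unit R) Y)"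
      "graph (eq_completion R) (ArMap (eq_unit R) f) = RelMap (eq_unit R) X Y (graph R f)"
      using eq_arr_graph[OF dia_eq_obj[OF o(1)] dia_eq_obj[OF o(2)], of f] f o by (simp_all add: eq_unit_def fib)
  qed
  show ?thesis
    by (rule rd_arrowI[OF _ relational_doctrine_eq_completion extensional_eq_completion _ ar])
      (auto simp: fib dia_eq_obj intro: relational_doctrine_axioms)
qed

section \<open>Projective covers\<close>

lemma restriction_simps [simp]:
  "Obj (restriction R \<G>) = \<G>" "Dom (restriction R \<G>) = Dom R" "Cod (restriction R \<G>) = Cod R"
  "Ide (restriction R \<G>) = Ide R" "Comp (restriction R \<G>) = Comp R" "Fib (restriction R \<G>) = Fib R"
  "Le (restriction R \<G>) = Le R" "Reindex (restriction R \<G>) = Reindex R"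
  "Seq (restriction R \<G>) = Seq R" "Dia (restriction R \<G>) = Dia R" "Conv (restriction R \<G>) = Conv R"
  "graph (restriction R \<G>) = graph R" "equivalence_rel (restriction R \<G>) = equivalence_rel R"
  by (simp_all add: restriction_def graph_def equivalence_rel_def fun_eq_iff)

lemma Arr_restriction [simp]:
  "f \<in> Arr (restriction R \<G>) \<longleftrightarrow> f \<in> Arr R \<and> Dom R f \<in> \<G> \<and> Cod R f \<in> \<G>"
  by (simp add: restriction_def)

lemma hom_restriction: "hom (restriction R \<G>) X Y = (if X \<in> \<G> \<and> Y \<in> \<G> then hom R X Y else {})"
  by (auto simp: hom_def)

section \<open>Restriction to a full subcategory\<close>

context relational_doctrine
begin

context
  fixes \<G> :: "'o set"
  assumes sub: "\<G> \<subseteq> Obj R"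
begin

lemma relational_doctrine_restriction: "relational_doctrine (restriction R \<G>)"
proof -
  have o: "X \<in> Obj R" if "X \<in> \<G>" for X using that sub by blast
  show ?thesis
  proof unfold_locales
    show "\<alpha> = \<beta>" if "X \<in> Obj (restriction R \<G>)" "Y \<in> Obj (restriction R \<G>)"
      "\<alpha> \<in> Fib (restriction R \<G>) X Y" "\<beta> \<in> Fib (restriction R \<G>) X Y"
      "Le (restriction R \<G>) X Y \<alpha> \<beta>" "Le (restriction R \<G>) X Y \<beta> \<alpha>" for X Y \<alpha> \<beta>
      using le_antisym[of X Y \<alpha> \<beta>] that o by simp
  qed (auto simp: hom_restriction o Comp_Ide_left Comp_Ide_right Reindex_Ide Reindex_Comp Comp_assoc
      split: if_splits intro: Ide_hom Comp_hom Reindex_closed Reindex_mono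
        Seq_Reindex Dia_Reindex Conv_Reindex le_refl le_trans seq_mono conv_mono)
qed

lemma rd_arrow_inclusion: "rd_arrow (restriction R \<G>) R inclusion"
proof -
  interpret S: relational_doctrine "restriction R \<G>" by (rule relational_doctrine_restriction)
  show ?thesis
    by unfold_locales (use sub in \<open>auto simp: hom_restriction split: if_splits\<close>)
qed

end

end

section \<open>Comparison with the completion for a given projective cover\<close>

locale projectively_covered = relational_doctrine R
  for R :: "('o, 'a, 'r) reldoc" +
  fixes \<G> :: "'o set"
  assumes ext: "extensional R" and quot: "has_quotients R" and cover: "projective_cover R \<G>"
begin

abbreviation S where "S \<equiv> restriction R \<G>"

abbreviation E where "E \<equiv> eq_completion (restriction R \<G>)"

lemma G_Obj: "X \<in> \<G> \<Longrightarrow> X \<in> Obj R"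
  using cover by (auto simp: projective_cover_def)

lemma relational_doctrine_S: "relational_doctrine S"
  by (rule relational_doctrine_restriction) (use G_Obj in blast)

lemma relational_doctrine_E: "relational_doctrine E"
  by (rule relational_doctrine.relational_doctrine_eq_completion[OF relational_doctrine_S])

lemma extensional_E: "extensional E"
  by (rule relational_doctrine.extensional_eq_completion[OF relational_doctrine_S])

lemma E_simps [simp]:
  "Le E A B = Le R (fst A) (fst B)" "Seq E A B D = Seq R (fst A) (fst B) (fst D)"
  "Dia E = snd" "Conv E A B = Conv R (fst A) (fst B)"
  by (simp_all add: relational_doctrine.eq_completion_simps[OF relational_doctrine_S])

lemma Obj_E: "A \<in> Obj E \<longleftrightarrow> fst A \<in> \<G> \<and> equivalence_rel R (fst A) (snd A)"
  by (cases A) (simp add: relational_doctrine.eq_completion_simps[OF relational_doctrine_S] eq_obj_def)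

lemma Fib_E: "A \<in> Obj E \<Longrightarrow> B \<in> Obj E \<Longrightarrow> \<alpha> \<in> Fib E A B \<longleftrightarrow> \<alpha> \<in> Fib R (fst A) (fst B) \<and>
    Seq R (fst A) (fst A) (fst B) (snd A) \<alpha> = \<alpha> \<and> Seq R (fst A) (fst B) (fst B) \<alpha> (snd B) = \<alpha>"
  using relational_doctrine.Fib_eq_completion[OF relational_doctrine_S, of A B \<alpha>]
  by (simp add: relational_doctrine.eq_completion_simps[OF relational_doctrine_S])

text \<open>Any f with the right composite represents an arrow, compatibility being contained in the
  membership of \<alpha> in the fibre.\<close>

lemma is_graph_E:
  assumes A: "A \<in> Obj E" and B: "B \<in> Obj E" and \<alpha>: "\<alpha> \<in> Fib E A B"
  shows "is_graph E A B \<alpha> \<longleftrightarrow>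
    (\<exists>f\<in>hom R (fst A) (fst B). Seq R (fst A) (fst B) (fst B) (graph R f) (snd B) = \<alpha>)"
proof -
  have hom: "hom S (fst A) (fst B) = hom R (fst A) (fst B)"
    using A B by (simp add: hom_restriction Obj_E)
  interpret S: relational_doctrine S by (rule relational_doctrine_S)
  show ?thesis
  proof
    assume "is_graph E A B \<alpha>"
    then obtain \<phi> where \<phi>: "\<phi> \<in> hom E A B" "graph E \<phi> = \<alpha>" by (auto simp: is_graph_def)
    obtain f where "f \<in> hom S (fst A) (fst B)"
      "graph E \<phi> = Seq S (fst A) (fst B) (fst B) (graph S f) (snd B)"
      using S.graph_eq_completion_ex[OF \<phi>(1)] .
    then show "\<exists>f\<in>hom R (fst A) (fst B). Seq R (fst A) (fst B) (fst B) (graph R f) (snd B) = \<alpha>"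
      using \<phi>(2) hom by auto
  next
    assume "\<exists>f\<in>hom R (fst A) (fst B). Seq R (fst A) (fst B) (fst B) (graph R f) (snd B) = \<alpha>"
    then obtain f where f: "f \<in> hom R (fst A) (fst B)"
      "Seq R (fst A) (fst B) (fst B) (graph R f) (snd B) = \<alpha>" by blast
    have AB: "A \<in> eq_obj S" "B \<in> eq_obj S" using A B by simp_all
    show "is_graph E A B \<alpha>"
      using S.eq_arr_graph[OF AB, of f] f \<alpha> hom
      unfolding is_graph_def by (intro bexI[of _ "eq_arr S A B f"]) simp_all
  qed
qed

section \<open>Transport of relations along covering quotient arrows\<close>

definition cov :: "'a \<Rightarrow> bool"
  where "cov p \<longleftrightarrow> Dom R p \<in> \<G> \<and> is_quotient_arrow R p"

definition ker_obj :: "'a \<Rightarrow> 'o \<times> 'r"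
  where "ker_obj p = (Dom R p, kernel R p)"

text \<open>On covers this is reindexing along p and p', written as a composite so that the laws of
  the fibres apply to it.\<close>

definition pull :: "'a \<Rightarrow> 'a \<Rightarrow> 'r \<Rightarrow> 'r"
  where "pull p p' \<alpha> = Seq R (Dom R p) (Cod R p) (Dom R p') (graph R p)
    (Seq R (Cod R p) (Cod R p') (Dom R p') \<alpha> (cograph R p'))"

text \<open>Inverse to \<open>pull\<close> on fibres of the completion: descent cancels the inner
  pairs in one order, and in the other order kernels appear on both sides, which the relation
  absorbs.\<close>

definition push :: "'a \<Rightarrow> 'a \<Rightarrow> 'r \<Rightarrow> 'r"
  where "push p p' \<beta> = Seq R (Cod R p) (Dom R p) (Cod R p') (cograph R p)
    (Seq R (Dom R p) (Dom R p') (Cod R p') \<beta> (graph R p'))"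

lemma fst_snd_ker_obj [simp]: "fst (ker_obj p) = Dom R p" "snd (ker_obj p) = kernel R p"
  by (simp_all add: ker_obj_def)

lemma cov_quotient: "cov p \<Longrightarrow> quotient_arrow R (Dom R p) (kernel R p) p"
  using quotient_arrow_effective_descent(1)[OF quot] unfolding cov_def is_quotient_arrow_def by metis

lemma cov_hom [simp]: "cov p \<Longrightarrow> p \<in> hom R (Dom R p) (Cod R p)"
  by (rule quotient_arrow_hom[OF cov_quotient])

lemma cov_Obj [simp]: "cov p \<Longrightarrow> Dom R p \<in> \<G>" "cov p \<Longrightarrow> Dom R p \<in> Obj R" "cov p \<Longrightarrow> Cod R p \<in> Obj R"
  using hom_Obj[OF cov_hom, of p] by (simp_all add: cov_def)

lemma cov_closed [simp]: "cov p \<Longrightarrow> graph R p \<in> Fib R (Dom R p) (Cod R p)"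
  "cov p \<Longrightarrow> cograph R p \<in> Fib R (Cod R p) (Dom R p)"
  "cov p \<Longrightarrow> kernel R p \<in> Fib R (Dom R p) (Dom R p)"
  by (rule graph_closed cograph_closed kernel_closed, rule cov_hom, assumption)+

lemma cov_conv [simp]: "cov p \<Longrightarrow> Conv R (Dom R p) (Cod R p) (graph R p) = cograph R p"
  "cov p \<Longrightarrow> Conv R (Cod R p) (Dom R p) (cograph R p) = graph R p"
  by (simp_all only: conv_graph[OF cov_hom] conv_cograph[OF cov_hom])

lemma cov_kernel: "cov p \<Longrightarrow> Seq R (Dom R p) (Cod R p) (Dom R p) (graph R p) (cograph R p) = kernel R p"
  by (simp add: kernel_eq[OF cov_hom])

lemma cov_descent [simp]:
  "cov p \<Longrightarrow> Seq R (Cod R p) (Dom R p) (Cod R p) (cograph R p) (graph R p) = Dia R (Cod R p)"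
  using quotient_arrow_effective_descent(2)[OF quot cov_quotient, of p]
  by (simp only: descent_iff[OF cov_hom])

lemma cov_cancel [simp]:
  assumes "cov p" "Z \<in> Obj R" "\<beta> \<in> Fib R (Cod R p) Z"
  shows "Seq R (Cod R p) (Dom R p) Z (cograph R p) (Seq R (Dom R p) (Cod R p) Z (graph R p) \<beta>) = \<beta>"
  using assms seq_assoc[of "Cod R p" "Dom R p" "Cod R p" Z "cograph R p" "graph R p" \<beta>] by simp

lemma ker_obj_closed [simp]: "cov p \<Longrightarrow> ker_obj p \<in> Obj E"
  using equivalence_rel_kernel[OF cov_hom, of p] by (simp add: Obj_E)

lemma pull_Fib [simp]:
  assumes "cov p" "cov p'" "\<alpha> \<in> Fib R (Cod R p) (Cod R p')"
  shows "pull p p' \<alpha> \<in> Fib R (Dom R p) (Dom R p')"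
  using assms by (simp add: pull_def)

lemma push_Fib [simp]:
  assumes "cov p" "cov p'" "\<beta> \<in> Fib R (Dom R p) (Dom R p')"
  shows "push p p' \<beta> \<in> Fib R (Cod R p) (Cod R p')"
  using assms by (simp add: push_def)

lemma pull_closed [simp]:
  assumes "cov p" "cov p'" "\<alpha> \<in> Fib R (Cod R p) (Cod R p')"
  shows "pull p p' \<alpha> \<in> Fib E (ker_obj p) (ker_obj p')"
  using assms by (simp add: Fib_E) (simp add: pull_def flip: cov_kernel)

lemma push_closed [simp]:
  assumes "cov p" "cov p'" "\<beta> \<in> Fib E (ker_obj p) (ker_obj p')"
  shows "push p p' \<beta> \<in> Fib R (Cod R p) (Cod R p')"
  using assms by (simp add: Fib_E)

lemma push_pull [simp]:
  assumes "cov p" "cov p'" "\<alpha> \<in> Fib R (Cod R p) (Cod R p')"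
  shows "push p p' (pull p p' \<alpha>) = \<alpha>"
  using assms by (simp add: pull_def push_def)

lemma pull_push [simp]:
  assumes p: "cov p" "cov p'" and \<beta>: "\<beta> \<in> Fib E (ker_obj p) (ker_obj p')"
  shows "pull p p' (push p p' \<beta>) = \<beta>"
proof -
  have b: "\<beta> \<in> Fib R (Dom R p) (Dom R p')" "Seq R (Dom R p) (Dom R p) (Dom R p') (kernel R p) \<beta> = \<beta>"
    "Seq R (Dom R p) (Dom R p') (Dom R p') \<beta> (kernel R p') = \<beta>"
    using p \<beta> by (simp_all add: Fib_E)
  have "pull p p' (push p p' \<beta>) = Seq R (Dom R p) (Dom R p) (Dom R p') (kernel R p)
      (Seq R (Dom R p) (Dom R p') (Dom R p') \<beta> (kernel R p'))"
    using p b(1) by (simp add: pull_def push_def flip: cov_kernel)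
  then show ?thesis by (simp only: b)
qed

lemma pull_mono:
  assumes "cov p" "cov p'" "\<alpha> \<in> Fib R (Cod R p) (Cod R p')" "\<beta> \<in> Fib R (Cod R p) (Cod R p')"
    "Le R (Cod R p) (Cod R p') \<alpha> \<beta>"
  shows "Le R (Dom R p) (Dom R p') (pull p p' \<alpha>) (pull p p' \<beta>)"
  using assms by (simp add: pull_def seq_mono le_refl)

lemma push_mono:
  assumes "cov p" "cov p'" "\<alpha> \<in> Fib R (Dom R p) (Dom R p')" "\<beta> \<in> Fib R (Dom R p) (Dom R p')"
    "Le R (Dom R p) (Dom R p') \<alpha> \<beta>"
  shows "Le R (Cod R p) (Cod R p') (push p p' \<alpha>) (push p p' \<beta>)"
  using assms by (simp add: push_def seq_mono le_refl)

lemma pull_Dia: "cov p \<Longrightarrow> pull p p (Dia R (Cod R p)) = kernel R p"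
  by (simp add: pull_def cov_kernel)

lemma pull_Conv:
  assumes "cov p" "cov p'" "\<alpha> \<in> Fib R (Cod R p) (Cod R p')"
  shows "pull p' p (Conv R (Cod R p) (Cod R p') \<alpha>) = Conv R (Dom R p) (Dom R p') (pull p p' \<alpha>)"
  using assms by (simp add: pull_def)

lemma pull_Seq:
  assumes "cov p" "cov p'" "cov p''" "\<alpha> \<in> Fib R (Cod R p) (Cod R p')" "\<beta> \<in> Fib R (Cod R p') (Cod R p'')"
  shows "pull p p'' (Seq R (Cod R p) (Cod R p') (Cod R p'') \<alpha> \<beta>) =
    Seq R (Dom R p) (Dom R p') (Dom R p'') (pull p p' \<alpha>) (pull p' p'' \<beta>)"
  using assms by (simp add: pull_def)

lemma push_Dia: "cov p \<Longrightarrow> push p p (kernel R p) = Dia R (Cod R p)"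
  by (simp flip: pull_Dia)

lemma push_Conv:
  assumes "cov p" "cov p'" "\<beta> \<in> Fib R (Dom R p) (Dom R p')"
  shows "push p' p (Conv R (Dom R p) (Dom R p') \<beta>) = Conv R (Cod R p) (Cod R p') (push p p' \<beta>)"
  using assms by (simp add: push_def)

text \<open>Obtained by inverting \<open>pull_Seq\<close>; a direct computation would have to absorb
  the kernel of p' that appears in the middle.\<close>

lemma push_Seq:
  assumes p: "cov p" "cov p'" "cov p''"
    and \<alpha>: "\<alpha> \<in> Fib E (ker_obj p) (ker_obj p')" and \<beta>: "\<beta> \<in> Fib E (ker_obj p') (ker_obj p'')"
  shows "push p p'' (Seq R (Dom R p) (Dom R p') (Dom R p'') \<alpha> \<beta>) =
    Seq R (Cod R p) (Cod R p') (Cod R p'') (push p p' \<alpha>) (push p' p'' \<beta>)"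
proof -
  let ?\<alpha> = "push p p' \<alpha>" and ?\<beta> = "push p' p'' \<beta>"
  have "push p p'' (Seq R (Dom R p) (Dom R p') (Dom R p'') (pull p p' ?\<alpha>) (pull p' p'' ?\<beta>)) =
      Seq R (Cod R p) (Cod R p') (Cod R p'') ?\<alpha> ?\<beta>"
    using p \<alpha> \<beta> by (simp add: pull_Seq[symmetric] del: pull_push)
  then show ?thesis using p \<alpha> \<beta> by simp
qed

text \<open>
  For the right-to-left direction, a representative \<open>f\<close> of an arrow of the completion with graph
  \<open>pull p p' \<alpha>\<close> makes \<open>p' \<circ> f\<close> compatible with the kernel of \<open>p\<close>; conversely, projectivity of
  the domain of \<open>p\<close> lifts \<open>h \<circ> p\<close> through \<open>p'\<close>.
\<close>

lemma is_graph_pull: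
  assumes p: "cov p" and p': "cov p'" and \<alpha>: "\<alpha> \<in> Fib R (Cod R p) (Cod R p')"
  shows "is_graph E (ker_obj p) (ker_obj p') (pull p p' \<alpha>) \<longleftrightarrow> is_graph R (Cod R p) (Cod R p') \<alpha>"
proof -
  let ?P = "Dom R p" and ?P' = "Dom R p'" and ?X = "Cod R p" and ?X' = "Cod R p'"
  note E = is_graph_E[OF ker_obj_closed[OF p] ker_obj_closed[OF p'] pull_closed[OF p p' \<alpha>], simplified]
  \<comment> \<open>An arrow f represents the pulled relation exactly when
    \<open>p' \<circ> f\<close> is \<alpha> after p. One passes between the two forms by composing
    with \<open>\<Gamma>\<^sub>p\<^sub>'\<close> or its converse.\<close>
  have key: "Seq R ?P ?P' ?P' (graph R f) (kernel R p') = pull p p' \<alpha> \<longleftrightarrow>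
      graph R (Comp R p' f) = Seq R ?P ?X ?X' (graph R p) \<alpha>" if f: "f \<in> hom R ?P ?P'" for f
  proof
    assume eq: "Seq R ?P ?P' ?P' (graph R f) (kernel R p') = pull p p' \<alpha>"
    have "graph R (Comp R p' f) = Seq R ?P ?P' ?X' (Seq R ?P ?P' ?P' (graph R f) (kernel R p')) (graph R p')"
      using f p p' graph_cograph_graph[OF cov_hom[OF p']] by (simp add: graph_Comp[OF f cov_hom[OF p']])
    also have "\<dots> = Seq R ?P ?X ?X' (graph R p) \<alpha>"
      unfolding eq using p p' \<alpha> by (simp add: pull_def)
    finally show "graph R (Comp R p' f) = Seq R ?P ?X ?X' (graph R p) \<alpha>" .
  next
    assume "graph R (Comp R p' f) = Seq R ?P ?X ?X' (graph R p) \<alpha>"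
    then have eq: "Seq R ?P ?P' ?X' (graph R f) (graph R p') = Seq R ?P ?X ?X' (graph R p) \<alpha>"
      by (simp add: graph_Comp[OF f cov_hom[OF p']])
    have "Seq R ?P ?P' ?P' (graph R f) (kernel R p') =
        Seq R ?P ?X' ?P' (Seq R ?P ?P' ?X' (graph R f) (graph R p')) (cograph R p')"
      using f p p' by (simp flip: cov_kernel)
    also have "\<dots> = pull p p' \<alpha>" unfolding eq using p p' \<alpha> by (simp add: pull_def)
    finally show "Seq R ?P ?P' ?P' (graph R f) (kernel R p') = pull p p' \<alpha>" .
  qed
  show ?thesis
  proof
    assume "is_graph E (ker_obj p) (ker_obj p') (pull p p' \<alpha>)"
    then obtain f where f: "f \<in> hom R ?P ?P'" "Seq R ?P ?P' ?P' (graph R f) (kernel R p') = pull p p' \<alpha>"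
      using E by auto
    then have gr: "graph R (Comp R p' f) = Seq R ?P ?X ?X' (graph R p) \<alpha>" using key by simp
    have c: "Comp R p' f \<in> hom R ?P ?X'" using Comp_hom[OF f(1) cov_hom[OF p']] .
    \<comment> \<open>The kernel of \<open>p' \<circ> f\<close> is reflexive, so it may follow the
      kernel of p; the latter is then absorbed, since the graph of \<open>p' \<circ> f\<close>
      begins with \<open>\<Gamma>\<^sub>p\<close>.\<close>
    have "leq ?P ?P (Seq R ?P ?P ?P (kernel R p) (Dia R ?P))
        (Seq R ?P ?P ?P (kernel R p) (kernel R (Comp R p' f)))"
      using p by (intro leq_seq_right kernel_total[OF c]) auto
    also have "Seq R ?P ?P ?P (kernel R p) (kernel R (Comp R p' f)) =
        Seq R ?P ?X' ?P (Seq R ?P ?P ?X' (kernel R p) (graph R (Comp R p' f))) (cograph R (Comp R p' f))"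
      using p p' c by (simp add: kernel_eq[OF c])
    also have "Seq R ?P ?P ?X' (kernel R p) (graph R (Comp R p' f)) = graph R (Comp R p' f)"
      unfolding gr using p p' \<alpha> by (simp flip: cov_kernel)
    finally have "Le R ?P ?P (kernel R p) (kernel R (Comp R p' f))"
      using p by (simp add: kernel_eq[OF c] leq_def)
    then obtain h where h: "h \<in> hom R ?X ?X'" "Comp R p' f = Comp R h p"
      using quotient_arrow_factor[OF cov_quotient[OF p] c] by metis
    have "Seq R ?P ?X ?X' (graph R p) (graph R h) = Seq R ?P ?X ?X' (graph R p) \<alpha>"
      using gr graph_Comp[OF cov_hom[OF p] h(1)] h(2) by simp
    \<comment> \<open>Descent of p cancels \<open>\<Gamma>\<^sub>p\<close> on the left.\<close>
    from arg_cong[OF this, of "Seq R ?X ?P ?X' (cograph R p)"]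
    have "graph R h = \<alpha>" using p p' h(1) \<alpha> by simp
    then show "is_graph R ?X ?X' \<alpha>" using h by (auto simp: is_graph_def)
  next
    assume "is_graph R ?X ?X' \<alpha>"
    then obtain h where h: "h \<in> hom R ?X ?X'" "graph R h = \<alpha>" by (auto simp: is_graph_def)
    have c: "Comp R h p \<in> hom R ?P ?X'" using Comp_hom[OF cov_hom[OF p] h(1)] .
    have "projective R ?P" using cover p by (simp add: projective_cover_def)
    moreover have "Comp R h p \<in> Arr R" "Dom R (Comp R h p) = ?P" "Cod R p' = Cod R (Comp R h p)"
      using c by (simp_all add: hom_def)
    moreover have "is_quotient_arrow R p'" using p' by (simp add: cov_def)
    ultimately obtain f where f: "f \<in> hom R ?P ?P'" "Comp R h p = Comp R p' f"
      unfolding projective_def by blast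
    have "graph R (Comp R p' f) = Seq R ?P ?X ?X' (graph R p) \<alpha>"
      using f(2) graph_Comp[OF cov_hom[OF p] h(1)] h(2) by simp
    then show "is_graph E (ker_obj p) (ker_obj p') (pull p p' \<alpha>)"
      using E f(1) key by blast
  qed
qed

lemma kernel_Fib:
  assumes "cov q" "cov p" "ker_obj q = ker_obj p"
  shows "kernel R p \<in> Fib E (ker_obj q) (ker_obj p)"
  using fibres.dia_closed[OF relational_doctrine.fibres_eq_completion[OF relational_doctrine_S]
      ker_obj_closed[OF assms(2)]] assms(3)
  by simp

text \<open>In the completion the kernel is the diagonal of the common object
  \<open>ker_obj p\<close>, hence the graph of its identity. Pushing it along q and p gives the
  comparison between two quotients of the same relation.\<close>

lemma graph_iso_push:
  assumes q: "cov q" and p: "cov p" and eq: "ker_obj q = ker_obj p"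
  shows "graph_iso R (Cod R q) (Cod R p) (push q p (kernel R p))"
proof -
  interpret E: relational_doctrine E by (rule relational_doctrine_E)
  have gr: "is_graph R (Cod R q') (Cod R p') (push q' p' (kernel R p'))"
    if "cov q'" "cov p'" "ker_obj q' = ker_obj p'" for q' p'
    using is_graph_pull[OF that(1,2), of "push q' p' (kernel R p')"] kernel_Fib[OF that] that
      E.is_graph_Dia[of "ker_obj p'"] by simp
  have D: "Dom R q = Dom R p" "kernel R q = kernel R p" using eq by (simp_all add: ker_obj_def)
  have k: "Seq R (Dom R p) (Dom R p) (Dom R p) (kernel R p) (kernel R p) = kernel R p"
    "Conv R (Dom R p) (Dom R p) (kernel R p) = kernel R p"
    using equivalence_rel_kernel[OF cov_hom[OF p]] equivalence_rel_iff[of "Dom R p" "kernel R p"] p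
    by simp_all
  have inv: "Seq R (Cod R q) (Cod R p) (Cod R q) (push q p (kernel R p)) (push p q (kernel R q)) =
      Dia R (Cod R q)"
    "Seq R (Cod R p) (Cod R q) (Cod R p) (push p q (kernel R q)) (push q p (kernel R p)) =
      Dia R (Cod R p)"
    using push_Seq[OF q p q kernel_Fib[OF q p eq] kernel_Fib[OF p q eq[symmetric]]]
      push_Seq[OF p q p kernel_Fib[OF p q eq[symmetric]] kernel_Fib[OF q p eq]]
      push_Dia[OF p] push_Dia[OF q] D k by simp_all
  have "Conv R (Cod R q) (Cod R p) (push q p (kernel R p)) = push p q (kernel R q)"
    using push_Conv[OF q p, of "kernel R p"] D k p by simp
  then show ?thesis
    using gr[OF q p eq] gr[OF p q eq[symmetric]] inv by (simp add: graph_iso_def)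
qed

text \<open>Both sides are \<open>push q p' (pull p p' \<alpha>)\<close>, because the pulled
  relation absorbs the kernels.\<close>

lemma push_pull_natural:
  assumes q: "cov q" "cov q'" and p: "cov p" "cov p'"
    and eq: "ker_obj q = ker_obj p" "ker_obj q' = ker_obj p'"
    and \<alpha>: "\<alpha> \<in> Fib R (Cod R p) (Cod R p')"
  shows "Seq R (Cod R q) (Cod R q') (Cod R p') (push q q' (pull p p' \<alpha>)) (push q' p' (kernel R p')) =
    Seq R (Cod R q) (Cod R p) (Cod R p') (push q p (kernel R p)) \<alpha>"
proof -
  have D: "Dom R q = Dom R p" "Dom R q' = Dom R p'"
    using eq by (simp_all add: ker_obj_def)
  have pl: "pull p p' \<alpha> \<in> Fib E (ker_obj p) (ker_obj p')" using p \<alpha> by simp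
  then have k: "Seq R (Dom R p) (Dom R p) (Dom R p') (kernel R p) (pull p p' \<alpha>) = pull p p' \<alpha>"
    "Seq R (Dom R p) (Dom R p') (Dom R p') (pull p p' \<alpha>) (kernel R p') = pull p p' \<alpha>"
    using p by (simp_all add: Fib_E)
  show ?thesis
    using push_Seq[OF q p(2), of "pull p p' \<alpha>" "kernel R p'"] kernel_Fib[OF q(2) p(2) eq(2)]
      push_Seq[OF q(1) p, of "kernel R p" "pull p p' \<alpha>"] kernel_Fib[OF q(1) p(1) eq(1)] pl eq D k p \<alpha>
    by simp
qed

text \<open>Dual comparison, between the kernel objects of two covers of one object: the diagonal
  downstairs is pulled back along different covers on the two sides.\<close>

lemma graph_iso_pull:
  assumes p: "cov p" and q: "cov q" and eq: "Cod R p = Cod R q"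
  shows "graph_iso E (ker_obj p) (ker_obj q) (pull p q (Dia R (Cod R q)))"
proof -
  have d: "Dia R (Cod R q) \<in> Fib R (Cod R q) (Cod R q)" "is_graph R (Cod R q) (Cod R q) (Dia R (Cod R q))"
    using q by (simp_all add: is_graph_Dia)
  have "Conv R (Dom R p) (Dom R q) (pull p q (Dia R (Cod R q))) = pull q p (Dia R (Cod R q))"
    using pull_Conv[OF p q, of "Dia R (Cod R q)"] eq d q by simp
  then show ?thesis
    using is_graph_pull[OF p q, of "Dia R (Cod R q)"] is_graph_pull[OF q p, of "Dia R (Cod R q)"] d eq p q
      pull_Seq[OF p q p, of "Dia R (Cod R q)" "Dia R (Cod R q)"]
      pull_Seq[OF q p q, of "Dia R (Cod R q)" "Dia R (Cod R q)"] pull_Dia[OF p] pull_Dia[OF q]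
    by (simp add: graph_iso_def)
qed

text \<open>Both sides are \<open>pull p q' (push q q' \<beta>)\<close>, the diagonals being neutral
  downstairs.\<close>

lemma pull_push_natural:
  assumes p: "cov p" "cov p'" and q: "cov q" "cov q'"
    and eq: "Cod R p = Cod R q" "Cod R p' = Cod R q'"
    and \<beta>: "\<beta> \<in> Fib E (ker_obj q) (ker_obj q')"
  shows "Seq R (Dom R p) (Dom R p') (Dom R q') (pull p p' (push q q' \<beta>)) (pull p' q' (Dia R (Cod R q'))) =
    Seq R (Dom R p) (Dom R q) (Dom R q') (pull p q (Dia R (Cod R q))) \<beta>"
proof -
  have b: "push q q' \<beta> \<in> Fib R (Cod R q) (Cod R q')" using q \<beta> by simp
  show ?thesis
    using pull_Seq[OF p q(2), of "push q q' \<beta>" "Dia R (Cod R q')"]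
      pull_Seq[OF p(1) q, of "Dia R (Cod R q)" "push q q' \<beta>"] b eq q \<beta> by simp
qed

text \<open>Makes \<open>(X, d\<^sub>X)\<close> the kernel object of a cover of X, so that
  \<open>graph_iso_push\<close> can compare X with any other quotient of
  \<open>(X, d\<^sub>X)\<close>.\<close>

lemma cov_Ide:
  assumes X: "X \<in> \<G>"
  shows "cov (Ide R X)" "ker_obj (Ide R X) = (X, Dia R X)" "Cod R (Ide R X) = X"
proof -
  note o = G_Obj[OF X] and i = Ide_hom[OF G_Obj[OF X]]
  show c: "Cod R (Ide R X) = X" using i by (simp add: hom_def)
  have k: "kernel R (Ide R X) = Dia R X" using o by (simp add: kernel_eq[OF i])
  then show "ker_obj (Ide R X) = (X, Dia R X)" using i by (simp add: ker_obj_def hom_def)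
  have "quotient_arrow R X (Dia R X) (Ide R X)"
  proof (rule quotient_arrowI[OF ext _ i])
    show "equivalence_rel R X (Dia R X)" using o by (simp add: equivalence_rel_iff leq_refl)
    show "Le R X X (Dia R X) (kernel R (Ide R X))" using o k by (simp add: le_refl)
    show "descent R (Ide R X)" using o by (simp add: descent_iff[OF i])
    show "\<exists>h\<in>hom R X Z. graph R f = Seq R X X Z (graph R (Ide R X)) (graph R h)"
      if f: "f \<in> hom R X Z" for f Z
      by (rule bexI[of _ f]) (use f o hom_Obj[OF f] in simp_all)
  qed
  then show "cov (Ide R X)" using X i by (auto simp: cov_def is_quotient_arrow_def hom_def)
qed

text \<open>F sends X to the kernel object of its cover \<open>p X\<close>, and G sends an object of
  the completion to the codomain of its quotient \<open>q A\<close>. On relations they are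
  \<open>pull\<close> and \<open>push\<close>; the discrepancy between the choices is measured by
  \<open>graph_iso_push\<close> and \<open>graph_iso_pull\<close>.\<close>

lemma equivalence_exists:
  "\<exists>F G. EQRD_equivalence R E F G \<and> iso_arrows S R (comp_arrow G (eq_unit S)) inclusion"
proof -
  interpret S: relational_doctrine S by (rule relational_doctrine_S)
  interpret E: relational_doctrine E by (rule relational_doctrine_E)
  have R: "relational_doctrine R" by (rule relational_doctrine_axioms)
  have "\<forall>X\<in>Obj R. \<exists>p. cov p \<and> Cod R p = X"
  proof
    fix X assume "X \<in> Obj R"
    then obtain P p where "P \<in> \<G>" "p \<in> hom R P X" "is_quotient_arrow R p"
      using cover unfolding projective_cover_def by blast
    then show "\<exists>p. cov p \<and> Cod R p = X" by (intro exI[of _ p]) (simp add: cov_def hom_def)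
  qed
  then obtain p where p: "\<And>X. X \<in> Obj R \<Longrightarrow> cov (p X)" and Cp: "\<And>X. X \<in> Obj R \<Longrightarrow> Cod R (p X) = X"
    by metis
  have "\<forall>A\<in>Obj E. \<exists>q. cov q \<and> ker_obj q = A"
  proof
    fix A assume "A \<in> Obj E"
    then have A: "fst A \<in> \<G>" "equivalence_rel R (fst A) (snd A)" by (simp_all only: Obj_E)
    then obtain q where q: "quotient_arrow R (fst A) (snd A) q"
      using quot G_Obj unfolding has_quotients_def by blast
    then have "Dom R q = fst A" using quotient_arrow_hom[OF q] by (simp add: hom_def)
    then show "\<exists>q. cov q \<and> ker_obj q = A"
      using A q quotient_arrow_effective_descent(1)[OF quot q]
      by (intro exI[of _ q]) (auto simp: cov_def ker_obj_def is_quotient_arrow_def)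
  qed
  then obtain q where q: "\<And>A. A \<in> Obj E \<Longrightarrow> cov (q A)" and Kq: "\<And>A. A \<in> Obj E \<Longrightarrow> ker_obj (q A) = A"
    by metis
  have Dq: "Dom R (q A) = fst A" "kernel R (q A) = snd A" if "A \<in> Obj E" for A
    using arg_cong[OF Kq[OF that], of fst] arg_cong[OF Kq[OF that], of snd] by simp_all
  let ?p = "\<lambda>X Y. pull (p X) (p Y)" and ?q = "\<lambda>A B. push (q A) (q B)"
  have pcl: "?p X Y \<alpha> \<in> Fib E (ker_obj (p X)) (ker_obj (p Y))"
    if "X \<in> Obj R" "Y \<in> Obj R" "\<alpha> \<in> Fib R X Y" for X Y \<alpha>
    using pull_closed[OF p p, of X Y \<alpha>] Cp that by simp
  have qcl: "?q A B \<beta> \<in> Fib R (Cod R (q A)) (Cod R (q B))"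
    if "A \<in> Obj E" "B \<in> Obj E" "\<beta> \<in> Fib E A B" for A B \<beta>
    using push_closed[OF q q, of A B \<beta>] Kq that by simp
  have p_graph: "is_graph E (ker_obj (p X)) (ker_obj (p Y)) (?p X Y \<alpha>) \<longleftrightarrow> is_graph R X Y \<alpha>"
    if "X \<in> Obj R" "Y \<in> Obj R" "\<alpha> \<in> Fib R X Y" for X Y \<alpha>
    using is_graph_pull[OF p p, of X Y \<alpha>] Cp that by simp
  \<comment> \<open>This is \<open>is_graph_pull\<close> at the pushed relation, which pulls back to
    \<beta>.\<close>
  have q_graph: "is_graph R (Cod R (q A)) (Cod R (q B)) (?q A B \<beta>) \<longleftrightarrow> is_graph E A B \<beta>"
    if "A \<in> Obj E" "B \<in> Obj E" "\<beta> \<in> Fib E A B" for A B \<beta>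
    using is_graph_pull[OF q q, of A B "?q A B \<beta>"] qcl[OF that] pull_push[OF q q, of A B \<beta>] Kq that
    by simp
  obtain F where F: "rd_arrow R E F" and Fo: "ObMap F = (\<lambda>X. ker_obj (p X))" and Fr: "RelMap F = ?p"
  proof (rule rd_arrow_ex[OF R relational_doctrine_E extensional_E, of "\<lambda>X. ker_obj (p X)" ?p])
    show "ker_obj (p X) \<in> Obj E" if "X \<in> Obj R" for X using p that by (intro ker_obj_closed)
    show "is_graph E (ker_obj (p X)) (ker_obj (p Y)) (?p X Y \<alpha>)" if "is_graph R X Y \<alpha>" for X Y \<alpha>
      using that p_graph is_graphD[OF that] by simp
    show "Le E (ker_obj (p X)) (ker_obj (p Y)) (?p X Y \<alpha>) (?p X Y \<beta>)"
      if "X \<in> Obj R" "Y \<in> Obj R" "\<alpha> \<in> Fib R X Y" "\<beta> \<in> Fib R X Y" "Le R X Y \<alpha> \<beta>" for X Y \<alpha> \<beta>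
      using pull_mono[OF p p, of X Y \<alpha> \<beta>] Cp that by simp
    show "?p X X (Dia R X) = Dia E (ker_obj (p X))" if "X \<in> Obj R" for X
      using pull_Dia[OF p[OF that]] Cp[OF that] by simp
    show "?p X Z (Seq R X Y Z \<alpha> \<beta>) =
        Seq E (ker_obj (p X)) (ker_obj (p Y)) (ker_obj (p Z)) (?p X Y \<alpha>) (?p Y Z \<beta>)"
      if "X \<in> Obj R" "Y \<in> Obj R" "Z \<in> Obj R" "\<alpha> \<in> Fib R X Y" "\<beta> \<in> Fib R Y Z" for X Y Z \<alpha> \<beta>
      using pull_Seq[OF p p p, of X Y Z \<alpha> \<beta>] Cp that by simp
    show "?p Y X (Conv R X Y \<alpha>) = Conv E (ker_obj (p X)) (ker_obj (p Y)) (?p X Y \<alpha>)"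
      if "X \<in> Obj R" "Y \<in> Obj R" "\<alpha> \<in> Fib R X Y" for X Y \<alpha>
      using pull_Conv[OF p p, of X Y \<alpha>] Cp that by simp
  qed (use pcl in blast)+
  obtain G where G: "rd_arrow E R G" and Go: "ObMap G = (\<lambda>A. Cod R (q A))" and Gr: "RelMap G = ?q"
  proof (rule rd_arrow_ex[OF relational_doctrine_E R ext, of "\<lambda>A. Cod R (q A)" ?q])
    show "Cod R (q A) \<in> Obj R" if "A \<in> Obj E" for A using q that by (intro cov_Obj)
    show "is_graph R (Cod R (q A)) (Cod R (q B)) (?q A B \<beta>)" if "is_graph E A B \<beta>" for A B \<beta>
      using that q_graph E.is_graphD[OF that] by blast
    show "Le R (Cod R (q A)) (Cod R (q B)) (?q A B \<alpha>) (?q A B \<beta>)"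
      if "A \<in> Obj E" "B \<in> Obj E" "\<alpha> \<in> Fib E A B" "\<beta> \<in> Fib E A B" "Le E A B \<alpha> \<beta>" for A B \<alpha> \<beta>
      using push_mono[OF q q, of A B \<alpha> \<beta>] Dq Fib_E[OF that(1,2)] that by simp
    show "?q A A (Dia E A) = Dia R (Cod R (q A))" if "A \<in> Obj E" for A
      using push_Dia[OF q[OF that]] Dq[OF that] by simp
    show "?q A D (Seq E A B D \<alpha> \<beta>) =
        Seq R (Cod R (q A)) (Cod R (q B)) (Cod R (q D)) (?q A B \<alpha>) (?q B D \<beta>)"
      if "A \<in> Obj E" "B \<in> Obj E" "D \<in> Obj E" "\<alpha> \<in> Fib E A B" "\<beta> \<in> Fib E B D" for A B D \<alpha> \<beta>
      using push_Seq[OF q q q, of A B D \<alpha> \<beta>] Kq Dq that by simp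
    show "?q B A (Conv E A B \<alpha>) = Conv R (Cod R (q A)) (Cod R (q B)) (?q A B \<alpha>)"
      if "A \<in> Obj E" "B \<in> Obj E" "\<alpha> \<in> Fib E A B" for A B \<alpha>
      using push_Conv[OF q q, of A B \<alpha>] Dq Fib_E[OF that(1,2)] that by simp
  qed (use qcl in blast)+
  interpret F: rd_arrow R E F by (rule F)
  interpret G: rd_arrow E R G by (rule G)
  let ?GF = "\<lambda>X. push (q (ker_obj (p X))) (p X) (kernel R (p X))"
  have K: "ker_obj (p X) \<in> Obj E" if "X \<in> Obj R" for X using p that by (intro ker_obj_closed)
  have GF: "graph_iso R (Cod R (q (ker_obj (p X)))) X (?GF X)" if X: "X \<in> Obj R" for X
    using graph_iso_push[OF q[OF K[OF X]] p[OF X] Kq[OF K[OF X]]] Cp[OF X] by simp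
  let ?FG = "\<lambda>A. pull (p (Cod R (q A))) (q A) (Dia R (Cod R (q A)))"
  have W: "Cod R (q A) \<in> Obj R" if "A \<in> Obj E" for A using q that by (intro cov_Obj)
  have FG: "graph_iso E (ker_obj (p (Cod R (q A)))) A (?FG A)" if A: "A \<in> Obj E" for A
    using graph_iso_pull[OF p[OF W[OF A]] q[OF A] Cp[OF W[OF A]]] Kq[OF A] by simp
  have isoR: "iso_arrows R R (comp_arrow G F) id_arrow"
  proof (rule iso_arrowsI[OF rd_arrow_comp[OF F G] rd_arrow_id[OF R] ext, of ?GF])
    fix X assume X: "X \<in> Obj R"
    show "graph_iso R (ObMap (comp_arrow G F) X) (ObMap id_arrow X) (?GF X)"
      using GF[OF X] by (simp add: Fo Go)
    fix Y \<alpha> assume Y: "Y \<in> Obj R" and \<alpha>: "\<alpha> \<in> Fib R X Y"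
    show "Seq R (ObMap (comp_arrow G F) X) (ObMap (comp_arrow G F) Y) (ObMap id_arrow Y)
        (RelMap (comp_arrow G F) X Y \<alpha>) (?GF Y) =
      Seq R (ObMap (comp_arrow G F) X) (ObMap id_arrow X) (ObMap id_arrow Y) (?GF X)
        (RelMap id_arrow X Y \<alpha>)"
      using push_pull_natural[OF q[OF K[OF X]] q[OF K[OF Y]] p[OF X] p[OF Y] Kq[OF K[OF X]] Kq[OF K[OF Y]],
          of \<alpha>] Cp[OF X] Cp[OF Y] \<alpha>
      by (simp add: Fo Go Fr Gr)
  qed
  have isoE: "iso_arrows E E (comp_arrow F G) id_arrow"
  proof (rule iso_arrowsI[OF rd_arrow_comp[OF G F] rd_arrow_id[OF relational_doctrine_E] extensional_E,
        of ?FG])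
    fix A assume A: "A \<in> Obj E"
    show "graph_iso E (ObMap (comp_arrow F G) A) (ObMap id_arrow A) (?FG A)"
      using FG[OF A] by (simp add: Fo Go)
    fix B \<alpha> assume B: "B \<in> Obj E" and \<alpha>: "\<alpha> \<in> Fib E A B"
    show "Seq E (ObMap (comp_arrow F G) A) (ObMap (comp_arrow F G) B) (ObMap id_arrow B)
        (RelMap (comp_arrow F G) A B \<alpha>) (?FG B) =
      Seq E (ObMap (comp_arrow F G) A) (ObMap id_arrow A) (ObMap id_arrow B) (?FG A)
        (RelMap id_arrow A B \<alpha>)"
      using pull_push_natural[OF p[OF W[OF A]] p[OF W[OF B]] q[OF A] q[OF B] Cp[OF W[OF A]] Cp[OF W[OF B]],
          of \<alpha>] Kq[OF A] Kq[OF B] Dq[OF A] Dq[OF B] \<alpha>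
      by (simp add: Fo Go Fr Gr)
  qed
  \<comment> \<open>For X in \<open>\<G>\<close>, the chosen quotient of
    \<open>(X, d\<^sub>X)\<close> and the identity of X are covers with the same kernel object, so
    the required isomorphism is another instance of \<open>graph_iso_push\<close>.\<close>
  have isoS: "iso_arrows S R (comp_arrow G (eq_unit S)) inclusion"
  proof (rule iso_arrowsI[OF rd_arrow_comp[OF S.rd_arrow_eq_unit G] rd_arrow_inclusion ext,
        of "\<lambda>X. push (q (X, Dia R X)) (Ide R X) (Dia R X)"])
    show "\<G> \<subseteq> Obj R" using G_Obj by blast
    have K': "(X, Dia R X) \<in> Obj E" if "X \<in> \<G>" for X
      using ker_obj_closed[OF cov_Ide(1)[OF that]] cov_Ide(2)[OF that] by simp
    have k: "kernel R (Ide R X) = Dia R X" "Dom R (Ide R X) = X" if "X \<in> \<G>" for X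
      using cov_Ide(2)[OF that] by (simp_all add: ker_obj_def)
    have eq: "ker_obj (q (X, Dia R X)) = ker_obj (Ide R X)" if "X \<in> \<G>" for X
      using Kq[OF K'[OF that]] cov_Ide(2)[OF that] by simp
    fix X assume "X \<in> Obj S"
    then have X: "X \<in> \<G>" by simp
    show "graph_iso R (ObMap (comp_arrow G (eq_unit S)) X) (ObMap inclusion X)
        (push (q (X, Dia R X)) (Ide R X) (Dia R X))"
      using graph_iso_push[OF q[OF K'[OF X]] cov_Ide(1)[OF X] eq[OF X]] cov_Ide(3)[OF X] k[OF X]
      by (simp add: Go)
    fix Y \<alpha> assume "Y \<in> Obj S" and "\<alpha> \<in> Fib S X Y"
    then have Y: "Y \<in> \<G>" and \<alpha>: "\<alpha> \<in> Fib R X Y" by simp_all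
    have "pull (Ide R X) (Ide R Y) \<alpha> = \<alpha>"
      using \<alpha> G_Obj[OF X] G_Obj[OF Y] k[OF X] k[OF Y] cov_Ide(3)[OF X] cov_Ide(3)[OF Y]
      by (simp add: pull_def)
    then show "Seq R (ObMap (comp_arrow G (eq_unit S)) X) (ObMap (comp_arrow G (eq_unit S)) Y)
        (ObMap inclusion Y) (RelMap (comp_arrow G (eq_unit S)) X Y \<alpha>)
        (push (q (Y, Dia R Y)) (Ide R Y) (Dia R Y)) =
      Seq R (ObMap (comp_arrow G (eq_unit S)) X) (ObMap inclusion X) (ObMap inclusion Y)
        (push (q (X, Dia R X)) (Ide R X) (Dia R X)) (RelMap inclusion X Y \<alpha>)"
      using push_pull_natural[OF q[OF K'[OF X]] q[OF K'[OF Y]] cov_Ide(1)[OF X] cov_Ide(1)[OF Y]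
          eq[OF X] eq[OF Y], of \<alpha>] cov_Ide(3)[OF X] cov_Ide(3)[OF Y] k[OF X] k[OF Y] \<alpha>
      by (simp add: Go Gr)
  qed
  \<comment> \<open>Since \<open>push\<close> is a monotone inverse of \<open>pull\<close>,
    relations are hit and the order is reflected; essential surjectivity is the isomorphism between
    \<open>FG(A)\<close> and A read backwards.\<close>
  have "preserves_quotients R E F"
  proof (rule preserves_quotientsI[OF F quot extensional_E])
    fix X Y assume X: "X \<in> Obj R" and Y: "Y \<in> Obj R"
    note pX = p[OF X] p[OF Y] Cp[OF X] Cp[OF Y]
    show "\<exists>\<alpha>\<in>Fib R X Y. RelMap F X Y \<alpha> = \<beta>" if "\<beta> \<in> Fib E (ObMap F X) (ObMap F Y)" for \<beta>
      using that pull_push[OF pX(1,2), of \<beta>] push_closed[OF pX(1,2), of \<beta>] pX(3,4) by (auto simp: Fo Fr)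
    fix \<alpha> assume \<alpha>: "\<alpha> \<in> Fib R X Y"
    show "is_graph R X Y \<alpha>" if "is_graph E (ObMap F X) (ObMap F Y) (RelMap F X Y \<alpha>)"
      using that p_graph[OF X Y \<alpha>] by (simp add: Fo Fr)
    show "Le R X Y \<alpha> \<beta>" if "\<beta> \<in> Fib R X Y"
      "Le E (ObMap F X) (ObMap F Y) (RelMap F X Y \<alpha>) (RelMap F X Y \<beta>)" for \<beta>
      using that \<alpha> pX push_mono[OF pX(1,2), of "?p X Y \<alpha>" "?p X Y \<beta>"]
        push_pull[OF pX(1,2), of \<alpha>] push_pull[OF pX(1,2), of \<beta>]
        pull_Fib[OF pX(1,2), of \<alpha>] pull_Fib[OF pX(1,2), of \<beta>] by (simp add: Fo Fr)
  next
    show "\<exists>Y\<in>Obj R. \<exists>\<tau>. graph_iso E A (ObMap F Y) \<tau>" if "A \<in> Obj E" for A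
      using E.graph_iso_sym[OF FG[OF that]] W[OF that] unfolding Fo by blast
  qed
  moreover have "preserves_quotients E R G"
  proof (rule preserves_quotientsI[OF G S.has_quotients_eq_completion ext])
    fix A B assume A: "A \<in> Obj E" and B: "B \<in> Obj E"
    note qA = q[OF A] q[OF B] Kq[OF A] Kq[OF B]
    show "\<exists>\<alpha>\<in>Fib E A B. RelMap G A B \<alpha> = \<beta>" if "\<beta> \<in> Fib R (ObMap G A) (ObMap G B)" for \<beta>
      using that push_pull[OF qA(1,2), of \<beta>] pull_closed[OF qA(1,2), of \<beta>] qA(3,4)
      unfolding Go Gr by force
    fix \<alpha> assume \<alpha>: "\<alpha> \<in> Fib E A B"
    show "is_graph E A B \<alpha>" if "is_graph R (ObMap G A) (ObMap G B) (RelMap G A B \<alpha>)"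
      using that q_graph[OF A B \<alpha>] by (simp add: Go Gr)
    show "Le E A B \<alpha> \<beta>" if "\<beta> \<in> Fib E A B"
      "Le R (ObMap G A) (ObMap G B) (RelMap G A B \<alpha>) (RelMap G A B \<beta>)" for \<beta>
      using that \<alpha> qA Dq[OF A] Dq[OF B] pull_mono[OF qA(1,2), of "?q A B \<alpha>" "?q A B \<beta>"]
        pull_push[OF qA(1,2), of \<alpha>] pull_push[OF qA(1,2), of \<beta>] qcl[OF A B] by (simp add: Go Gr)
  next
    show "\<exists>A\<in>Obj E. \<exists>\<tau>. graph_iso R X (ObMap G A) \<tau>" if "X \<in> Obj R" for X
      using graph_iso_sym[OF GF[OF that]] K[OF that] unfolding Go by blast
  qed
  moreover have "EQRD_object R" by (simp add: EQRD_object_def R ext quot)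
  ultimately have "EQRD_equivalence R E F G"
    using isoR isoE F G S.EQRD_object_eq_completion by (simp add: EQRD_equivalence_def EQRD_arrow_def)
  then show ?thesis using isoS by blast
qed

end

section \<open>From an equivalence to a projective cover\<close>

lemma projectiveD:
  assumes "projective R P" "f \<in> hom R P Y" "q \<in> hom R Z Y" "is_quotient_arrow R q"
  obtains h where "h \<in> hom R P Z" "f = Comp R q h"
  using assms unfolding projective_def hom_def by blast

lemma projectiveI:
  assumes "P \<in> Obj R"
    and "\<And>f q Y Z. f \<in> hom R P Y \<Longrightarrow> q \<in> hom R Z Y \<Longrightarrow> is_quotient_arrow R q \<Longrightarrow>
      \<exists>h\<in>hom R P Z. f = Comp R q h"
  shows "projective R P"
  unfolding projective_def
proof (intro conjI allI impI)
  show "P \<in> Obj R" by fact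
  fix f q
  assume *: "f \<in> Arr R \<and> Dom R f = P \<and> is_quotient_arrow R q \<and> Cod R q = Cod R f"
  then have "q \<in> Arr R" by (auto simp: is_quotient_arrow_def quotient_arrow_def)
  with * have "f \<in> hom R P (Cod R f)" "q \<in> hom R (Dom R q) (Cod R f)" by (simp_all add: hom_def)
  then show "\<exists>h. h \<in> hom R P (Dom R q) \<and> f = Comp R q h" using assms(2) * by blast
qed

context relational_doctrine
begin

lemma projective_iso:
  assumes X: "projective R X" and ij: "iso_pair R P X i j"
  shows "projective R P"
proof (rule projectiveI)
  have i: "i \<in> hom R P X" and j: "j \<in> hom R X P" and ji: "Comp R j i = Ide R P"
    using ij by (simp_all add: iso_pair_def)
  show "P \<in> Obj R" using hom_Obj[OF i] by simp
  fix f q Y Z assume f: "f \<in> hom R P Y" and q: "q \<in> hom R Z Y" "is_quotient_arrow R q"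
  obtain h where h: "h \<in> hom R X Z" "Comp R f j = Comp R q h"
    using projectiveD[OF X Comp_hom[OF j f] q] .
  have "Comp R q (Comp R h i) = Comp R (Comp R f j) i"
    using Comp_assoc[OF i h(1) q(1)] h(2) by simp
  also have "\<dots> = f" using Comp_assoc[OF i j f] ji Comp_Ide_right[OF f] by simp
  finally show "\<exists>h\<in>hom R P Z. f = Comp R q h" using Comp_hom[OF i h(1)] by metis
qed

text \<open>
  Up to isomorphism, a quotient arrow of the completion is represented by an identity of the base,
  so any representative of an arrow into its codomain is also a lift; no compatibility is required
  of the lift, the domain carrying the diagonal.
\<close>

lemma projective_eq_completion:
  assumes X: "X \<in> Obj R"
  shows "projective (eq_completion R) (X, Dia R X)"
proof (rule projectiveI)
  interpret Q: relational_doctrine "eq_completion R" by (rule relational_doctrine_eq_completion)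
  let ?D = "(X, Dia R X)"
  note D = dia_eq_obj[OF X]
  show "?D \<in> Obj (eq_completion R)" using D by simp
  fix f q Y Z assume f: "f \<in> hom (eq_completion R) ?D Y" and hq: "q \<in> hom (eq_completion R) Z Y"
    and "is_quotient_arrow (eq_completion R) q"
  then obtain \<tau> where q: "quotient_arrow (eq_completion R) Z \<tau> q"
    by (auto simp: is_quotient_arrow_def hom_def)
  have cq: "Cod (eq_completion R) q = Y" using hq by (simp add: hom_def)
  have Z: "Z \<in> eq_obj R" using Q.hom_Obj[OF hq] by simp
  have \<tau>: "equivalence_rel (eq_completion R) Z \<tau>" using q by (simp add: quotient_arrow_def)
  let ?T = "(fst Z, \<tau>)" and ?r = "eq_arr R Z (fst Z, \<tau>) (Ide R (fst Z))"
  note r = quotient_arrow_eq_completion[OF Z \<tau>] and z = eq_objD[OF Z]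
  have cr: "Cod (eq_completion R) ?r = ?T" using r(3) by (simp add: hom_def)
  \<comment> \<open>Uniqueness of quotients replaces q by the canonical quotient arrow
    \<open>?r\<close> of the same relation, up to an isomorphism of codomains.\<close>
  obtain i j where ij: "iso_pair (eq_completion R) ?T Y i j" and qi: "q = Comp (eq_completion R) i ?r"
    using Q.quotient_arrow_iso[OF r(2) q] unfolding cr cq by metis
  have i: "i \<in> hom (eq_completion R) ?T Y" and j: "j \<in> hom (eq_completion R) Y ?T"
    and eq: "Comp (eq_completion R) i j = Ide (eq_completion R) Y"
    using ij by (simp_all only: iso_pair_def)
  note jf = Q.Comp_hom[OF f j]
  obtain g where g: "g \<in> hom R X (fst Z)"
    "graph (eq_completion R) (Comp (eq_completion R) j f) = Seq R X (fst Z) (fst Z) (graph R g) \<tau>"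
    using graph_eq_completion_ex[OF jf] by auto
  have t: "\<tau> \<in> Fib R (fst Z) (fst Z)" "Seq R (fst Z) (fst Z) (fst Z) (snd Z) \<tau> = \<tau>"
    using \<tau> by (simp_all add: equivalence_rel_def Fib_eq_completion[OF Z Z])
  let ?h = "eq_arr R ?D Z g"
  have "Seq R X (fst Z) (fst Z) (graph R g) (snd Z) \<in> Fib (eq_completion R) ?D Z"
    using X z g by (simp add: Fib_eq_completion[OF D Z])
  then have h: "?h \<in> hom (eq_completion R) ?D Z"
    "graph (eq_completion R) ?h = Seq R X (fst Z) (fst Z) (graph R g) (snd Z)"
    using eq_arr_graph[OF D Z, of g] g by simp_all
  \<comment> \<open>Composition with \<open>?r\<close> multiplies the graph of the lift by \<tau>,
    and \<tau> absorbs the relation of Z on its left.\<close>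
  have "Comp (eq_completion R) ?r ?h = Comp (eq_completion R) j f"
    by (rule Q.extensionalD[OF extensional_eq_completion Q.Comp_hom[OF h(1) r(3)] jf])
      (use X z g(1) t in \<open>simp add: Q.graph_Comp[OF h(1) r(3)] g(2) r(4) h(2)\<close>)
  then have "Comp (eq_completion R) q ?h = Comp (eq_completion R) i (Comp (eq_completion R) j f)"
    using Q.Comp_assoc[OF h(1) r(3) i] qi by simp
  also have "\<dots> = f"
    using Q.Comp_assoc[OF f j i] Q.Comp_Ide_left[OF f] by (simp only: eq)
  finally show "\<exists>h\<in>hom (eq_completion R) ?D Z. f = Comp (eq_completion R) q h"
    using h(1) by metis
qed

text \<open>The relation of A is an equivalence relation on \<open>(X, d\<^sub>X)\<close> in the
  completion too, and the quotient by it is A.\<close>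

lemma eq_completion_cover:
  assumes A: "A \<in> eq_obj R"
  obtains u where "u \<in> hom (eq_completion R) (fst A, Dia R (fst A)) A"
    "is_quotient_arrow (eq_completion R) u"
proof -
  let ?D = "(fst A, Dia R (fst A))"
  note a = eq_objD[OF A] and D = dia_eq_obj[OF eq_objD(1)[OF A]]
  interpret Q: relational_doctrine "eq_completion R" by (rule relational_doctrine_eq_completion)
  have e: "equivalence_rel (eq_completion R) ?D (snd A)"
    using a D by (simp add: Q.equivalence_rel_iff Q.leq_def Fib_eq_completion[OF D D] leqD)
  note r = quotient_arrow_eq_completion[OF D e, simplified]
  show ?thesis
    by (rule that[OF r(3)]) (use r(2,3) in \<open>auto simp: is_quotient_arrow_def hom_def\<close>)
qed

end

lemma iso_arrowsE:
  assumes "iso_arrows R S F G"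
  obtains \<theta> \<theta>' where "\<And>X. X \<in> Obj R \<Longrightarrow> iso_pair S (ObMap F X) (ObMap G X) (\<theta> X) (\<theta>' X)"
    "\<And>f X Y. f \<in> hom R X Y \<Longrightarrow> Comp S (\<theta> Y) (ArMap F f) = Comp S (ArMap G f) (\<theta> X)"
proof -
  obtain \<theta> \<theta>' where \<theta>: "two_arrow R S F G \<theta>" "two_arrow R S G F \<theta>'"
    "\<forall>X\<in>Obj R. Comp S (\<theta>' X) (\<theta> X) = Ide S (ObMap F X) \<and> Comp S (\<theta> X) (\<theta>' X) = Ide S (ObMap G X)"
    using assms unfolding iso_arrows_def by blast
  show ?thesis
    by (rule that[of \<theta> \<theta>']) (use \<theta> in \<open>auto simp: iso_pair_def two_arrow_def hom_def\<close>)
qed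

lemma preserves_quotients_is_quotient_arrow:
  assumes "preserves_quotients R S F" "is_quotient_arrow R q"
  shows "is_quotient_arrow S (ArMap F q)"
proof -
  obtain \<rho> where "quotient_arrow R (Dom R q) \<rho> q" using assms by (auto simp: is_quotient_arrow_def)
  then have "quotient_arrow S (ObMap F (Dom R q)) (RelMap F (Dom R q) (Dom R q) \<rho>) (ArMap F q)"
    using assms by (simp add: preserves_quotients_def)
  moreover from this have "Dom S (ArMap F q) = ObMap F (Dom R q)" by (simp add: quotient_arrow_def)
  ultimately show ?thesis by (auto simp: is_quotient_arrow_def)
qed

text \<open>A lifting problem for \<open>G(A)\<close> is moved to S by F, which preserves the
  quotient arrow. There it is solved because \<open>FG(A)\<close> is isomorphic to A; the solution
  is brought back by G and corrected by the natural isomorphism from \<open>GF\<close> to the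
  identity.\<close>

lemma projective_EQRD_equivalence:
  assumes eqv: "EQRD_equivalence R S F G" and A: "projective S A"
  shows "projective R (ObMap G A)"
proof (rule projectiveI)
  interpret F: rd_arrow R S F using eqv by (simp add: EQRD_equivalence_def EQRD_arrow_def)
  interpret G: rd_arrow S R G using eqv by (simp add: EQRD_equivalence_def EQRD_arrow_def)
  have oA: "A \<in> Obj S" using A by (simp add: projective_def)
  show P: "ObMap G A \<in> Obj R" using G.ObMap_closed[OF oA] .
  let ?P = "ObMap G A"
  have isos: "iso_arrows R R (comp_arrow G F) id_arrow" "iso_arrows S S (comp_arrow F G) id_arrow"
    using eqv by (simp_all add: EQRD_equivalence_def)
  obtain \<psi> \<psi>' where \<psi>: "\<And>X. X \<in> Obj R \<Longrightarrow> iso_pair R (ObMap G (ObMap F X)) X (\<psi> X) (\<psi>' X)"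
    and nat: "\<And>f X Y. f \<in> hom R X Y \<Longrightarrow> Comp R (\<psi> Y) (ArMap G (ArMap F f)) = Comp R f (\<psi> X)"
    by (rule iso_arrowsE[OF isos(1), simplified]) (rule that)
  obtain \<phi> \<phi>' where \<phi>: "\<And>B. B \<in> Obj S \<Longrightarrow> iso_pair S (ObMap F (ObMap G B)) B (\<phi> B) (\<phi>' B)"
    by (rule iso_arrowsE[OF isos(2), simplified]) (rule that)
  have A': "projective S (ObMap F ?P)" by (rule F.tgt.projective_iso[OF A \<phi>[OF oA]])
  fix f q Y Z assume f: "f \<in> hom R ?P Y" and q: "q \<in> hom R Z Y" "is_quotient_arrow R q"
  have "preserves_quotients R S F" using eqv by (simp add: EQRD_equivalence_def EQRD_arrow_def)
  then have "is_quotient_arrow S (ArMap F q)"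
    using q(2) by (rule preserves_quotients_is_quotient_arrow)
  then obtain m where m: "m \<in> hom S (ObMap F ?P) (ObMap F Z)" "ArMap F f = Comp S (ArMap F q) m"
    using projectiveD[OF A' F.ArMap_hom[OF f] F.ArMap_hom[OF q(1)]] by metis
  note oZ = F.src.hom_Obj(1)[OF q(1)] and oY = F.src.hom_Obj(2)[OF f]
  have \<psi>Z: "\<psi> Z \<in> hom R (ObMap G (ObMap F Z)) Z" and \<psi>Y: "\<psi> Y \<in> hom R (ObMap G (ObMap F Y)) Y"
    and \<psi>P: "\<psi> ?P \<in> hom R (ObMap G (ObMap F ?P)) ?P" "\<psi>' ?P \<in> hom R ?P (ObMap G (ObMap F ?P))"
      "Comp R (\<psi> ?P) (\<psi>' ?P) = Ide R ?P"
    using \<psi>[OF oZ] \<psi>[OF oY] \<psi>[OF P] by (simp_all add: iso_pair_def)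
  note Gm = G.ArMap_hom[OF m(1)] and Fq = F.ArMap_hom[OF q(1)]
  let ?n = "Comp R (\<psi> Z) (ArMap G m)"
  have n: "?n \<in> hom R (ObMap G (ObMap F ?P)) Z" using F.src.Comp_hom[OF Gm \<psi>Z] .
  have "Comp R f (\<psi> ?P) = Comp R (\<psi> Y) (Comp R (ArMap G (ArMap F q)) (ArMap G m))"
    using nat[OF f] m(2) G.ArMap_Comp[OF m(1) Fq] by simp
  also have "\<dots> = Comp R (Comp R q (\<psi> Z)) (ArMap G m)"
    using F.src.Comp_assoc[OF Gm G.ArMap_hom[OF Fq] \<psi>Y] nat[OF q(1)] by simp
  also have "\<dots> = Comp R q ?n" using F.src.Comp_assoc[OF Gm \<psi>Z q(1)] by simp
  finally have "Comp R q (Comp R ?n (\<psi>' ?P)) = Comp R (Comp R f (\<psi> ?P)) (\<psi>' ?P)"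
    using F.src.Comp_assoc[OF \<psi>P(2) n q(1)] by simp
  also have "\<dots> = f"
    using F.src.Comp_assoc[OF \<psi>P(2,1) f] \<psi>P(3) F.src.Comp_Ide_right[OF f] by simp
  finally show "\<exists>h\<in>hom R ?P Z. f = Comp R q h" using F.src.Comp_hom[OF \<psi>P(2) n] by metis
qed

theorem corollary3p8:
  fixes R :: "('o, 'a, 'r) reldoc" and \<G> :: "'o set"
  assumes "relational_doctrine R" and "extensional R" and "has_quotients R"
    and "\<G> \<subseteq> Obj R"
  shows "projective_cover R \<G> \<longleftrightarrow>
    (\<exists>F G. EQRD_equivalence R (eq_completion (restriction R \<G>)) F G \<and>
      iso_arrows (restriction R \<G>) R (comp_arrow G (eq_unit (restriction R \<G>))) inclusion)"
proof
  assume "projective_cover R \<G>"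
  then interpret projectively_covered R \<G>
    using assms by (simp add: projectively_covered_def projectively_covered_axioms_def)
  show "\<exists>F G. EQRD_equivalence R (eq_completion (restriction R \<G>)) F G \<and>
      iso_arrows (restriction R \<G>) R (comp_arrow G (eq_unit (restriction R \<G>))) inclusion"
    by (rule equivalence_exists)
next
  interpret R: relational_doctrine R by fact
  let ?S = "restriction R \<G>" and ?E = "eq_completion (restriction R \<G>)"
  interpret S: relational_doctrine ?S by (rule R.relational_doctrine_restriction) fact
  assume "\<exists>F G. EQRD_equivalence R ?E F G \<and>
      iso_arrows ?S R (comp_arrow G (eq_unit ?S)) inclusion"
  then obtain F G where eqv: "EQRD_equivalence R ?E F G"
    and iso: "iso_arrows ?S R (comp_arrow G (eq_unit ?S)) inclusion" by blast
  interpret F: rd_arrow R ?E F using eqv by (simp add: EQRD_equivalence_def EQRD_arrow_def)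
  interpret G: rd_arrow ?E R G using eqv by (simp add: EQRD_equivalence_def EQRD_arrow_def)
  have pres: "preserves_quotients ?E R G"
    using eqv by (simp add: EQRD_equivalence_def EQRD_arrow_def)
  let ?u = "\<lambda>P. (P, Dia R P)"
  \<comment> \<open>Here the equivalence being over the inclusion enters: it identifies
    \<open>G(P, d\<^sub>P)\<close> with the given object P of \<open>\<G>\<close>.\<close>
  obtain \<kappa> \<kappa>' where \<kappa>: "\<And>P. P \<in> \<G> \<Longrightarrow> iso_pair R (ObMap G (?u P)) P (\<kappa> P) (\<kappa>' P)"
    by (rule iso_arrowsE[OF iso, simplified]) (rule that)
  have isoR: "iso_arrows R R (comp_arrow G F) id_arrow" using eqv by (simp add: EQRD_equivalence_def)
  obtain \<psi> \<psi>' where \<psi>: "\<And>X. X \<in> Obj R \<Longrightarrow> iso_pair R (ObMap G (ObMap F X)) X (\<psi> X) (\<psi>' X)"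
    by (rule iso_arrowsE[OF isoR, simplified]) (rule that)
  show "projective_cover R \<G>"
    unfolding projective_cover_def
  proof (intro conjI ballI)
    show "\<G> \<subseteq> Obj R" by fact
    fix P assume P: "P \<in> \<G>"
    have "projective ?E (?u P)" using S.projective_eq_completion[of P] P by simp
    then have "projective R (ObMap G (?u P))" by (rule projective_EQRD_equivalence[OF eqv])
    then show "projective R P" by (rule R.projective_iso[OF _ iso_pair_sym[OF \<kappa>[OF P]]])
  next
    fix X assume X: "X \<in> Obj R"
    let ?A = "ObMap F X" and ?P = "fst (ObMap F X)"
    have A: "?A \<in> eq_obj ?S" using F.ObMap_closed[OF X] by simp
    then have P: "?P \<in> \<G>" using S.eq_objD(1) by simp
    obtain u where u: "u \<in> hom ?E (?u ?P) ?A" "is_quotient_arrow ?E u"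
      using S.eq_completion_cover[OF A, unfolded restriction_simps] .
    \<comment> \<open>The canonical quotient arrow onto \<open>F(X)\<close> starts at
      \<open>(P, d\<^sub>P)\<close>; its image under G becomes an arrow from P to X after composing
      with the isomorphisms at both ends.\<close>
    let ?q = "Comp R (\<psi> X) (Comp R (ArMap G u) (\<kappa>' ?P))"
    note Gu = G.ArMap_hom[OF u(1)]
    have "is_quotient_arrow R ?q"
      by (rule R.is_quotient_arrow_conjugate[OF preserves_quotients_is_quotient_arrow[OF pres u(2)]
            Gu iso_pair_sym[OF \<kappa>[OF P]] \<psi>[OF X]])
    moreover have "?q \<in> hom R ?P X"
      using R.Comp_hom[OF R.Comp_hom[OF _ Gu]] \<kappa>[OF P] \<psi>[OF X] by (simp add: iso_pair_def)
    ultimately show "\<exists>P\<in>\<G>. \<exists>q. q \<in> hom R P X \<and> is_quotient_arrow R q" using P by blast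
  qed
qed

end
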